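(* Let $N\ge2$, $q\in\mathbb R\setminus\{-1,0,1\}$, $X=\mathrm S_q^{2N-1}$. From the free first order differential $*$-calculi $\Gamma_{\alpha\tau},\Gamma'_{\alpha\omega},\Gamma''_{\omega\psi},\Gamma'''_{\varrho\tau}$ (defined in the context), the following first order differential $*$-calculi are obtained by factorisation: 1. for any $\alpha\in\mathbb R\setminus\{0,q^{-2}\}$ (and any $\tau\in\mathbb R$, $\omega\in\mathbb R\setminus\{0\}$): $\Gamma_{\alpha\tau}/(\Omega_++\alpha^{-1}\Omega_-)=\Gamma'_{\alpha\omega}/(\Omega_++\alpha^{-1}\Omega_-)=\tilde\Gamma_{\alpha^{-1}}$; 2. for any $\omega\in\mathbb R\setminus\{0\}$, $\psi\in\mathbb R$, with $\lambda_1,\lambda_2$ the solutions of $q^{-4}\omega\lambda^2-q^{-2}\omega\psi\lambda+1=0$: $\Gamma''_{\omega\psi}/(\Omega_++\lambda_1\Omega_-)=\tilde\Gamma'_{\lambda_1}$ and $\Gamma''_{\omega\psi}/(\Omega_++\lambda_2\Omega_-)=\tilde\Gamma'_{\lambda_2}$; 3. for any $\varrho\in\mathbb R\setminus\{0,(\mathbf s'_+)^{-1}\}$, $\tau\in\mathbb R\setminus\{0\}$, with $\lambda_1=q^2\tau/\varrho$ and $\lambda_2=q^2(\mathbf s'_+\tau-q^2)/(\mathbf s'_+\varrho-1)$ ($\lambda_1=\lambda_2=q^4$ if $\tau=q^2\varrho$): $\Gamma'''_{\varrho\tau}/(\Omega_++\lambda_1\Omega_-)=\tilde\Gamma'_{\lambda_1}$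 and $\Gamma'''_{\varrho\tau}/(\Omega_++\lambda_2\Omega_-)=\tilde\Gamma''_{\lambda_2}$; 4. for $\varrho=(\mathbf s'_+)^{-1}$ and any $\tau\in\mathbb R\setminus\{0,q^2(\mathbf s'_+)^{-1}\}$, with $\lambda_1=q^2\tau/\varrho$: $\Gamma'''_{\varrho\tau}/(\Omega_++\lambda_1\Omega_-)=\tilde\Gamma'_{\lambda_1}$ and $\Gamma'''_{\varrho\tau}/(\Omega_-)=\tilde\Gamma''_\infty$; 5. for $\varrho=q^{-2}\tau=(\mathbf s'_+)^{-1}$ and any $\lambda\in\mathbb R$: $\Gamma'''_{\varrho\tau}/(\Omega_++\lambda\Omega_-)=\tilde\Gamma''_\lambda$ and $\Gamma'''_{\varrho\tau}/(\Omega_-)=\tilde\Gamma''_\infty$.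
   Context: Constants: $Q=q-q^{-1}$, $\mathbf s_+=\sum_{i=0}^{N-1}q^{2i}$, $\mathbf s'_+=\mathbf s_+-1$. All algebras are over $\mathbb C$. R-matrices ($N^2\times N^2$): $\hat R^{ij}_{kl}=1$ if $i=l\ne k=j$; $=q$ if $i=j=k=l$; $=Q$ if $i=k<j=l$; $=0$ otherwise. Its inverse $\hat R^-$: $\hat R^{-}{}^{ij}_{kl}=1$ if $i=l\ne k=j$; $=q^{-1}$ if $i=j=k=l$; $=-Q$ if $i=k>j=l$; $=0$ otherwise. Derived matrices: $\check R^{ij}_{kl}=\hat R^{lk}_{ji}$, $\acute R^{ij}_{kl}=\hat R^{ki}_{lj}$, $\grave R^{-}{}^{ij}_{kl}=q^{2l-2i}\hat R^{-}{}^{jl}_{ik}$. Repeated indices $s,t$ are summed from $1$ to $N$. Quantum sphere: $X=\mathrm S_q^{2N-1}$ is the unital $*$-algebra generated by $z_i,z^*_i$ ($i=1,\dots,N$), $(z_i)^*=z^*_i$, with defining relations $z_iz_j=qz_jz_i$ and $z^*_iz^*_j=q^{-1}z^*_jz^*_i$ for $i<j$; $z_iz^*_j=qz^*_jz_i$ for $i\ne j$; $z_iz^*_i-z^*_iz_i+q^{-1}Q\sum_{k>i}z_kz^*_k=0$; $\sum_{i=1}^Nz_iz^*_i=1$. First order differential calculus on $X$: a pair $(\Gamma,\mathrm d)$ of an $X$-bimodule $\Gamma$ and a linear map $\mathrm d:X\to\Gamma$ with $\mathrm d(xy)=(\mathrm dx)y+x\,\mathrm dy$ and $\Gamma=\mathrm{Lin}\{x\,\mathrm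 dy\mid x,y\in X\}$. $*$-calculus: $\sum_kx_k\,\mathrm dy_k=0$ implies $\sum_k\mathrm d(y_k^* )\,x_k^*=0$. Put $\Omega_+=\sum_iz_i\,\mathrm dz^*_i$, $\Omega_-=\sum_iq^{-2i}z^*_i\,\mathrm dz_i$. For $\Omega_0\in\Gamma$, $\Gamma/(\Omega_0)$ is the calculus obtained from $\Gamma$ by factorisation by the additional relation $\Omega_0=0$, i.e. the quotient of $\Gamma$ by the sub-bimodule generated by $\Omega_0$, with the induced differential. "$=$" between calculi means isomorphism of bimodules intertwining the differentials. (A) Free calculi: $\{\mathrm dz_i,\mathrm dz^*_i\mid i=1,\dots,N\}$ is a free left module basis and $$\begin{aligned} \mathrm dz_k\,z_l&=a_1\hat R^{-}{}^{st}_{kl}z_s\mathrm dz_t+b_1z_k\mathrm dz_l+c_1z_kz_l\Omega_++e_1z_kz_l\Omega_-,\\ \mathrm dz^*_k\,z^*_l&=a_2\check R^{st}_{kl}z^*_s\mathrm dz^*_t+b_2z^*_k\mathrm dz^*_l+c_2z^*_kz^*_l\Omega_++e_2z^*_kz^*_l\Omega_-,\\ \mathrm dz_k\,z^*_l&=a_3\grave R^{-}{}^{st}_{kl}z^*_s\mathrm dz_t+b_3z_k\mathrm dz^*_l+(c_3z_kz^*_l+d_3q^{2k}\delta_{kl})\Omega_++(e_3z_kz^*_l+f_3q^{2k}\delta_{kl})\Omega_-,\\ \mathrm dz^*_k\,z_l&=a_4\acute R^{st}_{kl}z_s\mathrm dz^*_t+b_4z^*_k\mathrm dz_l+(c_4z^*_kz_l+d_4\delta_{kl})\Omega_++(e_4z^*_kz_l+f_4\delta_{kl})\Omega_-.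 \end{aligned}$$ $\Gamma_{\alpha\tau}$ ($\alpha\in\mathbb R\setminus\{0,q^{-2}\}$, $\tau\in\mathbb R$): $a_1=a_4=q\alpha$, $a_2=a_3=q^{-1}\alpha^{-1}$; $b_1=b_3=q^2\alpha-1$, $b_2=b_4=q^{-2}\alpha^{-1}-1$; $c_1=q^2\alpha^2(1-\mathbf s'_+\tau)$, $c_2=1-\mathbf s'_+\tau$, $c_3=c_4=-q^2\alpha(1-\mathbf s_+\tau)$; $e_1=q^2(1-\alpha\mathbf s'_+\tau)$, $e_2=\alpha^{-2}(1-\alpha\mathbf s'_+\tau)$, $e_3=e_4=-\alpha^{-1}(1-q^2\alpha\mathbf s_+\tau)$; $d_3=-\alpha\tau$, $d_4=-q^{2N}\alpha\tau$, $f_3=-\tau$, $f_4=-q^{2N}\tau$. $\Gamma'_{\alpha\omega}$ (here only $\alpha\in\mathbb R\setminus\{0,q^{-2}\}$, $\omega\in\mathbb R\setminus\{0\}$ is needed): $a_1=a_4=q\alpha$, $a_2=a_3=q^{-1}\alpha^{-1}$; $b_1=b_3=q^2\alpha-1$, $b_2=b_4=q^{-2}\alpha^{-1}-1$; $c_1=\omega$, $c_2=q^2\alpha\omega^{-1}-(\alpha^{-1}-1)$, $c_3=c_4=-q^2\alpha$; $e_1=\alpha^{-1}\omega-q^2(\alpha-1)$, $e_2=q^2\omega^{-1}$, $e_3=e_4=-\alpha^{-1}$; $d_3=d_4=f_3=f_4=0$. $\Gamma''_{\omega\psi}$ ($\omega\in\mathbb R\setminus\{0\}$, $\psi\in\mathbb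 R$): $a_1=a_4=q^{-1}$, $a_2=a_3=q$; all $b_\nu=0$; $c_1=\omega$, $c_2=\psi-q^2$, $c_3=c_4=-1$; $e_1=q^2\omega\psi-1$, $e_2=q^2\omega^{-1}$, $e_3=e_4=-q^2$; $d_3=d_4=f_3=f_4=0$. $\Gamma'''_{\varrho\tau}$ ($\varrho,\tau\in\mathbb R\setminus\{0\}$): $a_1=a_4=q^{-1}$, $a_2=a_3=q$; all $b_\nu=0$; $c_1=-q^{-2}\frac{\varrho}{\tau}(\mathbf s'_+\varrho-1)$, $c_2=-\frac{\tau}{\varrho}(\mathbf s'_+\varrho-1)$, $c_3=c_4=\mathbf s_+\varrho-1$; $e_1=-\frac{\varrho}{\tau}(\mathbf s'_+\tau-q^2)$, $e_2=-q^2\frac{\tau}{\varrho}(\mathbf s'_+\tau-q^2)$, $e_3=e_4=q^2(\mathbf s_+\tau-1)$; $d_3=-q^{-2}\varrho$, $d_4=-q^{2N-2}\varrho$, $f_3=-\tau$, $f_4=-q^{2N}\tau$. (B) Calculi with one relation: as a left module the calculus is the quotient of the free left module on $\mathrm dz_i,\mathrm dz^*_i$ by the left submodule generated by $\Omega_++\lambda\Omega_-$ ($\lambda\in\mathbb C$) or by $\Omega_-$ ($\lambda=\infty$), and $$\begin{aligned} \mathrm dz_k\,z_l&=a_1\hat R^{-}{}^{st}_{kl}z_s\mathrm dz_t+b_1z_k\mathrm dz_l+c_1z_kz_l\Omega_1,\\ \mathrm dz^*_k\,z^*_l&=a_2\check R^{st}_{kl}z^*_s\mathrm dz^*_t+b_2z^*_k\mathrm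 dz^*_l+c_2z^*_kz^*_l\Omega_1,\\ \mathrm dz_k\,z^*_l&=a_3\grave R^{-}{}^{st}_{kl}z^*_s\mathrm dz_t+b_3z_k\mathrm dz^*_l+c_3z_kz^*_l\Omega_1+d_3q^{2k}\delta_{kl}\Omega_1,\\ \mathrm dz^*_k\,z_l&=a_4\acute R^{st}_{kl}z_s\mathrm dz^*_t+b_4z^*_k\mathrm dz_l+c_4z^*_kz_l\Omega_1+d_4\delta_{kl}\Omega_1, \end{aligned}$$ where coefficients not listed are $0$ and $\Omega_1=\Omega_+$ except where stated: $\tilde\Gamma_\lambda$ ($\lambda\in\mathbb C\setminus\{0,q^2\}$): $a_1=a_4=q\lambda^{-1}$, $a_2=a_3=q^{-1}\lambda$; $b_1=b_3=q^2\lambda^{-1}-1$, $b_2=b_4=q^{-2}\lambda-1$; $c_1=q^2\lambda^{-1}(\lambda^{-1}-1)$, $c_2=-(\lambda-1)$, $c_3=c_4=-(q^2\lambda^{-1}-1)$. $\tilde\Gamma'_\lambda$ ($\lambda\in\mathbb C\setminus\{0\}$): $a_1=a_4=q^{-1}$, $a_2=a_3=q$; $c_1=-\lambda^{-1}(q^4\lambda^{-1}-1)$, $c_2=-q^{-2}\lambda(q^4\lambda^{-1}-1)$, $c_3=c_4=q^2\lambda^{-1}-1$. $\tilde\Gamma''_\lambda$ ($\lambda\in\mathbb C\cup\{\infty\}$): $a_1=a_4=q^{-1}$, $a_2=a_3=q$; for $\lambda\notin\{0,\infty\}$: $c_3=c_4=-(\mathbf s'_+)^{-1}(q^{2N+2}\lambda^{-1}-1)$,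 $d_3=q^{-2}(\mathbf s'_+)^{-1}(q^4\lambda^{-1}-1)$, $d_4=q^{2N-2}(\mathbf s'_+)^{-1}(q^4\lambda^{-1}-1)$; for $\lambda=0$: $\Omega_1=\Omega_-$, $c_3=c_4=q^2(\mathbf s'_+)^{-1}$, $d_3=-q^{-2N+2}(\mathbf s'_+)^{-1}$, $d_4=-q^2(\mathbf s'_+)^{-1}$; for $\lambda=\infty$: $c_3=c_4=(\mathbf s'_+)^{-1}$, $d_3=-q^{-2}(\mathbf s'_+)^{-1}$, $d_4=-q^{2N-2}(\mathbf s'_+)^{-1}$.
   Formalization: The coefficients of Γ̃''_0 are corrected by a factor q^{2N} (c3=c4=q^{2N+2}/s'_+, d3=-q^2/s'_+, d4=-q^{2N+2}/s'_+), as no calculus has the printed ones; in item 2 the *-property is claimed only for real roots λ, since it fails for non-real ones. *)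

theory Defs
  imports Complex_Main "HOL-Algebra.QuotRing" "HOL-Algebra.Module" "HOL-Library.Poly_Mapping"
begin

section \<open>Complex *-algebras and first order differential calculi\<close>

record 'a star_alg = "'a ring" +
  cscale :: "complex \<Rightarrow> 'a \<Rightarrow> 'a"
  cstar :: "'a \<Rightarrow> 'a"

(* The left action is smult of the module record; its ring fields mult and one are not used. *)
record ('a, 'm) calculus = "('a, 'm) module" +
  rsmult :: "'m \<Rightarrow> 'a \<Rightarrow> 'm"
  diff :: "'a \<Rightarrow> 'm"

(* Scalars act on a bimodule through c . 1; the last assumption makes the left and the right
   complex structure agree, as is required of a bimodule over a complex algebra. *)
locale bimodule = A?: ring A + M?: abelian_group M
  for A :: "('a, 'c) star_alg_scheme" and M :: "('a, 'm, 'd) calculus_scheme" +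
  assumes lmult_closed: "\<lbrakk>x \<in> carrier A; m \<in> carrier M\<rbrakk> \<Longrightarrow> x \<odot>\<^bsub>M\<^esub> m \<in> carrier M"
    and rmult_closed: "\<lbrakk>x \<in> carrier A; m \<in> carrier M\<rbrakk> \<Longrightarrow> rsmult M m x \<in> carrier M"
    and lmult_add_left: "\<lbrakk>x \<in> carrier A; y \<in> carrier A; m \<in> carrier M\<rbrakk>
      \<Longrightarrow> (x \<oplus>\<^bsub>A\<^esub> y) \<odot>\<^bsub>M\<^esub> m = x \<odot>\<^bsub>M\<^esub> m \<oplus>\<^bsub>M\<^esub> y \<odot>\<^bsub>M\<^esub> m"
    and lmult_add_right: "\<lbrakk>x \<in> carrier A; m \<in> carrier M; n \<in> carrier M\<rbrakk>
      \<Longrightarrow> x \<odot>\<^bsub>M\<^esub> (m \<oplus>\<^bsub>M\<^esub> n) = x \<odot>\<^bsub>M\<^esub> m \<oplus>\<^bsub>M\<^esub> x \<odot>\<^bsub>M\<^esub> n"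
    and lmult_assoc: "\<lbrakk>x \<in> carrier A; y \<in> carrier A; m \<in> carrier M\<rbrakk>
      \<Longrightarrow> (x \<otimes>\<^bsub>A\<^esub> y) \<odot>\<^bsub>M\<^esub> m = x \<odot>\<^bsub>M\<^esub> (y \<odot>\<^bsub>M\<^esub> m)"
    and lmult_one: "m \<in> carrier M \<Longrightarrow> \<one>\<^bsub>A\<^esub> \<odot>\<^bsub>M\<^esub> m = m"
    and rmult_add_left: "\<lbrakk>x \<in> carrier A; m \<in> carrier M; n \<in> carrier M\<rbrakk>
      \<Longrightarrow> rsmult M (m \<oplus>\<^bsub>M\<^esub> n) x = rsmult M m x \<oplus>\<^bsub>M\<^esub> rsmult M n x"
    and rmult_add_right: "\<lbrakk>x \<in> carrier A; y \<in> carrier A; m \<in> carrier M\<rbrakk>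
      \<Longrightarrow> rsmult M m (x \<oplus>\<^bsub>A\<^esub> y) = rsmult M m x \<oplus>\<^bsub>M\<^esub> rsmult M m y"
    and rmult_assoc: "\<lbrakk>x \<in> carrier A; y \<in> carrier A; m \<in> carrier M\<rbrakk>
      \<Longrightarrow> rsmult M m (x \<otimes>\<^bsub>A\<^esub> y) = rsmult M (rsmult M m x) y"
    and rmult_one: "m \<in> carrier M \<Longrightarrow> rsmult M m \<one>\<^bsub>A\<^esub> = m"
    and lmult_rmult: "\<lbrakk>x \<in> carrier A; y \<in> carrier A; m \<in> carrier M\<rbrakk>
      \<Longrightarrow> rsmult M (x \<odot>\<^bsub>M\<^esub> m) y = x \<odot>\<^bsub>M\<^esub> rsmult M m y"
    and scalar_central: "m \<in> carrier M \<Longrightarrow>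
      cscale A c \<one>\<^bsub>A\<^esub> \<odot>\<^bsub>M\<^esub> m = rsmult M m (cscale A c \<one>\<^bsub>A\<^esub>)"

locale first_order_calculus = bimodule +
  assumes diff_closed: "x \<in> carrier A \<Longrightarrow> diff M x \<in> carrier M"
    and diff_add: "\<lbrakk>x \<in> carrier A; y \<in> carrier A\<rbrakk>
      \<Longrightarrow> diff M (x \<oplus>\<^bsub>A\<^esub> y) = diff M x \<oplus>\<^bsub>M\<^esub> diff M y"
    and diff_cscale: "x \<in> carrier A
      \<Longrightarrow> diff M (cscale A c x) = cscale A c \<one>\<^bsub>A\<^esub> \<odot>\<^bsub>M\<^esub> diff M x"
    and diff_mult: "\<lbrakk>x \<in> carrier A; y \<in> carrier A\<rbrakk>
      \<Longrightarrow> diff M (x \<otimes>\<^bsub>A\<^esub> y) = rsmult M (diff M x) y \<oplus>\<^bsub>M\<^esub> x \<odot>\<^bsub>M\<^esub> diff M y"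
    and diff_span: "m \<in> carrier M \<Longrightarrow>
      \<exists>(n::nat) x y. (\<forall>k<n. x k \<in> carrier A \<and> y k \<in> carrier A) \<and>
        m = (\<Oplus>\<^bsub>M\<^esub>k\<in>{..<n}. x k \<odot>\<^bsub>M\<^esub> diff M (y k))"

locale star_calculus = first_order_calculus +
  assumes star_compatible:
    "\<And>(n::nat) x y. \<lbrakk>\<forall>k<n. x k \<in> carrier A \<and> y k \<in> carrier A;
        (\<Oplus>\<^bsub>M\<^esub>k\<in>{..<n}. x k \<odot>\<^bsub>M\<^esub> diff M (y k)) = \<zero>\<^bsub>M\<^esub>\<rbrakk>
      \<Longrightarrow> (\<Oplus>\<^bsub>M\<^esub>k\<in>{..<n}. rsmult M (diff M (cstar A (y k))) (cstar A (x k))) = \<zero>\<^bsub>M\<^esub>"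

definition sub_bimodule ::
  "('a, 'c) star_alg_scheme \<Rightarrow> ('a, 'm, 'd) calculus_scheme \<Rightarrow> 'm set \<Rightarrow> bool" where
  "sub_bimodule A M S \<longleftrightarrow> additive_subgroup S M \<and>
     (\<forall>x\<in>carrier A. \<forall>m\<in>S. x \<odot>\<^bsub>M\<^esub> m \<in> S \<and> rsmult M m x \<in> S)"

definition sub_bimodule_generated ::
  "('a, 'c) star_alg_scheme \<Rightarrow> ('a, 'm, 'd) calculus_scheme \<Rightarrow> 'm set \<Rightarrow> 'm set" where
  "sub_bimodule_generated A M W = \<Inter>{S. sub_bimodule A M S \<and> W \<subseteq> S}"

definition quotient_calculus ::
  "('a, 'm, 'd) calculus_scheme \<Rightarrow> 'm set \<Rightarrow> ('a, 'm set) calculus" where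
  "quotient_calculus M S =
     \<lparr>carrier = a_rcosets\<^bsub>M\<^esub> S, mult = undefined, one = undefined,
      zero = S, add = set_add M,
      smult = (\<lambda>x K. \<Union>m\<in>K. S +>\<^bsub>M\<^esub> (x \<odot>\<^bsub>M\<^esub> m)),
      rsmult = (\<lambda>K x. \<Union>m\<in>K. S +>\<^bsub>M\<^esub> rsmult M m x),
      diff = (\<lambda>x. S +>\<^bsub>M\<^esub> diff M x)\<rparr>"

definition calculus_iso ::
  "('a, 'c) star_alg_scheme \<Rightarrow> ('a, 'm, 'd) calculus_scheme \<Rightarrow> ('a, 'n, 'e) calculus_scheme \<Rightarrow> bool" where
  "calculus_iso A M M' \<longleftrightarrow> (\<exists>\<phi>. bij_betw \<phi> (carrier M) (carrier M') \<and>
     (\<forall>m\<in>carrier M. \<forall>n\<in>carrier M. \<phi> (m \<oplus>\<^bsub>M\<^esub> n) = \<phi> m \<oplus>\<^bsub>M'\<^esub> \<phi> n) \<and>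
     (\<forall>x\<in>carrier A. \<forall>m\<in>carrier M. \<phi> (x \<odot>\<^bsub>M\<^esub> m) = x \<odot>\<^bsub>M'\<^esub> \<phi> m) \<and>
     (\<forall>x\<in>carrier A. \<forall>m\<in>carrier M. \<phi> (rsmult M m x) = rsmult M' (\<phi> m) x) \<and>
     (\<forall>x\<in>carrier A. \<phi> (diff M x) = diff M' x))"


section \<open>The quantum sphere\<close>

datatype gen = Z nat | Zs nat

definition gens :: "nat \<Rightarrow> gen set" where
  "gens N = Z ` {1..N} \<union> Zs ` {1..N}"

fun gen_star :: "gen \<Rightarrow> gen" where
  "gen_star (Z i) = Zs i"
| "gen_star (Zs i) = Z i"

(* The free monoid, written additively: finitely supported functions on an additive monoid
   carry the convolution product in HOL-Library. *)
datatype word = Word (letters: "gen list")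

instantiation word :: monoid_add
begin

definition zero_word :: word where
  "zero_word = Word []"

definition plus_word :: "word \<Rightarrow> word \<Rightarrow> word" where
  "plus_word u v = Word (letters u @ letters v)"

instance
  by standard (simp_all add: zero_word_def plus_word_def)

end

type_synonym free_alg = "word \<Rightarrow>\<^sub>0 complex"

definition const :: "complex \<Rightarrow> free_alg" where
  "const c = Poly_Mapping.single 0 c"

definition gen_poly :: "gen \<Rightarrow> free_alg" where
  "gen_poly g = Poly_Mapping.single (Word [g]) 1"

definition word_star :: "word \<Rightarrow> word" where
  "word_star w = Word (rev (map gen_star (letters w)))"

definition free_star :: "free_alg \<Rightarrow> free_alg" where
  "free_star p = (\<Sum>w\<in>Poly_Mapping.keys p.
     Poly_Mapping.single (word_star w) (cnj (Poly_Mapping.lookup p w)))"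

definition free_star_alg :: "nat \<Rightarrow> free_alg star_alg" where
  "free_star_alg N =
     \<lparr>carrier = {p. \<forall>w\<in>Poly_Mapping.keys p. set (letters w) \<subseteq> gens N},
      mult = (*), one = 1, zero = 0, add = (+),
      cscale = (\<lambda>c p. const c * p), cstar = free_star\<rparr>"

definition sphere_relations :: "nat \<Rightarrow> real \<Rightarrow> free_alg set" where
  "sphere_relations N q =
     (let z = (\<lambda>i. gen_poly (Z i)); zs = (\<lambda>i. gen_poly (Zs i)); Q = q - 1 / q in
      {z i * z j - const q * (z j * z i) | i j. 1 \<le> i \<and> i < j \<and> j \<le> N} \<union>
      {zs i * zs j - const (1 / q) * (zs j * zs i) | i j. 1 \<le> i \<and> i < j \<and> j \<le> N} \<union>
      {z i * zs j - const q * (zs j * z i) | i j. i \<in> {1..N} \<and> j \<in> {1..N} \<and> i \<noteq> j} \<union>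
      {z i * zs i - zs i * z i + const (1 / q * Q) * (\<Sum>k\<in>{i<..N}. z k * zs k) | i. i \<in> {1..N}} \<union>
      {(\<Sum>i\<in>{1..N}. z i * zs i) - 1})"

definition sphere_ideal :: "nat \<Rightarrow> real \<Rightarrow> free_alg set" where
  "sphere_ideal N q = genideal (free_star_alg N) (sphere_relations N q)"

(* For real q the set of relations is stable under the involution up to sign and scalars, so the
   two-sided ideal it generates is a *-ideal and the involution of a coset is its image. *)
definition sphere :: "nat \<Rightarrow> real \<Rightarrow> free_alg set star_alg" where
  "sphere N q = (let F = free_star_alg N; I = sphere_ideal N q in
     \<lparr>carrier = carrier (F Quot I), mult = mult (F Quot I), one = one (F Quot I),
      zero = zero (F Quot I), add = add (F Quot I),
      cscale = (\<lambda>c K. \<Union>p\<in>K. I +>\<^bsub>F\<^esub> cscale F c p),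
      cstar = (\<lambda>K. cstar F ` K)\<rparr>)"

definition sphere_gen :: "nat \<Rightarrow> real \<Rightarrow> gen \<Rightarrow> free_alg set" where
  "sphere_gen N q g = sphere_ideal N q +>\<^bsub>free_star_alg N\<^esub> gen_poly g"


section \<open>R-matrices\<close>

(* The arguments i j k l stand for upper indices i j and lower indices k l. *)

definition Rhat :: "real \<Rightarrow> nat \<Rightarrow> nat \<Rightarrow> nat \<Rightarrow> nat \<Rightarrow> real" where
  "Rhat q i j k l =
     (if i = l \<and> l \<noteq> k \<and> k = j then 1
      else if i = j \<and> j = k \<and> k = l then q
      else if i = k \<and> k < j \<and> j = l then q - 1 / q
      else 0)"

definition Rhat_inv :: "real \<Rightarrow> nat \<Rightarrow> nat \<Rightarrow> nat \<Rightarrow> nat \<Rightarrow> real" where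
  "Rhat_inv q i j k l =
     (if i = l \<and> l \<noteq> k \<and> k = j then 1
      else if i = j \<and> j = k \<and> k = l then 1 / q
      else if i = k \<and> k > j \<and> j = l then - (q - 1 / q)
      else 0)"

definition Rcheck :: "real \<Rightarrow> nat \<Rightarrow> nat \<Rightarrow> nat \<Rightarrow> nat \<Rightarrow> real" where
  "Rcheck q i j k l = Rhat q l k j i"

definition Racute :: "real \<Rightarrow> nat \<Rightarrow> nat \<Rightarrow> nat \<Rightarrow> nat \<Rightarrow> real" where
  "Racute q i j k l = Rhat q k i l j"

definition Rgrave_inv :: "real \<Rightarrow> nat \<Rightarrow> nat \<Rightarrow> nat \<Rightarrow> nat \<Rightarrow> real" where
  "Rgrave_inv q i j k l = q powi (2 * int l - 2 * int i) * Rhat_inv q j l i k"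


section \<open>Calculi given by bimodule relations\<close>

definition s_plus :: "nat \<Rightarrow> real \<Rightarrow> real" where
  "s_plus N q = (\<Sum>i<N. q ^ (2 * i))"

definition s_plus' :: "nat \<Rightarrow> real \<Rightarrow> real" where
  "s_plus' N q = s_plus N q - 1"

record one_coeffs =
  a\<^sub>1 :: complex  a\<^sub>2 :: complex  a\<^sub>3 :: complex  a\<^sub>4 :: complex
  b\<^sub>1 :: complex  b\<^sub>2 :: complex  b\<^sub>3 :: complex  b\<^sub>4 :: complex
  c\<^sub>1 :: complex  c\<^sub>2 :: complex  c\<^sub>3 :: complex  c\<^sub>4 :: complex
  d\<^sub>3 :: complex  d\<^sub>4 :: complex

record two_coeffs = one_coeffs +
  e\<^sub>1 :: complex  e\<^sub>2 :: complex  e\<^sub>3 :: complex  e\<^sub>4 :: complex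
  f\<^sub>3 :: complex  f\<^sub>4 :: complex

datatype ext_complex = Fin complex | Infty

context
  fixes N :: nat and q :: real
begin

definition free_vectors :: "(gen \<Rightarrow> free_alg set) set" where
  "free_vectors = gens N \<rightarrow>\<^sub>E carrier (sphere N q)"

definition left_comb :: "(free_alg set, 'm) calculus \<Rightarrow> (gen \<Rightarrow> free_alg set) \<Rightarrow> 'm" where
  "left_comb C v = (\<Oplus>\<^bsub>C\<^esub>g\<in>gens N. v g \<odot>\<^bsub>C\<^esub> diff C (sphere_gen N q g))"

definition Omega_plus :: "(free_alg set, 'm) calculus \<Rightarrow> 'm" where
  "Omega_plus C =
     (\<Oplus>\<^bsub>C\<^esub>i\<in>{1..N}. sphere_gen N q (Z i) \<odot>\<^bsub>C\<^esub> diff C (sphere_gen N q (Zs i)))"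

definition Omega_minus :: "(free_alg set, 'm) calculus \<Rightarrow> 'm" where
  "Omega_minus C =
     (\<Oplus>\<^bsub>C\<^esub>i\<in>{1..N}. cscale (sphere N q) (q powi (- 2 * int i)) (sphere_gen N q (Zs i))
        \<odot>\<^bsub>C\<^esub> diff C (sphere_gen N q (Z i)))"

definition relation_form :: "ext_complex \<Rightarrow> (free_alg set, 'm) calculus \<Rightarrow> 'm" where
  "relation_form lam C = (case lam of
     Fin l \<Rightarrow> Omega_plus C \<oplus>\<^bsub>C\<^esub> cscale (sphere N q) l \<one>\<^bsub>sphere N q\<^esub> \<odot>\<^bsub>C\<^esub> Omega_minus C
   | Infty \<Rightarrow> Omega_minus C)"

(* The element of the free left module whose image under left_comb is relation_form. *)
definition relation_vector :: "ext_complex \<Rightarrow> gen \<Rightarrow> free_alg set" where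
  "relation_vector lam = (\<lambda>g\<in>gens N. case lam of
     Fin l \<Rightarrow> (case g of
         Z i \<Rightarrow> cscale (sphere N q) (l * q powi (- 2 * int i)) (sphere_gen N q (Zs i))
       | Zs i \<Rightarrow> sphere_gen N q (Z i))
   | Infty \<Rightarrow> (case g of
         Z i \<Rightarrow> cscale (sphere N q) (q powi (- 2 * int i)) (sphere_gen N q (Zs i))
       | Zs i \<Rightarrow> \<zero>\<^bsub>sphere N q\<^esub>))"

definition left_free :: "(free_alg set, 'm) calculus \<Rightarrow> bool" where
  "left_free C \<longleftrightarrow> (\<forall>m\<in>carrier C. \<exists>!v. v \<in> free_vectors \<and> left_comb C v = m)"

(* The canonical map from the free left module is onto, and its kernel is the left submodule
   generated by the relation. *)
definition left_one_relation :: "ext_complex \<Rightarrow> (free_alg set, 'm) calculus \<Rightarrow> bool" where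
  "left_one_relation lam C \<longleftrightarrow>
     left_comb C ` free_vectors = carrier C \<and>
     {v \<in> free_vectors. left_comb C v = \<zero>\<^bsub>C\<^esub>} =
       {\<lambda>g\<in>gens N. w \<otimes>\<^bsub>sphere N q\<^esub> relation_vector lam g | w. w \<in> carrier (sphere N q)}"

definition two_form_relations :: "two_coeffs \<Rightarrow> (free_alg set, 'm) calculus \<Rightarrow> bool" where
  "two_form_relations K C \<longleftrightarrow>
     (let A = sphere N q;
          z = (\<lambda>i. sphere_gen N q (Z i)); zs = (\<lambda>i. sphere_gen N q (Zs i));
          dz = (\<lambda>i. diff C (z i)); dzs = (\<lambda>i. diff C (zs i));
          \<delta> = (\<lambda>k l. if k = l then 1 else (0::complex));
          \<Omega>p = Omega_plus C; \<Omega>m = Omega_minus C in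
      \<forall>k\<in>{1..N}. \<forall>l\<in>{1..N}.
        rsmult C (dz k) (z l) =
          (\<Oplus>\<^bsub>C\<^esub>s\<in>{1..N}. \<Oplus>\<^bsub>C\<^esub>t\<in>{1..N}.
             cscale A (a\<^sub>1 K * Rhat_inv q s t k l) (z s) \<odot>\<^bsub>C\<^esub> dz t)
          \<oplus>\<^bsub>C\<^esub> cscale A (b\<^sub>1 K) (z k) \<odot>\<^bsub>C\<^esub> dz l
          \<oplus>\<^bsub>C\<^esub> cscale A (c\<^sub>1 K) (z k \<otimes>\<^bsub>A\<^esub> z l) \<odot>\<^bsub>C\<^esub> \<Omega>p
          \<oplus>\<^bsub>C\<^esub> cscale A (e\<^sub>1 K) (z k \<otimes>\<^bsub>A\<^esub> z l) \<odot>\<^bsub>C\<^esub> \<Omega>m \<and>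
        rsmult C (dzs k) (zs l) =
          (\<Oplus>\<^bsub>C\<^esub>s\<in>{1..N}. \<Oplus>\<^bsub>C\<^esub>t\<in>{1..N}.
             cscale A (a\<^sub>2 K * Rcheck q s t k l) (zs s) \<odot>\<^bsub>C\<^esub> dzs t)
          \<oplus>\<^bsub>C\<^esub> cscale A (b\<^sub>2 K) (zs k) \<odot>\<^bsub>C\<^esub> dzs l
          \<oplus>\<^bsub>C\<^esub> cscale A (c\<^sub>2 K) (zs k \<otimes>\<^bsub>A\<^esub> zs l) \<odot>\<^bsub>C\<^esub> \<Omega>p
          \<oplus>\<^bsub>C\<^esub> cscale A (e\<^sub>2 K) (zs k \<otimes>\<^bsub>A\<^esub> zs l) \<odot>\<^bsub>C\<^esub> \<Omega>m \<and>
        rsmult C (dz k) (zs l) =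
          (\<Oplus>\<^bsub>C\<^esub>s\<in>{1..N}. \<Oplus>\<^bsub>C\<^esub>t\<in>{1..N}.
             cscale A (a\<^sub>3 K * Rgrave_inv q s t k l) (zs s) \<odot>\<^bsub>C\<^esub> dz t)
          \<oplus>\<^bsub>C\<^esub> cscale A (b\<^sub>3 K) (z k) \<odot>\<^bsub>C\<^esub> dzs l
          \<oplus>\<^bsub>C\<^esub> (cscale A (c\<^sub>3 K) (z k \<otimes>\<^bsub>A\<^esub> zs l)
                \<oplus>\<^bsub>A\<^esub> cscale A (d\<^sub>3 K * q ^ (2 * k) * \<delta> k l) \<one>\<^bsub>A\<^esub>) \<odot>\<^bsub>C\<^esub> \<Omega>p
          \<oplus>\<^bsub>C\<^esub> (cscale A (e\<^sub>3 K) (z k \<otimes>\<^bsub>A\<^esub> zs l)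
                \<oplus>\<^bsub>A\<^esub> cscale A (f\<^sub>3 K * q ^ (2 * k) * \<delta> k l) \<one>\<^bsub>A\<^esub>) \<odot>\<^bsub>C\<^esub> \<Omega>m \<and>
        rsmult C (dzs k) (z l) =
          (\<Oplus>\<^bsub>C\<^esub>s\<in>{1..N}. \<Oplus>\<^bsub>C\<^esub>t\<in>{1..N}.
             cscale A (a\<^sub>4 K * Racute q s t k l) (z s) \<odot>\<^bsub>C\<^esub> dzs t)
          \<oplus>\<^bsub>C\<^esub> cscale A (b\<^sub>4 K) (zs k) \<odot>\<^bsub>C\<^esub> dz l
          \<oplus>\<^bsub>C\<^esub> (cscale A (c\<^sub>4 K) (zs k \<otimes>\<^bsub>A\<^esub> z l)
                \<oplus>\<^bsub>A\<^esub> cscale A (d\<^sub>4 K * \<delta> k l) \<one>\<^bsub>A\<^esub>) \<odot>\<^bsub>C\<^esub> \<Omega>p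
          \<oplus>\<^bsub>C\<^esub> (cscale A (e\<^sub>4 K) (zs k \<otimes>\<^bsub>A\<^esub> z l)
                \<oplus>\<^bsub>A\<^esub> cscale A (f\<^sub>4 K * \<delta> k l) \<one>\<^bsub>A\<^esub>) \<odot>\<^bsub>C\<^esub> \<Omega>m)"

definition one_form_relations ::
  "one_coeffs \<Rightarrow> (free_alg set, 'm) calculus \<Rightarrow> 'm \<Rightarrow> bool" where
  "one_form_relations K C \<Omega> \<longleftrightarrow>
     (let A = sphere N q;
          z = (\<lambda>i. sphere_gen N q (Z i)); zs = (\<lambda>i. sphere_gen N q (Zs i));
          dz = (\<lambda>i. diff C (z i)); dzs = (\<lambda>i. diff C (zs i));
          \<delta> = (\<lambda>k l. if k = l then 1 else (0::complex)) in
      \<forall>k\<in>{1..N}. \<forall>l\<in>{1..N}.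
        rsmult C (dz k) (z l) =
          (\<Oplus>\<^bsub>C\<^esub>s\<in>{1..N}. \<Oplus>\<^bsub>C\<^esub>t\<in>{1..N}.
             cscale A (a\<^sub>1 K * Rhat_inv q s t k l) (z s) \<odot>\<^bsub>C\<^esub> dz t)
          \<oplus>\<^bsub>C\<^esub> cscale A (b\<^sub>1 K) (z k) \<odot>\<^bsub>C\<^esub> dz l
          \<oplus>\<^bsub>C\<^esub> cscale A (c\<^sub>1 K) (z k \<otimes>\<^bsub>A\<^esub> z l) \<odot>\<^bsub>C\<^esub> \<Omega> \<and>
        rsmult C (dzs k) (zs l) =
          (\<Oplus>\<^bsub>C\<^esub>s\<in>{1..N}. \<Oplus>\<^bsub>C\<^esub>t\<in>{1..N}.
             cscale A (a\<^sub>2 K * Rcheck q s t k l) (zs s) \<odot>\<^bsub>C\<^esub> dzs t)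
          \<oplus>\<^bsub>C\<^esub> cscale A (b\<^sub>2 K) (zs k) \<odot>\<^bsub>C\<^esub> dzs l
          \<oplus>\<^bsub>C\<^esub> cscale A (c\<^sub>2 K) (zs k \<otimes>\<^bsub>A\<^esub> zs l) \<odot>\<^bsub>C\<^esub> \<Omega> \<and>
        rsmult C (dz k) (zs l) =
          (\<Oplus>\<^bsub>C\<^esub>s\<in>{1..N}. \<Oplus>\<^bsub>C\<^esub>t\<in>{1..N}.
             cscale A (a\<^sub>3 K * Rgrave_inv q s t k l) (zs s) \<odot>\<^bsub>C\<^esub> dz t)
          \<oplus>\<^bsub>C\<^esub> cscale A (b\<^sub>3 K) (z k) \<odot>\<^bsub>C\<^esub> dzs l
          \<oplus>\<^bsub>C\<^esub> cscale A (c\<^sub>3 K) (z k \<otimes>\<^bsub>A\<^esub> zs l) \<odot>\<^bsub>C\<^esub> \<Omega>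
          \<oplus>\<^bsub>C\<^esub> cscale A (d\<^sub>3 K * q ^ (2 * k) * \<delta> k l) \<one>\<^bsub>A\<^esub> \<odot>\<^bsub>C\<^esub> \<Omega> \<and>
        rsmult C (dzs k) (z l) =
          (\<Oplus>\<^bsub>C\<^esub>s\<in>{1..N}. \<Oplus>\<^bsub>C\<^esub>t\<in>{1..N}.
             cscale A (a\<^sub>4 K * Racute q s t k l) (z s) \<odot>\<^bsub>C\<^esub> dzs t)
          \<oplus>\<^bsub>C\<^esub> cscale A (b\<^sub>4 K) (zs k) \<odot>\<^bsub>C\<^esub> dz l
          \<oplus>\<^bsub>C\<^esub> cscale A (c\<^sub>4 K) (zs k \<otimes>\<^bsub>A\<^esub> z l) \<odot>\<^bsub>C\<^esub> \<Omega>
          \<oplus>\<^bsub>C\<^esub> cscale A (d\<^sub>4 K * \<delta> k l) \<one>\<^bsub>A\<^esub> \<odot>\<^bsub>C\<^esub> \<Omega>)"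

definition free_calculus :: "two_coeffs \<Rightarrow> (free_alg set, 'm) calculus \<Rightarrow> bool" where
  "free_calculus K C \<longleftrightarrow>
     star_calculus (sphere N q) C \<and> left_free C \<and> two_form_relations K C"

definition one_relation_calculus ::
  "ext_complex \<Rightarrow> one_coeffs \<Rightarrow> (free_alg set, 'm) calculus \<Rightarrow> 'm \<Rightarrow> bool" where
  "one_relation_calculus lam K C \<Omega> \<longleftrightarrow>
     first_order_calculus (sphere N q) C \<and> left_one_relation lam C \<and> one_form_relations K C \<Omega>"

definition factor_calculus ::
  "(free_alg set, 'm) calculus \<Rightarrow> ext_complex \<Rightarrow> (free_alg set, 'm set) calculus" where
  "factor_calculus C lam =
     quotient_calculus C (sub_bimodule_generated (sphere N q) C {relation_form lam C})"


section \<open>The families of calculi\<close>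

(* A family member is specified up to isomorphism by a predicate on calculi. *)

definition is_Gamma :: "real \<Rightarrow> real \<Rightarrow> (free_alg set, 'm) calculus \<Rightarrow> bool" where
  "is_Gamma \<alpha> \<tau> = (let s = s_plus N q; s' = s_plus' N q in free_calculus
    \<lparr>a\<^sub>1 = of_real (q * \<alpha>), a\<^sub>2 = of_real (1 / (q * \<alpha>)),
     a\<^sub>3 = of_real (1 / (q * \<alpha>)), a\<^sub>4 = of_real (q * \<alpha>),
     b\<^sub>1 = of_real (q^2 * \<alpha> - 1), b\<^sub>2 = of_real (1 / (q^2 * \<alpha>) - 1),
     b\<^sub>3 = of_real (q^2 * \<alpha> - 1), b\<^sub>4 = of_real (1 / (q^2 * \<alpha>) - 1),
     c\<^sub>1 = of_real (q^2 * \<alpha>^2 * (1 - s' * \<tau>)), c\<^sub>2 = of_real (1 - s' * \<tau>),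
     c\<^sub>3 = of_real (- (q^2 * \<alpha> * (1 - s * \<tau>))), c\<^sub>4 = of_real (- (q^2 * \<alpha> * (1 - s * \<tau>))),
     d\<^sub>3 = of_real (- (\<alpha> * \<tau>)), d\<^sub>4 = of_real (- (q^(2*N) * \<alpha> * \<tau>)),
     e\<^sub>1 = of_real (q^2 * (1 - \<alpha> * s' * \<tau>)), e\<^sub>2 = of_real (1 / \<alpha>^2 * (1 - \<alpha> * s' * \<tau>)),
     e\<^sub>3 = of_real (- (1 / \<alpha> * (1 - q^2 * \<alpha> * s * \<tau>))),
     e\<^sub>4 = of_real (- (1 / \<alpha> * (1 - q^2 * \<alpha> * s * \<tau>))),
     f\<^sub>3 = of_real (- \<tau>), f\<^sub>4 = of_real (- (q^(2*N) * \<tau>))\<rparr>)"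

definition is_Gamma' :: "real \<Rightarrow> real \<Rightarrow> (free_alg set, 'm) calculus \<Rightarrow> bool" where
  "is_Gamma' \<alpha> \<omega> = free_calculus
    \<lparr>a\<^sub>1 = of_real (q * \<alpha>), a\<^sub>2 = of_real (1 / (q * \<alpha>)),
     a\<^sub>3 = of_real (1 / (q * \<alpha>)), a\<^sub>4 = of_real (q * \<alpha>),
     b\<^sub>1 = of_real (q^2 * \<alpha> - 1), b\<^sub>2 = of_real (1 / (q^2 * \<alpha>) - 1),
     b\<^sub>3 = of_real (q^2 * \<alpha> - 1), b\<^sub>4 = of_real (1 / (q^2 * \<alpha>) - 1),
     c\<^sub>1 = of_real \<omega>, c\<^sub>2 = of_real (q^2 * \<alpha> / \<omega> - (1 / \<alpha> - 1)),
     c\<^sub>3 = of_real (- (q^2 * \<alpha>)), c\<^sub>4 = of_real (- (q^2 * \<alpha>)),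
     d\<^sub>3 = 0, d\<^sub>4 = 0,
     e\<^sub>1 = of_real (\<omega> / \<alpha> - q^2 * (\<alpha> - 1)), e\<^sub>2 = of_real (q^2 / \<omega>),
     e\<^sub>3 = of_real (- (1 / \<alpha>)), e\<^sub>4 = of_real (- (1 / \<alpha>)),
     f\<^sub>3 = 0, f\<^sub>4 = 0\<rparr>"

definition is_Gamma'' :: "real \<Rightarrow> real \<Rightarrow> (free_alg set, 'm) calculus \<Rightarrow> bool" where
  "is_Gamma'' \<omega> \<psi> = free_calculus
    \<lparr>a\<^sub>1 = of_real (1 / q), a\<^sub>2 = of_real q, a\<^sub>3 = of_real q, a\<^sub>4 = of_real (1 / q),
     b\<^sub>1 = 0, b\<^sub>2 = 0, b\<^sub>3 = 0, b\<^sub>4 = 0,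
     c\<^sub>1 = of_real \<omega>, c\<^sub>2 = of_real (\<psi> - q^2), c\<^sub>3 = - 1, c\<^sub>4 = - 1,
     d\<^sub>3 = 0, d\<^sub>4 = 0,
     e\<^sub>1 = of_real (q^2 * \<omega> * \<psi> - 1), e\<^sub>2 = of_real (q^2 / \<omega>),
     e\<^sub>3 = of_real (- (q^2)), e\<^sub>4 = of_real (- (q^2)),
     f\<^sub>3 = 0, f\<^sub>4 = 0\<rparr>"

definition is_Gamma''' :: "real \<Rightarrow> real \<Rightarrow> (free_alg set, 'm) calculus \<Rightarrow> bool" where
  "is_Gamma''' \<rho> \<tau> = (let s = s_plus N q; s' = s_plus' N q in free_calculus
    \<lparr>a\<^sub>1 = of_real (1 / q), a\<^sub>2 = of_real q, a\<^sub>3 = of_real q, a\<^sub>4 = of_real (1 / q),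
     b\<^sub>1 = 0, b\<^sub>2 = 0, b\<^sub>3 = 0, b\<^sub>4 = 0,
     c\<^sub>1 = of_real (- (1 / q^2 * (\<rho> / \<tau>) * (s' * \<rho> - 1))),
     c\<^sub>2 = of_real (- (\<tau> / \<rho> * (s' * \<rho> - 1))),
     c\<^sub>3 = of_real (s * \<rho> - 1), c\<^sub>4 = of_real (s * \<rho> - 1),
     d\<^sub>3 = of_real (- (1 / q^2 * \<rho>)), d\<^sub>4 = of_real (- (q^(2*N - 2) * \<rho>)),
     e\<^sub>1 = of_real (- (\<rho> / \<tau> * (s' * \<tau> - q^2))),
     e\<^sub>2 = of_real (- (q^2 * (\<tau> / \<rho>) * (s' * \<tau> - q^2))),
     e\<^sub>3 = of_real (q^2 * (s * \<tau> - 1)), e\<^sub>4 = of_real (q^2 * (s * \<tau> - 1)),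
     f\<^sub>3 = of_real (- \<tau>), f\<^sub>4 = of_real (- (q^(2*N) * \<tau>))\<rparr>)"

definition is_tilde_Gamma :: "complex \<Rightarrow> (free_alg set, 'm) calculus \<Rightarrow> bool" where
  "is_tilde_Gamma l D \<longleftrightarrow> (let q = complex_of_real q in
    l \<notin> {0, q^2} \<and> one_relation_calculus (Fin l)
    \<lparr>a\<^sub>1 = q / l, a\<^sub>2 = l / q, a\<^sub>3 = l / q, a\<^sub>4 = q / l,
     b\<^sub>1 = q^2 / l - 1, b\<^sub>2 = l / q^2 - 1, b\<^sub>3 = q^2 / l - 1, b\<^sub>4 = l / q^2 - 1,
     c\<^sub>1 = q^2 / l * (1 / l - 1), c\<^sub>2 = - (l - 1),
     c\<^sub>3 = - (q^2 / l - 1), c\<^sub>4 = - (q^2 / l - 1),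
     d\<^sub>3 = 0, d\<^sub>4 = 0\<rparr> D (Omega_plus D))"

definition is_tilde_Gamma' :: "complex \<Rightarrow> (free_alg set, 'm) calculus \<Rightarrow> bool" where
  "is_tilde_Gamma' l D \<longleftrightarrow> (let q = complex_of_real q in
    l \<noteq> 0 \<and> one_relation_calculus (Fin l)
    \<lparr>a\<^sub>1 = 1 / q, a\<^sub>2 = q, a\<^sub>3 = q, a\<^sub>4 = 1 / q,
     b\<^sub>1 = 0, b\<^sub>2 = 0, b\<^sub>3 = 0, b\<^sub>4 = 0,
     c\<^sub>1 = - (1 / l * (q^4 / l - 1)), c\<^sub>2 = - (l / q^2 * (q^4 / l - 1)),
     c\<^sub>3 = q^2 / l - 1, c\<^sub>4 = q^2 / l - 1,
     d\<^sub>3 = 0, d\<^sub>4 = 0\<rparr> D (Omega_plus D))"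

(* The coefficients at 0 are those forced by the left module structure (the relation
   d 1 = 0 for 1 = sum z_i zs_i requires c_3 + q^2 s_+ d_3 = - q^2 there) and by the limit
   l -> 0 of the generic ones under Omega_+ = - l Omega_-. They carry a common factor q^(2N)
   against the originally published values q^2/s', - q^(2-2N)/s', - q^2/s', for which no such calculus exists. *)
definition is_tilde_Gamma'' :: "ext_complex \<Rightarrow> (free_alg set, 'm) calculus \<Rightarrow> bool" where
  "is_tilde_Gamma'' lam D \<longleftrightarrow>
    (let s' = complex_of_real (s_plus' N q); q = complex_of_real q;
         K = (\<lambda>c d3 d4.
           \<lparr>a\<^sub>1 = 1 / q, a\<^sub>2 = q, a\<^sub>3 = q, a\<^sub>4 = 1 / q,
            b\<^sub>1 = 0, b\<^sub>2 = 0, b\<^sub>3 = 0, b\<^sub>4 = 0,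
            c\<^sub>1 = 0, c\<^sub>2 = 0, c\<^sub>3 = c, c\<^sub>4 = c, d\<^sub>3 = d3, d\<^sub>4 = d4\<rparr>) in
     case lam of
       Fin l \<Rightarrow>
         if l = 0
         then one_relation_calculus (Fin 0)
                (K (q^(2*N + 2) / s') (- (q^2 / s')) (- (q^(2*N + 2) / s'))) D (Omega_minus D)
         else one_relation_calculus (Fin l)
                (K (- (1 / s' * (q^(2*N + 2) / l - 1)))
                   (1 / q^2 * (1 / s') * (q^4 / l - 1))
                   (q^(2*N - 2) * (1 / s') * (q^4 / l - 1))) D (Omega_plus D)
     | Infty \<Rightarrow>
         one_relation_calculus Infty
           (K (1 / s') (- (1 / q^2 * (1 / s'))) (- (q^(2*N - 2) * (1 / s')))) D (Omega_plus D))"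

end

end

(* Every calculus involved is a quotient of the free left module on the differentials of the
   generators, so its elements and its structure are described by coordinate vectors over the free
   algebra, taken modulo the defining ideal of the sphere. Two calculations in these coordinates
   carry the proof. First, Omega_+ x and Omega_- x for a generator x are combinations of x Omega_+,
   x Omega_- and dx; for the coefficients of the four free families this makes the left submodule
   generated by Omega = Omega_+ + lambda Omega_- stable under right multiplication, so it is the
   sub-bimodule that is factored out, and substituting the relation turns the given commutation
   rules into those with one form. Second, the involution maps Omega to - Omega for real lambda,
   because sum_i z_i z_i^* and sum_i q^(-2i) z_i^* z_i are constants, so the quotient remains a
   star calculus. Conversely the left module structure together with the products of the
   differentials of generators with generators determines a calculus up to isomorphism. *)
theory Submission
  imports Defs
begin

section \<open>The free algebra\<close>

text \<open>For a generator h, right multiplication carries u Omega_+ + v Omega_- to h times another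
  such combination plus a multiple of dh. An admissible relation is therefore a line (u : v) that is
  an eigenline of one 2x2 matrix of scalars for the \<open>z l\<close> and of another for the
  \<open>zs l\<close>, and on which the dh part vanishes. In \<open>is_Gamma\<close> and
  \<open>is_Gamma'\<close> the b coefficients are nonzero, and the dh part alone forces lambda =
  1/alpha. In the other two families all b vanish, and the eigenline condition for
  \<open>z l\<close> is a quadratic equation in lambda. For \<open>is_Gamma'''\<close> its leading
  coefficient contains the factor s'_+ rho - 1 and its constant term is s'_+ tau - q^2. At rho =
  1/s'_+ one root moves to infinity, which is the relation Omega_- = 0; if also tau = q^2/s'_+, the
  equation holds identically and every lambda occurs. The star condition is the one axiom that does
  not descend to the quotient by itself, since it speaks of sums that vanish only modulo the
  sub-bimodule; such a sum is completed to one that vanishes in the free calculus.\<close>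

lemma const_add: "const (a + b) = const a + const b"
  by (simp add: const_def single_add)

lemma const_mult: "const (a * b) = const a * const b"
  by (simp add: const_def mult_single)

lemma const_zero [simp]: "const 0 = 0"
  by (simp add: const_def)

lemma const_one [simp]: "const 1 = 1"
  by (simp add: const_def)

lemma const_minus: "const (- a) = - const a"
  by (simp add: const_def single_uminus)

lemma free_alg_monomials:
  fixes p :: free_alg
  shows "p = (\<Sum>w\<in>Poly_Mapping.keys p. Poly_Mapping.single w (Poly_Mapping.lookup p w))"
  by (rule poly_mapping_eqI)
    (simp add: lookup_sum lookup_single when_def in_keys_iff)

text \<open>Multiplication of polynomials is not commutative here, but the empty word is neutral on
  both sides, so comparing monomials leaves only commuting scalars.\<close>

lemma const_central: "p * const c = const c * p"
proof -
  have "(\<Sum>w\<in>Poly_Mapping.keys p. Poly_Mapping.single w (Poly_Mapping.lookup p w)) * const c =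
     const c * (\<Sum>w\<in>Poly_Mapping.keys p. Poly_Mapping.single w (Poly_Mapping.lookup p w))"
    by (simp add: const_def sum_distrib_left sum_distrib_right mult_single mult.commute)
  then show ?thesis
    by (simp flip: free_alg_monomials)
qed

lemma const_left_commute: "p * (const c * r) = const c * (p * r)"
  by (metis const_central mult.assoc)

section \<open>Words, generators and the involution of the free algebra\<close>

lemma letters_zero [simp]: "letters 0 = []"
  by (simp add: zero_word_def)

lemma letters_plus [simp]: "letters (u + v) = letters u @ letters v"
  by (simp add: plus_word_def)

lemma gen_star_gen_star [simp]: "gen_star (gen_star g) = g"
  by (cases g) auto

lemma gen_star_gens [simp]: "gen_star g \<in> gens N \<longleftrightarrow> g \<in> gens N"
  by (cases g) (auto simp: gens_def)

lemma finite_gens [simp]: "finite (gens N)"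
  by (simp add: gens_def)

lemma Z_gens [simp]: "Z i \<in> gens N \<longleftrightarrow> i \<in> {1..N}"
  and Zs_gens [simp]: "Zs i \<in> gens N \<longleftrightarrow> i \<in> {1..N}"
  by (auto simp: gens_def)

lemma sum_gens: "(\<Sum>g\<in>gens N. f g) = (\<Sum>i\<in>{1..N}. f (Z i)) + (\<Sum>i\<in>{1..N}. f (Zs i))"
proof -
  have "sum f (Z ` {1..N} \<union> Zs ` {1..N}) = sum f (Z ` {1..N}) + sum f (Zs ` {1..N})"
    by (rule sum.union_disjoint) auto
  then show ?thesis
    by (simp add: gens_def sum.reindex inj_on_def)
qed

lemma word_star_word_star [simp]: "word_star (word_star w) = w"
  by (cases w) (simp add: word_star_def rev_map comp_def)

lemma word_star_eq_iff: "word_star v = w \<longleftrightarrow> v = word_star w"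
  by auto

lemma word_star_plus: "word_star (u + v) = word_star v + word_star u"
  by (simp add: word_star_def plus_word_def)

text \<open>Since \<open>word_star\<close> is its own inverse, each coefficient of the adjoint comes
  from exactly one coefficient of p. The additive laws below are then proved
  coefficientwise.\<close>

lemma lookup_free_star:
  "Poly_Mapping.lookup (free_star p) w = cnj (Poly_Mapping.lookup p (word_star w))"
  by (simp add: free_star_def lookup_sum lookup_single when_def word_star_eq_iff in_keys_iff)

lemma free_star_free_star [simp]: "free_star (free_star p) = p"
  by (rule poly_mapping_eqI) (simp add: lookup_free_star)

lemma free_star_add: "free_star (p + r) = free_star p + free_star r"
  by (rule poly_mapping_eqI) (simp add: lookup_free_star lookup_add)

lemma free_star_minus: "free_star (- p) = - free_star p"
  by (rule poly_mapping_eqI) (simp add: lookup_free_star)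

lemma free_star_diff: "free_star (p - r) = free_star p - free_star r"
  by (rule poly_mapping_eqI) (simp add: lookup_free_star lookup_minus)

lemma free_star_zero [simp]: "free_star 0 = 0"
  by (rule poly_mapping_eqI) (simp add: lookup_free_star)

lemma free_star_sum: "free_star (\<Sum>x\<in>J. f x) = (\<Sum>x\<in>J. free_star (f x))"
  by (induction J rule: infinite_finite_induct) (auto simp: free_star_add)

lemma free_star_single:
  "free_star (Poly_Mapping.single w c) = Poly_Mapping.single (word_star w) (cnj c)"
  by (rule poly_mapping_eqI) (auto simp: lookup_free_star lookup_single when_def)

lemma free_star_mult: "free_star (p * r) = free_star r * free_star p"
proof -
  \<comment> \<open>The monomial expansion of p mentions p itself, so it is kept as an abbreviation
    and folded back only at the end.\<close>
  let ?m = "\<lambda>p::free_alg. \<Sum>w\<in>Poly_Mapping.keys p. Poly_Mapping.single w (Poly_Mapping.lookup p w)"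
  have "free_star (?m p * ?m r) = free_star (?m r) * free_star (?m p)"
    unfolding sum_distrib_left sum_distrib_right free_star_sum mult_single free_star_single
    by (subst sum.swap) (simp add: word_star_plus mult.commute)
  then show ?thesis
    by (simp flip: free_alg_monomials)
qed

lemma free_star_const [simp]: "free_star (const c) = const (cnj c)"
  by (simp add: const_def free_star_single word_star_def zero_word_def)

lemma free_star_one [simp]: "free_star 1 = 1"
  using free_star_const[of 1] by simp

lemma free_star_gen_poly [simp]: "free_star (gen_poly g) = gen_poly (gen_star g)"
  by (simp add: gen_poly_def free_star_single word_star_def)

section \<open>Polynomials in the generators with index at most N\<close>

abbreviation FC :: "nat \<Rightarrow> free_alg set" where
  "FC N \<equiv> carrier (free_star_alg N)"

lemma FC_iff: "p \<in> FC N \<longleftrightarrow> (\<forall>w\<in>Poly_Mapping.keys p. set (letters w) \<subseteq> gens N)"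
  by (simp add: free_star_alg_def)

lemma FC_const [simp, intro]: "const c \<in> FC N"
  by (auto simp: FC_iff const_def split: if_splits)

lemma FC_zero [simp, intro]: "0 \<in> FC N"
  using FC_const[of 0] by simp

lemma FC_one [simp, intro]: "1 \<in> FC N"
  using FC_const[of 1] by simp

lemma FC_gen [simp, intro]: "g \<in> gens N \<Longrightarrow> gen_poly g \<in> FC N"
  by (auto simp: FC_iff gen_poly_def)

lemma FC_add [simp, intro]: "p \<in> FC N \<Longrightarrow> r \<in> FC N \<Longrightarrow> p + r \<in> FC N"
  using Poly_Mapping.keys_add[of p r] by (force simp: FC_iff)

lemma FC_minus [simp, intro]: "p \<in> FC N \<Longrightarrow> - p \<in> FC N"
  by (auto simp: FC_iff)

lemma FC_diff [simp, intro]: "p \<in> FC N \<Longrightarrow> r \<in> FC N \<Longrightarrow> p - r \<in> FC N"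
  using FC_add[of p N "- r"] by simp

lemma FC_mult [simp, intro]: "p \<in> FC N \<Longrightarrow> r \<in> FC N \<Longrightarrow> p * r \<in> FC N"
  using keys_mult[of p r] by (fastforce simp: FC_iff)

lemma FC_sum [simp, intro]: "(\<And>x. x \<in> J \<Longrightarrow> f x \<in> FC N) \<Longrightarrow> (\<Sum>x\<in>J. f x) \<in> FC N"
  by (induction J rule: infinite_finite_induct) auto

lemma FC_star [simp, intro]:
  assumes "p \<in> FC N"
  shows "free_star p \<in> FC N"
proof -
  have "set (letters w) \<subseteq> gens N" if "w \<in> Poly_Mapping.keys (free_star p)" for w
  proof -
    have "word_star w \<in> Poly_Mapping.keys p"
      using that by (simp add: in_keys_iff lookup_free_star)
    then have "set (letters (word_star w)) \<subseteq> gens N"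
      using assms by (auto simp: FC_iff)
    then show ?thesis
      by (auto simp: word_star_def)
  qed
  then show ?thesis
    by (simp add: FC_iff)
qed

lemma single_eq_gen_polys:
  "Poly_Mapping.single (Word gs) c = const c * prod_list (map gen_poly gs)"
proof (induction gs arbitrary: c)
  case Nil
  then show ?case
    by (simp add: const_def zero_word_def)
next
  case (Cons g gs)
  have "const c * prod_list (map gen_poly (g # gs)) = gen_poly g * Poly_Mapping.single (Word gs) c"
    by (simp add: Cons.IH const_left_commute)
  then show ?case
    by (simp add: gen_poly_def[of g] mult_single plus_word_def)
qed

text \<open>Words are products of generators, and members of \<open>FC N\<close> are sums of scaled
  words. Right multiplication and the differential are later controlled through this rule, from
  their values on constants and generators.\<close>

lemma FC_induct [consumes 1, case_names const gen add mult]: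
  assumes p: "p \<in> FC N"
    and const: "\<And>c. P (const c)"
    and gen: "\<And>g. g \<in> gens N \<Longrightarrow> P (gen_poly g)"
    and add: "\<And>p r. p \<in> FC N \<Longrightarrow> r \<in> FC N \<Longrightarrow> P p \<Longrightarrow> P r \<Longrightarrow> P (p + r)"
    and mult: "\<And>p r. p \<in> FC N \<Longrightarrow> r \<in> FC N \<Longrightarrow> P p \<Longrightarrow> P r \<Longrightarrow> P (p * r)"
  shows "P p"
proof -
  have prod: "P (prod_list (map gen_poly gs)) \<and> prod_list (map gen_poly gs) \<in> FC N"
    if "set gs \<subseteq> gens N" for gs
    using that const[of 1] by (induction gs) (auto intro!: mult gen)
  have mono: "P (Poly_Mapping.single w c) \<and> Poly_Mapping.single w c \<in> FC N"
    if "set (letters w) \<subseteq> gens N" for w c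
  proof -
    have "Poly_Mapping.single w c = const c * prod_list (map gen_poly (letters w))"
      using single_eq_gen_polys[of "letters w" c] by simp
    then show ?thesis
      using prod[OF that] const by (auto intro!: mult)
  qed
  have sums: "P (\<Sum>w\<in>J. Poly_Mapping.single w (c w)) \<and> (\<Sum>w\<in>J. Poly_Mapping.single w (c w)) \<in> FC N"
    if "\<And>w. w \<in> J \<Longrightarrow> set (letters w) \<subseteq> gens N" for J c
    using that const[of 0]
    by (induction J rule: infinite_finite_induct) (auto intro!: add simp: mono)
  have "P (\<Sum>w\<in>Poly_Mapping.keys p. Poly_Mapping.single w (Poly_Mapping.lookup p w))"
    using sums[of "Poly_Mapping.keys p"] p by (auto simp: FC_iff)
  then show ?thesis
    by (simp flip: free_alg_monomials)
qed

lemma free_star_alg_simps [simp]: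
  "mult (free_star_alg N) = (*)" "one (free_star_alg N) = 1" "zero (free_star_alg N) = 0"
  "add (free_star_alg N) = (+)" "cscale (free_star_alg N) = (\<lambda>c p. const c * p)"
  "cstar (free_star_alg N) = free_star"
  by (simp_all add: free_star_alg_def)

text \<open>Connects type class arithmetic on polynomials with the record based ring theory in which
  ideals and quotients are stated.\<close>

lemma ring_free_star_alg: "ring (free_star_alg N)"
proof (rule ringI)
  show "abelian_group (free_star_alg N)"
  proof (rule abelian_groupI)
    fix p assume "p \<in> FC N"
    then show "\<exists>r\<in>FC N. r \<oplus>\<^bsub>free_star_alg N\<^esub> p = \<zero>\<^bsub>free_star_alg N\<^esub>"
      by (intro bexI[of _ "- p"]) auto
  qed (auto simp: ac_simps)
  show "monoid (free_star_alg N)"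
    by (rule monoidI) (auto simp: mult.assoc)
qed (auto simp: algebra_simps)

section \<open>The coordinate algebra of the sphere\<close>

locale quantum_sphere =
  fixes N :: nat and q :: real
  assumes q_nonzero [simp]: "q \<noteq> 0"
begin

abbreviation "I \<equiv> sphere_ideal N q"
abbreviation "A \<equiv> sphere N q"
abbreviation cls :: "free_alg \<Rightarrow> free_alg set" where
  "cls p \<equiv> I +>\<^bsub>free_star_alg N\<^esub> p"
abbreviation z :: "nat \<Rightarrow> free_alg" where "z i \<equiv> gen_poly (Z i)"
abbreviation zs :: "nat \<Rightarrow> free_alg" where "zs i \<equiv> gen_poly (Zs i)"

lemma sphere_relations_FC: "sphere_relations N q \<subseteq> FC N"
  by (auto simp: sphere_relations_def Let_def intro!: FC_add FC_diff FC_mult FC_sum FC_gen)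

lemma ideal_I: "ideal I (free_star_alg N)"
  unfolding sphere_ideal_def
  by (rule ring.genideal_ideal[OF ring_free_star_alg sphere_relations_FC])

sublocale FI: ideal I "free_star_alg N"
  by (rule ideal_I)

lemma I_FC: "p \<in> I \<Longrightarrow> p \<in> FC N"
  by (rule FI.a_Hcarr)

lemma I_zero [simp, intro]: "0 \<in> I"
  using additive_subgroup.zero_closed[OF FI.is_additive_subgroup] by simp

lemma I_add [intro]: "p \<in> I \<Longrightarrow> r \<in> I \<Longrightarrow> p + r \<in> I"
  using additive_subgroup.a_closed[OF FI.is_additive_subgroup] by simp

lemma I_mult_left [intro]: "p \<in> I \<Longrightarrow> r \<in> FC N \<Longrightarrow> r * p \<in> I"
  using FI.I_l_closed by simp

lemma I_mult_right [intro]: "p \<in> I \<Longrightarrow> r \<in> FC N \<Longrightarrow> p * r \<in> I"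
  using FI.I_r_closed by simp

lemma I_minus [intro]: "p \<in> I \<Longrightarrow> - p \<in> I"
  using I_mult_left[of p "const (-1)"] by (simp add: const_minus)

lemma I_diff [intro]: "p \<in> I \<Longrightarrow> r \<in> I \<Longrightarrow> p - r \<in> I"
  using I_add[of p "- r"] by auto

lemma I_relations: "p \<in> sphere_relations N q \<Longrightarrow> p \<in> I"
  unfolding sphere_ideal_def
  using ring.genideal_self[OF ring_free_star_alg sphere_relations_FC] by blast

lemma I_zz: "1 \<le> i \<Longrightarrow> i < j \<Longrightarrow> j \<le> N \<Longrightarrow> z i * z j - const q * (z j * z i) \<in> I"
  by (rule I_relations) (unfold sphere_relations_def Let_def, blast)

lemma I_zszs: "1 \<le> i \<Longrightarrow> i < j \<Longrightarrow> j \<le> N \<Longrightarrow> zs i * zs j - const (1 / q) * (zs j * zs i) \<in> I"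
  by (rule I_relations) (unfold sphere_relations_def Let_def, blast)

lemma I_zzs: "i \<in> {1..N} \<Longrightarrow> j \<in> {1..N} \<Longrightarrow> i \<noteq> j \<Longrightarrow> z i * zs j - const q * (zs j * z i) \<in> I"
  by (rule I_relations) (unfold sphere_relations_def Let_def, blast)

lemma I_comm:
  "i \<in> {1..N} \<Longrightarrow>
    z i * zs i - zs i * z i + const (1 / q * (q - 1 / q)) * (\<Sum>k\<in>{i<..N}. z k * zs k) \<in> I"
  by (rule I_relations) (unfold sphere_relations_def Let_def, blast)

lemma I_one: "(\<Sum>i\<in>{1..N}. z i * zs i) - 1 \<in> I"
  by (rule I_relations) (unfold sphere_relations_def Let_def, blast)

lemma cls_iff: "r \<in> cls p \<longleftrightarrow> (\<exists>x\<in>I. r = x + p)"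
  by (auto simp: a_r_coset_def')

lemma cls_eq_iff: 
  assumes "p \<in> FC N" "r \<in> FC N" 
  shows "cls p = cls r \<longleftrightarrow> p - r \<in> I"
proof
  assume "cls p = cls r"
  moreover have "p \<in> cls p"
    unfolding cls_iff by (intro bexI[of _ 0]) auto
  ultimately have "p \<in> cls r"
    by simp
  then obtain x where "x \<in> I" "p = x + r"
    unfolding cls_iff by blast
  then show "p - r \<in> I"
    by simp
next
  assume d: "p - r \<in> I"
  have "x + p \<in> cls r" "x + r \<in> cls p" if "x \<in> I" for x
    unfolding cls_iff using I_add[OF that d] I_diff[OF that d]
    by (auto intro: bexI[of _ "x + (p - r)"] bexI[of _ "x - (p - r)"])
  then show "cls p = cls r"
    unfolding set_eq_iff cls_iff by blast
qed

lemma sphere_carrier: "carrier A = cls ` FC N"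
  by (auto simp: sphere_def Let_def FactRing_def A_RCOSETS_def')

lemma cls_closed [simp, intro]: "p \<in> FC N \<Longrightarrow> cls p \<in> carrier A"
  by (simp add: sphere_carrier)

lemma cls_mult [simp]: "p \<in> FC N \<Longrightarrow> r \<in> FC N \<Longrightarrow> cls p \<otimes>\<^bsub>A\<^esub> cls r = cls (p * r)"
  using FI.rcoset_mult_add[of p r] by (simp add: sphere_def Let_def FactRing_def)

lemma cls_add [simp]: "p \<in> FC N \<Longrightarrow> r \<in> FC N \<Longrightarrow> cls p \<oplus>\<^bsub>A\<^esub> cls r = cls (p + r)"
  using FI.a_rcos_sum[of p r] by (simp add: sphere_def Let_def FactRing_def)

lemma cls_one: "\<one>\<^bsub>A\<^esub> = cls 1"
  by (simp add: sphere_def Let_def FactRing_def)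

lemma cls_zero: "\<zero>\<^bsub>A\<^esub> = cls 0"
proof -
  have "r \<in> cls 0 \<longleftrightarrow> r \<in> I" for r
    unfolding cls_iff by simp
  then have "cls 0 = I"
    by blast
  then show ?thesis
    by (simp add: sphere_def Let_def FactRing_def)
qed

text \<open>\<open>sphere\<close> scales a coset by a union over its representatives. As I absorbs
  constants, all members of this union are the same coset.\<close>

lemma cls_cscale [simp]: "p \<in> FC N \<Longrightarrow> cscale A c (cls p) = cls (const c * p)"
proof -
  assume p: "p \<in> FC N"
  have "cls (const c * r) = cls (const c * p)" if r: "r \<in> cls p" for r
  proof -
    obtain x where x: "x \<in> I" "r = x + p"
      using r unfolding cls_iff by blast
    then show ?thesis
      using p I_FC[OF x(1)] I_mult_left[OF x(1), of "const c"]
      by (intro cls_eq_iff[THEN iffD2]) (simp_all add: distrib_left)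
  qed
  moreover have "p \<in> cls p"
    unfolding cls_iff by (intro bexI[of _ 0]) auto
  ultimately have "(\<Union>r\<in>cls p. cls (const c * r)) = cls (const c * p)"
    by (metis (no_types, lifting) SUP_eq_const empty_iff)
  then show ?thesis
    by (simp add: sphere_def Let_def)
qed

text \<open>The polynomials whose adjoint lies in I form a two-sided ideal, because the involution
  exchanges left and right factors. It contains the relations, hence all of I, the smallest such
  ideal.\<close>

lemma free_star_I:
  assumes "p \<in> I"
  shows "free_star p \<in> I"
proof -
  let ?J = "{p \<in> FC N. free_star p \<in> I}"
  have "ideal ?J (free_star_alg N)"
  proof (rule idealI)
    show "subgroup ?J (add_monoid (free_star_alg N))"
    proof (rule group.subgroupI)
      show "group (add_monoid (free_star_alg N))"
        by (rule FI.a_group)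
      fix p assume "p \<in> ?J"
      moreover have "inv\<^bsub>add_monoid (free_star_alg N)\<^esub> p = - p" if "p \<in> FC N" for p
        unfolding a_inv_def[symmetric] by (rule FI.minus_equality) (use that in auto)
      ultimately show "inv\<^bsub>add_monoid (free_star_alg N)\<^esub> p \<in> ?J"
        by (auto simp: free_star_minus)
    qed (auto simp: free_star_add intro: exI[of _ 0])
  qed (auto simp: free_star_mult FI.ring_axioms)
  moreover have "sphere_relations N q \<subseteq> ?J"
  proof
    fix p assume p: "p \<in> sphere_relations N q"
    \<comment> \<open>As q is real, the adjoint of a relation among the z is -q times a relation
      among the zs; the converse direction has the factor -1/q.\<close>
    have 1: "free_star (z i * z j - const q * (z j * z i)) \<in> I" if "1 \<le> i" "i < j" "j \<le> N" for i j
    proof -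
      have "free_star (z i * z j - const q * (z j * z i)) =
          const (- q) * (zs i * zs j - const (1 / q) * (zs j * zs i))"
        by (simp add: free_star_diff free_star_mult const_central[of "zs i * zs j"] right_diff_distrib
            const_minus mult.assoc[symmetric] const_mult[symmetric])
      then show ?thesis using I_zszs[OF that] by auto
    qed
    have 2: "free_star (zs i * zs j - const (1 / q) * (zs j * zs i)) \<in> I" if "1 \<le> i" "i < j" "j \<le> N" for i j
    proof -
      have "free_star (zs i * zs j - const (1 / q) * (zs j * zs i)) =
          const (- (1 / q)) * (z i * z j - const q * (z j * z i))"
        by (simp add: free_star_diff free_star_mult const_central[of "z i * z j"] right_diff_distrib
            const_minus mult.assoc[symmetric] const_mult[symmetric])
      then show ?thesis using I_zz[OF that] by auto
    qed
    \<comment> \<open>The mixed relations are permuted by exchanging i and j; the remaining two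
      kinds are self-adjoint.\<close>
    have 3: "free_star (z i * zs j - const q * (zs j * z i)) \<in> I"
      if "i \<in> {1..N}" "j \<in> {1..N}" "i \<noteq> j" for i j
    proof -
      have "free_star (z i * zs j - const q * (zs j * z i)) = z j * zs i - const q * (zs i * z j)"
        by (simp add: free_star_diff free_star_mult const_central[of "zs i * z j"])
      then show ?thesis using I_zzs[of j i] that by auto
    qed
    have 4: "free_star (z i * zs i - zs i * z i + const (1 / q * (q - 1 / q)) * (\<Sum>k\<in>{i<..N}. z k * zs k)) \<in> I"
      if "i \<in> {1..N}" for i
      using I_comm[OF that]
      by (simp add: free_star_diff free_star_add free_star_mult free_star_sum
          const_central[of "\<Sum>k\<in>{i<..N}. z k * zs k"])
    have 5: "free_star ((\<Sum>i\<in>{1..N}. z i * zs i) - 1) \<in> I"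
      using I_one by (simp add: free_star_diff free_star_mult free_star_sum)
    have "free_star p \<in> I"
      using p unfolding sphere_relations_def Let_def Un_iff mem_Collect_eq singleton_iff
      by (elim disjE exE conjE) (simp_all only: 1 2 3 4 5 simp_thms)
    then show "p \<in> ?J"
      using p sphere_relations_FC by auto
  qed
  ultimately have "I \<subseteq> ?J"
    unfolding sphere_ideal_def by (rule ring.genideal_minimal[OF ring_free_star_alg])
  then show ?thesis
    using assms by auto
qed

lemma cls_star [simp]: "p \<in> FC N \<Longrightarrow> cstar A (cls p) = cls (free_star p)"
proof -
  assume p: "p \<in> FC N"
  have "free_star r \<in> cls (free_star p)" if "r \<in> cls p" for r p
  proof -
    obtain x where "x \<in> I" "r = x + p"
      using \<open>r \<in> cls p\<close> unfolding cls_iff by blast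
    then show ?thesis
      unfolding cls_iff by (intro bexI[of _ "free_star x"]) (auto simp: free_star_add free_star_I)
  qed
  then have "free_star ` cls p = cls (free_star p)"
    by (force intro!: image_eqI[where x = "free_star _"])
  then show ?thesis
    by (simp add: sphere_def Let_def)
qed

lemma sphere_gen_cls: "sphere_gen N q g = cls (gen_poly g)"
  by (simp add: sphere_gen_def)

end

section \<open>Coordinates in a calculus\<close>

definition unit_vec :: "gen \<Rightarrow> free_alg \<Rightarrow> gen \<Rightarrow> free_alg" where
  "unit_vec h p = (\<lambda>g. if g = h then p else 0)"

text \<open>Unlike \<open>free_vectors\<close>, these vectors have entries in the free algebra and
  are unconstrained outside \<open>gens N\<close>, so that pointwise ring arithmetic applies
  directly; cosets are formed only when a vector is evaluated in a calculus.\<close>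

definition vecs :: "nat \<Rightarrow> (gen \<Rightarrow> free_alg) set" where
  "vecs N = {v. \<forall>g\<in>gens N. v g \<in> FC N}"

lemma vecsI: "(\<And>g. g \<in> gens N \<Longrightarrow> v g \<in> FC N) \<Longrightarrow> v \<in> vecs N"
  by (simp add: vecs_def)

lemma vecs_FC [simp]: "v \<in> vecs N \<Longrightarrow> g \<in> gens N \<Longrightarrow> v g \<in> FC N"
  by (simp add: vecs_def)

lemma vecs_add [simp, intro]: "v \<in> vecs N \<Longrightarrow> w \<in> vecs N \<Longrightarrow> (\<lambda>g. v g + w g) \<in> vecs N"
  by (simp add: vecsI)

lemma vecs_mult [simp, intro]: "p \<in> FC N \<Longrightarrow> w \<in> vecs N \<Longrightarrow> (\<lambda>g. p * w g) \<in> vecs N"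
  by (simp add: vecsI)

lemma vecs_sum [simp, intro]: "(\<And>i. i \<in> J \<Longrightarrow> v i \<in> vecs N) \<Longrightarrow> (\<lambda>g. \<Sum>i\<in>J. v i g) \<in> vecs N"
  by (simp add: vecsI)

lemma vecs_unit_vec [simp, intro]: "p \<in> FC N \<Longrightarrow> unit_vec h p \<in> vecs N"
  by (simp add: vecsI unit_vec_def)

lemma vecs_zero [simp, intro]: "(\<lambda>g. 0) \<in> vecs N"
  by (simp add: vecsI)

text \<open>The order of the four cases is that of the rules in \<open>two_form_relations\<close>
  and \<open>one_form_relations\<close>, which can thus be compared conjunct by conjunct.\<close>

lemma ball_gens_pairs:
  "(\<forall>h\<in>gens N. \<forall>h'\<in>gens N. P h h') \<longleftrightarrow>
   (\<forall>k\<in>{1..N}. \<forall>l\<in>{1..N}. P (Z k) (Z l) \<and> P (Zs k) (Zs l) \<and> P (Z k) (Zs l) \<and> P (Zs k) (Z l))"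
  by (auto simp: gens_def)

context quantum_sphere
begin

definition omega_plus :: "gen \<Rightarrow> free_alg" where
  "omega_plus g = (case g of Z i \<Rightarrow> 0 | Zs i \<Rightarrow> z i)"

definition omega_minus :: "gen \<Rightarrow> free_alg" where
  "omega_minus g = (case g of Z i \<Rightarrow> const (q powi (- 2 * int i)) * zs i | Zs i \<Rightarrow> 0)"

definition omega :: "complex \<Rightarrow> complex \<Rightarrow> gen \<Rightarrow> free_alg" where
  "omega u v = (\<lambda>g. const u * omega_plus g + const v * omega_minus g)"

lemma omega_plus_vecs [simp, intro]: "omega_plus \<in> vecs N"
  by (rule vecsI) (auto simp: omega_plus_def gens_def)

lemma omega_minus_vecs [simp, intro]: "omega_minus \<in> vecs N"
  by (rule vecsI) (auto simp: omega_minus_def gens_def)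

lemma omega_vecs [simp, intro]: "omega u v \<in> vecs N"
  by (auto simp: omega_def)

text \<open>Coordinates of \<open>dh \<cdot> h'\<close>: \<open>rmat\<close> collects the terms without \<open>\<Omega>\<^sub>+\<close> and \<open>\<Omega>\<^sub>-\<close>, and
  \<open>om_coeff\<close> gives the coefficient of one of these two.\<close>

fun om_coeff ::
  "complex \<Rightarrow> complex \<Rightarrow> complex \<Rightarrow> complex \<Rightarrow> complex \<Rightarrow> complex \<Rightarrow> gen \<Rightarrow> gen \<Rightarrow> free_alg" where
  "om_coeff x1 x2 x3 x4 y3 y4 (Z k) (Z l) = const x1 * (z k * z l)"
| "om_coeff x1 x2 x3 x4 y3 y4 (Zs k) (Zs l) = const x2 * (zs k * zs l)"
| "om_coeff x1 x2 x3 x4 y3 y4 (Z k) (Zs l) =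
     const x3 * (z k * zs l) + const (y3 * q ^ (2 * k) * (if k = l then 1 else 0))"
| "om_coeff x1 x2 x3 x4 y3 y4 (Zs k) (Z l) =
     const x4 * (zs k * z l) + const (y4 * (if k = l then 1 else 0))"

fun rmat :: "'x one_coeffs_scheme \<Rightarrow> gen \<Rightarrow> gen \<Rightarrow> gen \<Rightarrow> free_alg" where
  "rmat K (Z k) (Z l) = (\<lambda>g.
     (\<Sum>s\<in>{1..N}. \<Sum>t\<in>{1..N}. unit_vec (Z t) (const (a\<^sub>1 K * Rhat_inv q s t k l) * z s) g)
     + unit_vec (Z l) (const (b\<^sub>1 K) * z k) g)"
| "rmat K (Zs k) (Zs l) = (\<lambda>g.
     (\<Sum>s\<in>{1..N}. \<Sum>t\<in>{1..N}. unit_vec (Zs t) (const (a\<^sub>2 K * Rcheck q s t k l) * zs s) g)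
     + unit_vec (Zs l) (const (b\<^sub>2 K) * zs k) g)"
| "rmat K (Z k) (Zs l) = (\<lambda>g.
     (\<Sum>s\<in>{1..N}. \<Sum>t\<in>{1..N}. unit_vec (Z t) (const (a\<^sub>3 K * Rgrave_inv q s t k l) * zs s) g)
     + unit_vec (Zs l) (const (b\<^sub>3 K) * z k) g)"
| "rmat K (Zs k) (Z l) = (\<lambda>g.
     (\<Sum>s\<in>{1..N}. \<Sum>t\<in>{1..N}. unit_vec (Zs t) (const (a\<^sub>4 K * Racute q s t k l) * z s) g)
     + unit_vec (Z l) (const (b\<^sub>4 K) * zs k) g)"

text \<open>Stated for the record scheme: it is the coefficient of Omega_+ for a free calculus and
  that of the single remaining form for a quotient.\<close>

definition c_coeff :: "'x one_coeffs_scheme \<Rightarrow> gen \<Rightarrow> gen \<Rightarrow> free_alg" where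
  "c_coeff K = om_coeff (c\<^sub>1 K) (c\<^sub>2 K) (c\<^sub>3 K) (c\<^sub>4 K) (d\<^sub>3 K) (d\<^sub>4 K)"

definition e_coeff :: "two_coeffs \<Rightarrow> gen \<Rightarrow> gen \<Rightarrow> free_alg" where
  "e_coeff K = om_coeff (e\<^sub>1 K) (e\<^sub>2 K) (e\<^sub>3 K) (e\<^sub>4 K) (f\<^sub>3 K) (f\<^sub>4 K)"

definition rho_two :: "two_coeffs \<Rightarrow> gen \<Rightarrow> gen \<Rightarrow> gen \<Rightarrow> free_alg" where
  "rho_two K h h' = (\<lambda>g. rmat K h h' g + c_coeff K h h' * omega_plus g + e_coeff K h h' * omega_minus g)"

text \<open>The vector w holds the coordinates of the remaining form, which is Omega_+ or Omega_-
  depending on the relation.\<close>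

definition rho_one :: "one_coeffs \<Rightarrow> (gen \<Rightarrow> free_alg) \<Rightarrow> gen \<Rightarrow> gen \<Rightarrow> gen \<Rightarrow> free_alg" where
  "rho_one K w h h' = (\<lambda>g. rmat K h h' g + c_coeff K h h' * w g)"

lemma om_coeff_FC [simp, intro]:
  "h \<in> gens N \<Longrightarrow> h' \<in> gens N \<Longrightarrow> om_coeff x1 x2 x3 x4 y3 y4 h h' \<in> FC N"
  by (cases h; cases h') (auto simp del: mult_eq_0_iff)

lemma c_coeff_FC [simp, intro]: "h \<in> gens N \<Longrightarrow> h' \<in> gens N \<Longrightarrow> c_coeff K h h' \<in> FC N"
  and e_coeff_FC [simp, intro]: "h \<in> gens N \<Longrightarrow> h' \<in> gens N \<Longrightarrow> e_coeff K2 h h' \<in> FC N"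
  by (auto simp: c_coeff_def e_coeff_def)

lemma rmat_vecs [simp, intro]: "h \<in> gens N \<Longrightarrow> h' \<in> gens N \<Longrightarrow> rmat K h h' \<in> vecs N"
  by (cases h; cases h') (auto intro!: vecs_add vecs_sum vecs_unit_vec FC_mult FC_gen)

lemma rho_two_vecs [simp, intro]: "h \<in> gens N \<Longrightarrow> h' \<in> gens N \<Longrightarrow> rho_two K h h' \<in> vecs N"
  unfolding rho_two_def by (intro vecs_add vecs_mult rmat_vecs) auto

lemma rho_one_vecs [simp, intro]:
  "w \<in> vecs N \<Longrightarrow> h \<in> gens N \<Longrightarrow> h' \<in> gens N \<Longrightarrow> rho_one K w h h' \<in> vecs N"
  unfolding rho_one_def by (intro vecs_add vecs_mult rmat_vecs) auto

end

section \<open>Evaluation of coordinate vectors in a calculus over the sphere\<close>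

locale sphere_calculus =
  quantum_sphere N q + first_order_calculus "sphere N q" C
  for N q and C :: "(free_alg set, 'm) calculus"
begin

abbreviation act :: "free_alg \<Rightarrow> 'm \<Rightarrow> 'm" where "act p m \<equiv> cls p \<odot>\<^bsub>C\<^esub> m"
abbreviation ract :: "'m \<Rightarrow> free_alg \<Rightarrow> 'm" where "ract m p \<equiv> rsmult C m (cls p)"
abbreviation dg :: "gen \<Rightarrow> 'm" where "dg g \<equiv> diff C (cls (gen_poly g))"

definition Lc :: "(gen \<Rightarrow> free_alg) \<Rightarrow> 'm" where
  "Lc v = (\<Oplus>\<^bsub>C\<^esub>g\<in>gens N. act (v g) (dg g))"

lemma act_closed [simp]: "p \<in> FC N \<Longrightarrow> m \<in> carrier C \<Longrightarrow> act p m \<in> carrier C"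
  by (rule lmult_closed) auto

lemma ract_closed [simp]: "p \<in> FC N \<Longrightarrow> m \<in> carrier C \<Longrightarrow> ract m p \<in> carrier C"
  by (rule rmult_closed) auto

lemma dg_closed [simp]: "g \<in> gens N \<Longrightarrow> dg g \<in> carrier C"
  by (rule diff_closed) auto

lemma act_add: "p \<in> FC N \<Longrightarrow> r \<in> FC N \<Longrightarrow> m \<in> carrier C \<Longrightarrow> act (p + r) m = act p m \<oplus>\<^bsub>C\<^esub> act r m"
  using lmult_add_left[of "cls p" "cls r" m] by simp

lemma act_act: "p \<in> FC N \<Longrightarrow> r \<in> FC N \<Longrightarrow> m \<in> carrier C \<Longrightarrow> act p (act r m) = act (p * r) m"
  using lmult_assoc[of "cls p" "cls r" m] by simp

lemma act_one [simp]: "m \<in> carrier C \<Longrightarrow> act 1 m = m"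
  using lmult_one[of m] by (simp add: cls_one)

lemma act_zero [simp]: "m \<in> carrier C \<Longrightarrow> act 0 m = \<zero>\<^bsub>C\<^esub>"
  using act_add[of 0 0 m] M.add.l_cancel_one[of "act 0 m" "act 0 m"] by simp

lemma act_zero_right [simp]: "p \<in> FC N \<Longrightarrow> act p \<zero>\<^bsub>C\<^esub> = \<zero>\<^bsub>C\<^esub>"
  using lmult_add_right[of "cls p" "\<zero>\<^bsub>C\<^esub>" "\<zero>\<^bsub>C\<^esub>"] M.add.l_cancel_one[of "act p \<zero>\<^bsub>C\<^esub>" "act p \<zero>\<^bsub>C\<^esub>"]
  by simp

lemma ract_zero_left [simp]: "p \<in> FC N \<Longrightarrow> ract \<zero>\<^bsub>C\<^esub> p = \<zero>\<^bsub>C\<^esub>"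
  using rmult_add_left[of "cls p" "\<zero>\<^bsub>C\<^esub>" "\<zero>\<^bsub>C\<^esub>"] M.add.l_cancel_one[of "ract \<zero>\<^bsub>C\<^esub> p" "ract \<zero>\<^bsub>C\<^esub> p"]
  by simp

lemma act_finsum:
  "p \<in> FC N \<Longrightarrow> f \<in> J \<rightarrow> carrier C \<Longrightarrow> act p (\<Oplus>\<^bsub>C\<^esub>i\<in>J. f i) = (\<Oplus>\<^bsub>C\<^esub>i\<in>J. act p (f i))"
  by (induction J rule: infinite_finite_induct) (auto simp: lmult_add_right Pi_def)

lemma ract_finsum:
  "p \<in> FC N \<Longrightarrow> f \<in> J \<rightarrow> carrier C \<Longrightarrow> ract (\<Oplus>\<^bsub>C\<^esub>i\<in>J. f i) p = (\<Oplus>\<^bsub>C\<^esub>i\<in>J. ract (f i) p)"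
  by (induction J rule: infinite_finite_induct) (auto simp: rmult_add_left Pi_def)

lemma Lc_closed [simp, intro]: "v \<in> vecs N \<Longrightarrow> Lc v \<in> carrier C"
  unfolding Lc_def by (rule M.finsum_closed) auto

lemma Lc_add: "v \<in> vecs N \<Longrightarrow> w \<in> vecs N \<Longrightarrow> Lc v \<oplus>\<^bsub>C\<^esub> Lc w = Lc (\<lambda>g. v g + w g)"
proof -
  assume v: "v \<in> vecs N" "w \<in> vecs N"
  then have "Lc (\<lambda>g. v g + w g) = (\<Oplus>\<^bsub>C\<^esub>g\<in>gens N. act (v g) (dg g) \<oplus>\<^bsub>C\<^esub> act (w g) (dg g))"
    unfolding Lc_def by (intro M.finsum_cong') (auto simp: act_add)
  also have "\<dots> = Lc v \<oplus>\<^bsub>C\<^esub> Lc w"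
    unfolding Lc_def by (rule M.finsum_addf) (use v in auto)
  finally show ?thesis ..
qed

lemma act_Lc: "p \<in> FC N \<Longrightarrow> v \<in> vecs N \<Longrightarrow> act p (Lc v) = Lc (\<lambda>g. p * v g)"
  unfolding Lc_def by (subst act_finsum) (auto intro!: M.finsum_cong' simp: act_act)

lemma Lc_zero [simp]: "Lc (\<lambda>g. 0) = \<zero>\<^bsub>C\<^esub>"
  unfolding Lc_def by (rule M.add.finprod_one_eqI) simp

lemma Lc_cong: "(\<And>g. g \<in> gens N \<Longrightarrow> v g = w g) \<Longrightarrow> w \<in> vecs N \<Longrightarrow> Lc v = Lc w"
  unfolding Lc_def by (rule M.finsum_cong') auto

text \<open>Through this rule the relations of the sphere act on coordinates: entries may be changed
  by elements of I.\<close>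

lemma Lc_congI:
  assumes "\<And>g. g \<in> gens N \<Longrightarrow> v g - w g \<in> I" "v \<in> vecs N" "w \<in> vecs N"
  shows "Lc v = Lc w"
proof -
  have "cls (v g) = cls (w g)" if "g \<in> gens N" for g
    using assms that by (simp add: cls_eq_iff)
  then show ?thesis
    unfolding Lc_def using assms by (intro M.finsum_cong') auto
qed

lemma act_dg: "p \<in> FC N \<Longrightarrow> h \<in> gens N \<Longrightarrow> act p (dg h) = Lc (unit_vec h p)"
proof -
  assume "p \<in> FC N" "h \<in> gens N"
  then have "(\<Oplus>\<^bsub>C\<^esub>g\<in>gens N. if h = g then act p (dg g) else \<zero>\<^bsub>C\<^esub>) = act p (dg h)"
    by (intro M.finsum_singleton) auto
  also have "(\<Oplus>\<^bsub>C\<^esub>g\<in>gens N. if h = g then act p (dg g) else \<zero>\<^bsub>C\<^esub>) = Lc (unit_vec h p)"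
    unfolding Lc_def using \<open>p \<in> FC N\<close> by (intro M.finsum_cong') (auto simp: unit_vec_def)
  finally show ?thesis ..
qed

lemma dg_Lc: "h \<in> gens N \<Longrightarrow> dg h = Lc (unit_vec h 1)"
  using act_dg[of 1 h] by simp

lemma Lc_sum:
  "(\<And>i. i \<in> J \<Longrightarrow> v i \<in> vecs N) \<Longrightarrow> (\<Oplus>\<^bsub>C\<^esub>i\<in>J. Lc (v i)) = Lc (\<lambda>g. \<Sum>i\<in>J. v i g)"
  by (induction J rule: infinite_finite_induct) (auto simp: Lc_add Pi_def)

text \<open>Right multiplication commutes with left coefficients, so on coordinates it is a matrix
  whose rows are the products dg p. It is applied to generators p, where the rows are given by the
  commutation rules.\<close>

lemma ract_Lc:
  assumes "v \<in> vecs N" "p \<in> FC N"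
    and "\<And>g. g \<in> gens N \<Longrightarrow> w g \<in> vecs N"
    and "\<And>g. g \<in> gens N \<Longrightarrow> ract (dg g) p = Lc (w g)"
  shows "ract (Lc v) p = Lc (\<lambda>g'. \<Sum>g\<in>gens N. v g * w g g')"
proof -
  have "ract (Lc v) p = (\<Oplus>\<^bsub>C\<^esub>g\<in>gens N. ract (act (v g) (dg g)) p)"
    unfolding Lc_def by (rule ract_finsum) (use assms in auto)
  also have "\<dots> = (\<Oplus>\<^bsub>C\<^esub>g\<in>gens N. Lc (\<lambda>g'. v g * w g g'))"
    using assms by (intro M.finsum_cong') (auto simp: lmult_rmult act_Lc)
  also have "\<dots> = Lc (\<lambda>g'. \<Sum>g\<in>gens N. v g * w g g')"
    by (rule Lc_sum) (use assms in auto)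
  finally show ?thesis .
qed

lemma left_comb_Lc: "v \<in> vecs N \<Longrightarrow> left_comb N q C (\<lambda>g\<in>gens N. cls (v g)) = Lc v"
  unfolding left_comb_def Lc_def sphere_gen_cls by (rule M.finsum_cong') auto

lemma vecs_free_vectors: "v \<in> vecs N \<Longrightarrow> (\<lambda>g\<in>gens N. cls (v g)) \<in> free_vectors N q"
  unfolding free_vectors_def by auto

lemma free_vectors_vecs:
  assumes "u \<in> free_vectors N q"
  obtains v where "v \<in> vecs N" "u = (\<lambda>g\<in>gens N. cls (v g))"
proof -
  have "\<forall>g\<in>gens N. \<exists>p. p \<in> FC N \<and> u g = cls p"
    using assms unfolding free_vectors_def sphere_carrier by blast
  then obtain v where v: "\<forall>g\<in>gens N. v g \<in> FC N \<and> u g = cls (v g)"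
    by metis
  have "u = (\<lambda>g\<in>gens N. cls (v g))"
    using assms v unfolding free_vectors_def by (intro ext) (auto simp: PiE_def extensional_def)
  with v show thesis
    by (intro that[of v] vecsI) auto
qed

lemma left_comb_image: "left_comb N q C ` free_vectors N q = Lc ` vecs N"
proof (intro equalityI subsetI)
  fix m assume "m \<in> left_comb N q C ` free_vectors N q"
  then obtain u where u: "u \<in> free_vectors N q" "m = left_comb N q C u"
    by auto
  from u(1) obtain v where "v \<in> vecs N" "u = (\<lambda>g\<in>gens N. cls (v g))"
    by (rule free_vectors_vecs)
  then show "m \<in> Lc ` vecs N"
    using u(2) by (simp add: left_comb_Lc)
next
  fix m assume "m \<in> Lc ` vecs N"
  then obtain v where v: "v \<in> vecs N" "m = Lc v"
    by auto
  then show "m \<in> left_comb N q C ` free_vectors N q"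
    by (intro image_eqI[OF _ vecs_free_vectors]) (simp_all add: left_comb_Lc)
qed

lemma left_comb_eq_zero_iff:
  "v \<in> vecs N \<Longrightarrow> (\<lambda>g\<in>gens N. cls (v g)) \<in> {v \<in> free_vectors N q. left_comb N q C v = \<zero>\<^bsub>C\<^esub>} \<longleftrightarrow>
     Lc v = \<zero>\<^bsub>C\<^esub>"
  by (simp add: left_comb_Lc vecs_free_vectors)

lemma Omega_plus_Lc: "Omega_plus N q C = Lc omega_plus"
proof -
  have "Omega_plus N q C = (\<Oplus>\<^bsub>C\<^esub>i\<in>{1..N}. Lc (unit_vec (Zs i) (z i)))"
    unfolding Omega_plus_def sphere_gen_cls by (rule M.finsum_cong') (auto simp: act_dg)
  also have "\<dots> = Lc (\<lambda>g. \<Sum>i\<in>{1..N}. unit_vec (Zs i) (z i) g)"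
    by (rule Lc_sum) auto
  also have "\<dots> = Lc omega_plus"
    by (rule Lc_cong) (auto simp: omega_plus_def unit_vec_def gens_def)
  finally show ?thesis .
qed

lemma Omega_minus_Lc: "Omega_minus N q C = Lc omega_minus"
proof -
  have "Omega_minus N q C = (\<Oplus>\<^bsub>C\<^esub>i\<in>{1..N}. Lc (unit_vec (Z i) (const (q powi (- 2 * int i)) * zs i)))"
    unfolding Omega_minus_def sphere_gen_cls by (rule M.finsum_cong') (auto simp: act_dg)
  also have "\<dots> = Lc (\<lambda>g. \<Sum>i\<in>{1..N}. unit_vec (Z i) (const (q powi (- 2 * int i)) * zs i) g)"
    by (rule Lc_sum) auto
  also have "\<dots> = Lc omega_minus"
    by (rule Lc_cong) (auto simp: omega_minus_def unit_vec_def gens_def)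
  finally show ?thesis .
qed

text \<open>Common shape of the four R-matrix sums; \<open>double_sums_Lc\<close> lists them as
  ready rewrite rules.\<close>

lemma double_sum_Lc:
  assumes "\<And>s. s \<in> {1..N} \<Longrightarrow> u s \<in> gens N" "\<And>t. t \<in> {1..N} \<Longrightarrow> y t \<in> gens N"
  shows "(\<Oplus>\<^bsub>C\<^esub>s\<in>{1..N}. \<Oplus>\<^bsub>C\<^esub>t\<in>{1..N}. cscale A (x s t) (cls (gen_poly (u s))) \<odot>\<^bsub>C\<^esub> dg (y t)) =
    Lc (\<lambda>g. \<Sum>s\<in>{1..N}. \<Sum>t\<in>{1..N}. unit_vec (y t) (const (x s t) * gen_poly (u s)) g)"
proof -
  have *: "(\<Oplus>\<^bsub>C\<^esub>t\<in>{1..N}. cscale A (x s t) (cls (gen_poly (u s))) \<odot>\<^bsub>C\<^esub> dg (y t)) =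
    Lc (\<lambda>g. \<Sum>t\<in>{1..N}. unit_vec (y t) (const (x s t) * gen_poly (u s)) g)" if "s \<in> {1..N}" for s
    using assms(1)[OF that] assms(2)
    by (subst Lc_sum[symmetric]) (auto intro!: M.finsum_cong' simp: act_dg)
  have "(\<Oplus>\<^bsub>C\<^esub>s\<in>{1..N}. \<Oplus>\<^bsub>C\<^esub>t\<in>{1..N}. cscale A (x s t) (cls (gen_poly (u s))) \<odot>\<^bsub>C\<^esub> dg (y t)) =
    (\<Oplus>\<^bsub>C\<^esub>s\<in>{1..N}. Lc (\<lambda>g. \<Sum>t\<in>{1..N}. unit_vec (y t) (const (x s t) * gen_poly (u s)) g))"
    using assms by (intro M.finsum_cong') (simp_all only: *, auto)
  also have "\<dots> = Lc (\<lambda>g. \<Sum>s\<in>{1..N}. \<Sum>t\<in>{1..N}. unit_vec (y t) (const (x s t) * gen_poly (u s)) g)"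
    using assms by (intro Lc_sum) auto
  finally show ?thesis .
qed

lemma double_sums_Lc:
  shows "(\<Oplus>\<^bsub>C\<^esub>s\<in>{1..N}. \<Oplus>\<^bsub>C\<^esub>t\<in>{1..N}. cscale A (x s t) (cls (gen_poly (Z s))) \<odot>\<^bsub>C\<^esub> dg (Z t)) =
    Lc (\<lambda>g. \<Sum>s\<in>{1..N}. \<Sum>t\<in>{1..N}. unit_vec (Z t) (const (x s t) * gen_poly (Z s)) g)"
    and "(\<Oplus>\<^bsub>C\<^esub>s\<in>{1..N}. \<Oplus>\<^bsub>C\<^esub>t\<in>{1..N}. cscale A (x s t) (cls (gen_poly (Zs s))) \<odot>\<^bsub>C\<^esub> dg (Zs t)) =
    Lc (\<lambda>g. \<Sum>s\<in>{1..N}. \<Sum>t\<in>{1..N}. unit_vec (Zs t) (const (x s t) * gen_poly (Zs s)) g)"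
    and "(\<Oplus>\<^bsub>C\<^esub>s\<in>{1..N}. \<Oplus>\<^bsub>C\<^esub>t\<in>{1..N}. cscale A (x s t) (cls (gen_poly (Zs s))) \<odot>\<^bsub>C\<^esub> dg (Z t)) =
    Lc (\<lambda>g. \<Sum>s\<in>{1..N}. \<Sum>t\<in>{1..N}. unit_vec (Z t) (const (x s t) * gen_poly (Zs s)) g)"
    and "(\<Oplus>\<^bsub>C\<^esub>s\<in>{1..N}. \<Oplus>\<^bsub>C\<^esub>t\<in>{1..N}. cscale A (x s t) (cls (gen_poly (Z s))) \<odot>\<^bsub>C\<^esub> dg (Zs t)) =
    Lc (\<lambda>g. \<Sum>s\<in>{1..N}. \<Sum>t\<in>{1..N}. unit_vec (Zs t) (const (x s t) * gen_poly (Z s)) g)"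
  by (rule double_sum_Lc; simp)+

lemma double_sums_vecs:
  shows "(\<lambda>g. \<Sum>s\<in>{1..N}. \<Sum>t\<in>{1..N}. unit_vec (Z t) (const (x s t) * gen_poly (Z s)) g) \<in> vecs N"
    and "(\<lambda>g. \<Sum>s\<in>{1..N}. \<Sum>t\<in>{1..N}. unit_vec (Zs t) (const (x s t) * gen_poly (Zs s)) g) \<in> vecs N"
    and "(\<lambda>g. \<Sum>s\<in>{1..N}. \<Sum>t\<in>{1..N}. unit_vec (Z t) (const (x s t) * gen_poly (Zs s)) g) \<in> vecs N"
    and "(\<lambda>g. \<Sum>s\<in>{1..N}. \<Sum>t\<in>{1..N}. unit_vec (Zs t) (const (x s t) * gen_poly (Z s)) g) \<in> vecs N"
  by (intro vecs_sum vecs_unit_vec FC_mult; simp)+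

text \<open>With its counterpart for one form below, this lets the commutation rules enter the proof
  only as coordinate vectors of the products dh h'.\<close>

lemma two_form_relations_iff:
  "two_form_relations N q K C \<longleftrightarrow>
    (\<forall>h\<in>gens N. \<forall>h'\<in>gens N. ract (dg h) (gen_poly h') = Lc (rho_two K h h'))"
  unfolding ball_gens_pairs two_form_relations_def Let_def sphere_gen_cls Omega_plus_Lc Omega_minus_Lc
  by (intro ball_cong refl arg_cong2[where f = "(\<and>)"] arg_cong2[where f = "(=)"])
    (simp_all add: double_sums_Lc double_sums_vecs act_dg Lc_add act_Lc cls_one rho_two_def c_coeff_def e_coeff_def
      del: One_nat_def split del: if_split)

lemma one_form_relations_iff:
  assumes "w \<in> vecs N"
  shows "one_form_relations N q K C (Lc w) \<longleftrightarrow>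
    (\<forall>h\<in>gens N. \<forall>h'\<in>gens N. ract (dg h) (gen_poly h') = Lc (rho_one K w h h'))"
  unfolding ball_gens_pairs one_form_relations_def Let_def sphere_gen_cls
  using assms
  by (intro ball_cong refl arg_cong2[where f = "(\<and>)"] arg_cong2[where f = "(=)"])
    (simp_all add: double_sums_Lc double_sums_vecs act_dg Lc_add act_Lc cls_one rho_one_def c_coeff_def distrib_right
      add.assoc del: One_nat_def split del: if_split)

text \<open>The Leibniz rule for 1 = 1 1 reads d1 = d1 + d1.\<close>

lemma diff_one: "diff C (cls 1) = \<zero>\<^bsub>C\<^esub>"
proof -
  have "diff C (cls 1) \<in> carrier C"
    by (rule diff_closed) auto
  then show ?thesis
    using diff_mult[of "cls 1" "cls 1"] rmult_one[of "diff C (cls 1)"]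
      M.add.l_cancel_one[of "diff C (cls 1)" "diff C (cls 1)"] by (simp add: cls_one)
qed

lemma diff_const: "diff C (cls (const c)) = \<zero>\<^bsub>C\<^esub>"
  using diff_cscale[of "cls 1" c] by (simp add: diff_one cls_one)

lemma ract_const: "m \<in> carrier C \<Longrightarrow> ract m (const c) = act (const c) m"
  using scalar_central[of m c] by (simp add: cls_one)

end

section \<open>Right multiplication of \<open>\<Omega>\<^sub>+\<close> and \<open>\<Omega>\<^sub>-\<close>\<close>

text \<open>For fixed t and l, the R-matrix entries met below are sums of two delta terms in the
  summation indices: point masses, treated here, and a diagonal tail, treated by the next
  lemma.\<close>

lemma sum_delta_pair:
  assumes "a \<in> {1..N}" "b \<in> {1..(N::nat)}"
  shows "(\<Sum>i\<in>{1..N}. \<Sum>s\<in>{1..N}. const (if i = a \<and> s = b then c else 0) * X i s) = const c * X a b"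
proof -
  have "(\<Sum>s\<in>{1..N}. const (if i = a \<and> s = b then c else 0) * X i s) = (if i = a then const c * X a b else 0)" for i
    using assms(2) by (auto simp: if_distrib[of const] if_distrib[of "\<lambda>x. x * _"] cong: if_cong)
  then show ?thesis
    using assms(1) by simp
qed

lemma sum_delta_diag:
  assumes "l \<in> {1..(N::nat)}"
  shows "(\<Sum>i\<in>{1..N}. \<Sum>s\<in>{1..N}. const (if i = s \<and> l < i then c else 0) * X i s) =
    const c * (\<Sum>i\<in>{l<..N}. X i i)"
proof -
  have "(\<Sum>s\<in>{1..N}. const (if i = s \<and> l < i then c else 0) * X i s) = (if l < i then const c * X i i else 0)"
    if "i \<in> {1..N}" for i
    using that by (auto simp: if_distrib[of const] if_distrib[of "\<lambda>x. x * _"] cong: if_cong)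
  then have "(\<Sum>i\<in>{1..N}. \<Sum>s\<in>{1..N}. const (if i = s \<and> l < i then c else 0) * X i s) =
      (\<Sum>i\<in>{1..N}. if l < i then const c * X i i else 0)"
    by (intro sum.cong refl) auto
  also have "\<dots> = (\<Sum>i\<in>{l<..N}. const c * X i i)"
    by (rule sum.mono_neutral_cong_right) auto
  finally show ?thesis
    by (simp add: sum_distrib_left)
qed

context quantum_sphere
begin

text \<open>Equality in the sphere, expressed on representatives so that it chains with ring
  equalities of polynomials.\<close>

definition eqI :: "free_alg \<Rightarrow> free_alg \<Rightarrow> bool" (infix \<open>\<approx>\<close> 50) where
  "p \<approx> r \<longleftrightarrow> p - r \<in> I"

lemma eqI_refl [simp, intro]: "p \<approx> p"
  by (simp add: eqI_def)

lemma eqI_sym: "p \<approx> r \<Longrightarrow> r \<approx> p"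
  unfolding eqI_def using I_minus by fastforce

lemma eqI_trans [trans]: "p \<approx> r \<Longrightarrow> r \<approx> x \<Longrightarrow> p \<approx> x"
  unfolding eqI_def using I_add by fastforce

lemma eqI_add: "p \<approx> r \<Longrightarrow> p' \<approx> r' \<Longrightarrow> p + p' \<approx> r + r'"
  unfolding eqI_def using I_add[of "p - r" "p' - r'"] by (simp add: algebra_simps)

lemma eqI_mult_left: "x \<in> FC N \<Longrightarrow> p \<approx> r \<Longrightarrow> x * p \<approx> x * r"
  unfolding eqI_def using I_mult_left[of "p - r" x] by (simp add: algebra_simps)

lemma eqI_mult_right: "x \<in> FC N \<Longrightarrow> p \<approx> r \<Longrightarrow> p * x \<approx> r * x"
  unfolding eqI_def using I_mult_right[of "p - r" x] by (simp add: algebra_simps)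

lemma eqI_const: "p \<approx> r \<Longrightarrow> const c * p \<approx> const c * r"
  by (rule eqI_mult_left) auto

lemma eqI_const_swap: "c \<noteq> 0 \<Longrightarrow> p \<approx> const c * r \<Longrightarrow> r \<approx> const (1 / c) * p"
  using eqI_sym[OF eqI_const[of p "const c * r" "1 / c"]] by (simp flip: mult.assoc const_mult)

lemma zz_less: "i \<in> {1..N} \<Longrightarrow> j \<in> {1..N} \<Longrightarrow> i < j \<Longrightarrow> z i * z j \<approx> const q * (z j * z i)"
  unfolding eqI_def by (rule I_zz) auto

lemma zz_greater: "i \<in> {1..N} \<Longrightarrow> j \<in> {1..N} \<Longrightarrow> i < j \<Longrightarrow> z j * z i \<approx> const (1 / q) * (z i * z j)"
  using eqI_const_swap[OF _ zz_less] by simp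

lemma zszs_less: "i \<in> {1..N} \<Longrightarrow> j \<in> {1..N} \<Longrightarrow> i < j \<Longrightarrow> zs i * zs j \<approx> const (1 / q) * (zs j * zs i)"
  using I_zszs[of i j] unfolding eqI_def by auto

lemma zszs_greater: "i \<in> {1..N} \<Longrightarrow> j \<in> {1..N} \<Longrightarrow> i < j \<Longrightarrow> zs j * zs i \<approx> const q * (zs i * zs j)"
  using eqI_const_swap[OF _ zszs_less] by simp

lemma zzs: "i \<in> {1..N} \<Longrightarrow> j \<in> {1..N} \<Longrightarrow> i \<noteq> j \<Longrightarrow> z i * zs j \<approx> const q * (zs j * z i)"
  unfolding eqI_def by (rule I_zzs)

lemma zsz: "i \<in> {1..N} \<Longrightarrow> j \<in> {1..N} \<Longrightarrow> i \<noteq> j \<Longrightarrow> zs j * z i \<approx> const (1 / q) * (z i * zs j)"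
  using eqI_const_swap[OF _ zzs] by simp

lemma zsz_same:
  "i \<in> {1..N} \<Longrightarrow> zs i * z i \<approx> z i * zs i + const (1 - 1 / q^2) * (\<Sum>k\<in>{i<..N}. z k * zs k)"
proof -
  assume "i \<in> {1..N}"
  have "1 - 1 / q^2 = 1 / q * (q - 1 / q)"
    by (simp add: field_simps power2_eq_square)
  then have "z i * zs i + const (1 - 1 / q^2) * (\<Sum>k\<in>{i<..N}. z k * zs k) - zs i * z i \<in> I"
    using I_comm[OF \<open>i \<in> {1..N}\<close>] by (simp only: diff_add_eq)
  then show ?thesis
    by (intro eqI_sym[of "_ + _"]) (simp add: eqI_def)
qed

lemma sum_zzs: "(\<Sum>i\<in>{1..N}. z i * zs i) \<approx> 1"
  unfolding eqI_def by (rule I_one)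

section \<open>Weights of Omega_- and contractions of the R-matrices\<close>

definition wt :: "nat \<Rightarrow> real" where "wt i = q powi (- 2 * int i)"

lemma wt_Suc: "wt (Suc i) = wt i / q^2"
proof -
  have "- 2 * int (Suc i) = - 2 * int i - int 2"
    by simp
  then show ?thesis
    unfolding wt_def by (simp only: power_int_diff q_nonzero disj_not1 not_False_eq_True simp_thms power_int_of_nat)
qed

text \<open>The power is the factor occurring in \<open>Rgrave_inv\<close>; it turns the weight of
  one index into that of the other.\<close>

lemma wt_shift: "q powi (2 * int l - 2 * int t) * wt l = wt t"
  unfolding wt_def by (subst power_int_add[symmetric]) (auto simp: algebra_simps)

lemma wt_cancel: "wt i * q ^ (2 * i) = 1"
proof -
  have "q ^ (2 * i) = q powi (2 * int i)"
    using power_int_of_nat[of q "2 * i"] by simp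
  then show ?thesis
    unfolding wt_def by (simp add: power_int_minus)
qed

text \<open>Each \<open>zs i * z i\<close> is replaced by \<open>z i * zs i\<close> plus 1 - q^(-2)
  times the tail beyond i. With the weights q^(-2i), this correction and the induction hypothesis
  add up to the weight of the new term, so the sum telescopes downwards from the empty tail at l =
  N.\<close>

lemma sum_zsz_tail:
  "l \<le> N \<Longrightarrow> (\<Sum>i\<in>{l<..N}. const (wt i) * (zs i * z i)) \<approx> const (wt l / q^2) * (\<Sum>k\<in>{l<..N}. z k * zs k)"
proof (induction l rule: inc_induct)
  case base
  then show ?case by simp
next
  case (step l)
  let ?S = "\<Sum>k\<in>{Suc l<..N}. z k * zs k"
  have split: "{l<..N} = insert (Suc l) {Suc l<..N}"
    using step by auto
  have "(\<Sum>i\<in>{l<..N}. const (wt i) * (zs i * z i)) =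
      const (wt (Suc l)) * (zs (Suc l) * z (Suc l)) + (\<Sum>i\<in>{Suc l<..N}. const (wt i) * (zs i * z i))"
    unfolding split by simp
  also have "\<dots> \<approx> const (wt (Suc l)) * (z (Suc l) * zs (Suc l) + const (1 - 1 / q^2) * ?S) +
      const (wt (Suc l) / q^2) * ?S"
    using step by (intro eqI_add eqI_const zsz_same) auto
  also have "\<dots> = const (wt (Suc l)) * (z (Suc l) * zs (Suc l)) +
      const (of_real (wt (Suc l) * (1 - 1 / q^2) + wt (Suc l) / q^2)) * ?S"
    by (simp add: distrib_left distrib_right const_add const_mult mult.assoc)
  also have "wt (Suc l) * (1 - 1 / q^2) + wt (Suc l) / q^2 = wt (Suc l)"
    by (simp add: algebra_simps)
  also have "const (wt (Suc l)) * (z (Suc l) * zs (Suc l)) + const (of_real (wt (Suc l))) * ?S =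
      const (wt l / q^2) * (\<Sum>k\<in>{l<..N}. z k * zs k)"
    unfolding split by (simp add: wt_Suc distrib_left)
  finally show ?case .
qed

lemma sum_zsz: "(\<Sum>i\<in>{1..N}. const (wt i) * (zs i * z i)) \<approx> const (1 / q^2)"
proof -
  have "{0<..N} = {1..N}"
    by auto
  then have "(\<Sum>i\<in>{1..N}. const (wt i) * (zs i * z i)) \<approx> const (1 / q^2) * (\<Sum>k\<in>{1..N}. z k * zs k)"
    using sum_zsz_tail[of 0] by (simp add: wt_def)
  also have "\<dots> \<approx> const (1 / q^2) * 1"
    by (intro eqI_const sum_zzs)
  finally show ?thesis by simp
qed

text \<open>The quadratic relations say that the products of two z form an eigenvector of
  \<open>Rhat\<close> with eigenvalue q. The sum is the coordinate at \<open>Zs t\<close> of the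
  matrix part of Omega_+ times \<open>z l\<close>.\<close>

lemma Racute_sum:
  assumes "t \<in> {1..N}" "l \<in> {1..N}"
  shows "(\<Sum>i\<in>{1..N}. \<Sum>s\<in>{1..N}. const (Racute q s t i l) * (z i * z s)) \<approx> const q * (z l * z t)"
proof -
  \<comment> \<open>Only (i, s) = (t, l) and (i, s) = (l, t) give nonzero entries. For t = l they
    coincide, and the whole entry is booked under the second.\<close>
  let ?a = "if t = l then 0 else 1 :: complex"
  let ?b = "if t = l then of_real q else if l < t then of_real (q - 1 / q) else 0 :: complex"
  have "complex_of_real (Racute q s t i l) =
      (if i = t \<and> s = l then ?a else 0) + (if i = l \<and> s = t then ?b else 0)" for s i
    by (cases "i = t"; cases "s = l"; cases "i = l"; cases "s = t"; cases "i = s"; simp add: Racute_def Rhat_def)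
  then have *: "(\<Sum>i\<in>{1..N}. \<Sum>s\<in>{1..N}. const (Racute q s t i l) * (z i * z s)) =
      const ?a * (z t * z l) + const ?b * (z l * z t)"
    by (simp only: const_add distrib_right sum.distrib sum_delta_pair[OF assms]
        sum_delta_pair[OF assms(2,1)])
  consider "t = l" | "t < l" | "l < t" by linarith
  then show ?thesis
  proof cases
    case 1
    then show ?thesis unfolding * by simp
  next
    case 2
    then show ?thesis unfolding * using zz_less[OF assms] by simp
  next
    case 3
    \<comment> \<open>Reordering gives 1/q, and the second entry adds q - 1/q.\<close>
    have "const 1 * (z t * z l) + const (q - 1 / q) * (z l * z t) \<approx>
        const (1 / q) * (z l * z t) + const (q - 1 / q) * (z l * z t)"
      using zz_greater[OF assms(2,1) 3] by (intro eqI_add) auto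
    also have "\<dots> = const q * (z l * z t)"
      by (simp flip: distrib_right const_add)
    finally show ?thesis unfolding * using 3 by simp
  qed
qed

text \<open>For t = l the matrix contributes a diagonal tail, and the claim is the commutation
  relation of \<open>z l\<close> with \<open>zs l\<close> multiplied by q; for t different from l it
  is a mixed relation. This serves Omega_+ times \<open>zs l\<close>.\<close>

lemma Rcheck_sum:
  assumes "t \<in> {1..N}" "l \<in> {1..N}"
  shows "(\<Sum>i\<in>{1..N}. \<Sum>s\<in>{1..N}. const (Rcheck q s t i l) * (z i * zs s)) \<approx> const q * (zs l * z t)"
proof -
  let ?a = "if t = l then of_real q else 1 :: complex"
  let ?b = "if t = l then of_real (q - 1 / q) else 0 :: complex"
  have "complex_of_real (Rcheck q s t i l) =
      (if i = t \<and> s = l then ?a else 0) + (if i = s \<and> l < i then ?b else 0)" for s i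
    by (cases "i = t"; cases "s = l"; cases "i = l"; cases "s = t"; cases "i = s"; simp add: Rcheck_def Rhat_def)
  then have *: "(\<Sum>i\<in>{1..N}. \<Sum>s\<in>{1..N}. const (Rcheck q s t i l) * (z i * zs s)) =
      const ?a * (z t * zs l) + const ?b * (\<Sum>i\<in>{l<..N}. z i * zs i)"
    by (simp only: const_add distrib_right sum.distrib sum_delta_pair[OF assms]
        sum_delta_diag[OF assms(2)])
  show ?thesis
  proof (cases "t = l")
    case True
    have "const q * (zs l * z l) \<approx> const q * (z l * zs l + const (1 - 1 / q^2) * (\<Sum>k\<in>{l<..N}. z k * zs k))"
      by (intro eqI_const zsz_same assms)
    also have "\<dots> = const q * (z l * zs l) + const (of_real (q * (1 - 1 / q^2))) * (\<Sum>k\<in>{l<..N}. z k * zs k)"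
      by (simp add: distrib_left const_mult mult.assoc)
    also have "q * (1 - 1 / q^2) = q - 1 / q"
      by (simp add: field_simps power2_eq_square)
    finally show ?thesis unfolding * using True eqI_sym by simp
  next
    case False
    then show ?thesis unfolding * using zzs[OF assms] by simp
  qed
qed

text \<open>For t = l two tails arise, one from commuting \<open>zs l\<close> past
  \<open>z l\<close> and one from the matrix. By \<open>sum_zsz_tail\<close> both are multiples of
  the same sum, with opposite coefficients. This serves Omega_- times \<open>z l\<close>.\<close>

lemma Rhat_inv_sum:
  assumes "t \<in> {1..N}" "l \<in> {1..N}"
  shows "(\<Sum>i\<in>{1..N}. \<Sum>s\<in>{1..N}. const (Rhat_inv q s t i l) * (const (wt i) * (zs i * z s))) \<approx>
    const (1 / q) * (const (wt t) * (z l * zs t))"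
proof -
  let ?a = "if t = l then of_real (1 / q) else 1 :: complex"
  let ?b = "if t = l then of_real (- (q - 1 / q)) else 0 :: complex"
  have "complex_of_real (Rhat_inv q s t i l) =
      (if i = t \<and> s = l then ?a else 0) + (if i = s \<and> l < i then ?b else 0)" for s i
    by (cases "i = t"; cases "s = l"; cases "i = l"; cases "s = t"; cases "i = s"; simp add: Rhat_inv_def)
  then have *: "(\<Sum>i\<in>{1..N}. \<Sum>s\<in>{1..N}. const (Rhat_inv q s t i l) * (const (wt i) * (zs i * z s))) =
      const ?a * (const (wt t) * (zs t * z l)) + const ?b * (\<Sum>i\<in>{l<..N}. const (wt i) * (zs i * z i))"
    by (simp only: const_add distrib_right sum.distrib sum_delta_pair[OF assms]
        sum_delta_diag[OF assms(2)])
  show ?thesis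
  proof (cases "t = l")
    case True
    let ?S = "\<Sum>k\<in>{l<..N}. z k * zs k"
    have "const (1 / q) * (const (wt l) * (zs l * z l)) +
        const (of_real (- (q - 1 / q))) * (\<Sum>i\<in>{l<..N}. const (wt i) * (zs i * z i)) \<approx>
        const (1 / q) * (const (wt l) * (z l * zs l + const (1 - 1 / q^2) * ?S)) +
        const (of_real (- (q - 1 / q))) * (const (wt l / q^2) * ?S)"
      using assms by (intro eqI_add eqI_const zsz_same sum_zsz_tail) auto
    also have "\<dots> = const (1 / q) * (const (wt l) * (z l * zs l)) +
        const (of_real (1 / q * (wt l * (1 - 1 / q^2)) + - (q - 1 / q) * (wt l / q^2))) * ?S"
      by (simp only: of_real_add of_real_mult const_add const_mult distrib_left distrib_right mult.assoc add.assoc)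
    also have "1 / q * (wt l * (1 - 1 / q^2)) + - (q - 1 / q) * (wt l / q^2) = 0"
      by (simp add: field_simps power2_eq_square)
    finally show ?thesis unfolding * using True by simp
  next
    case False
    have "const (wt t) * (zs t * z l) \<approx> const (wt t) * (const (1 / q) * (z l * zs t))"
      using False by (intro eqI_const zsz assms) auto
    then show ?thesis unfolding * using False const_left_commute[of "const (wt t)" "of_real (1 / q)" "z l * zs t"] by simp
  qed
qed

text \<open>The power of q inside the matrix adapts the weights, after which the argument is that of
  \<open>Racute_sum\<close> with q replaced by 1/q. This serves Omega_- times
  \<open>zs l\<close>.\<close>

lemma Rgrave_inv_sum:
  assumes "t \<in> {1..N}" "l \<in> {1..N}"
  shows "(\<Sum>i\<in>{1..N}. \<Sum>s\<in>{1..N}. const (Rgrave_inv q s t i l) * (const (wt i) * (zs i * zs s))) \<approx>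
    const (1 / q) * (const (wt t) * (zs l * zs t))"
proof -
  let ?a = "if t = l then of_real (1 / q) else 1 :: complex"
  let ?b = "if l < t then of_real (- (q - 1 / q) * q powi (2 * int l - 2 * int t)) else 0 :: complex"
  have "complex_of_real (Rgrave_inv q s t i l) =
      (if i = t \<and> s = l then ?a else 0) + (if i = l \<and> s = t then ?b else 0)" for s i
    by (cases "i = t"; cases "s = l"; cases "i = l"; cases "s = t"; cases "i = s"; simp add: Rgrave_inv_def Rhat_inv_def)
  then have *: "(\<Sum>i\<in>{1..N}. \<Sum>s\<in>{1..N}. const (Rgrave_inv q s t i l) * (const (wt i) * (zs i * zs s))) =
      const ?a * (const (wt t) * (zs t * zs l)) + const ?b * (const (wt l) * (zs l * zs t))"
    by (simp only: const_add distrib_right sum.distrib sum_delta_pair[OF assms]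
        sum_delta_pair[OF assms(2,1)])
  consider "t = l" | "t < l" | "l < t" by linarith
  then show ?thesis
  proof cases
    case 1
    then show ?thesis unfolding * by simp
  next
    case 2
    have "const (wt t) * (zs t * zs l) \<approx> const (wt t) * (const (1 / q) * (zs l * zs t))"
      using 2 by (intro eqI_const zszs_less assms) auto
    then show ?thesis unfolding * using 2 const_left_commute[of "const (wt t)" "of_real (1 / q)" "zs l * zs t"] by simp
  next
    case 3
    have "const (wt t) * (zs t * zs l) + const (of_real (- (q - 1 / q) * q powi (2 * int l - 2 * int t))) * (const (wt l) * (zs l * zs t)) \<approx>
        const (wt t) * (const q * (zs l * zs t)) +
        const (of_real (- (q - 1 / q) * q powi (2 * int l - 2 * int t))) * (const (wt l) * (zs l * zs t))"
      using 3 by (intro eqI_add eqI_const zszs_greater assms) auto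
    also have "\<dots> = const (of_real (wt t * q + - (q - 1 / q) * (q powi (2 * int l - 2 * int t) * wt l))) * (zs l * zs t)"
      by (simp only: of_real_add of_real_mult const_add const_mult distrib_left distrib_right mult.assoc add.assoc)
    also have "wt t * q + - (q - 1 / q) * (q powi (2 * int l - 2 * int t) * wt l) = 1 / q * wt t"
      unfolding wt_shift by (simp add: algebra_simps)
    also have "const (of_real (1 / q * wt t)) * (zs l * zs t) = const (1 / q) * (const (wt t) * (zs l * zs t))"
      by (simp only: of_real_mult const_mult mult.assoc)
    finally show ?thesis unfolding * using 3 by simp
  qed
qed

end

lemma const_mult_left: "const a * (const b * r) = const (a * b) * r"
  by (simp add: const_mult mult.assoc)

lemma gen_poly_const: "gen_poly g * const c = const c * gen_poly g"
  by (rule const_central)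

lemma gen_poly_const_left: "gen_poly g * (const c * r) = const c * (gen_poly g * r)"
  by (rule const_left_commute)

lemmas const_normalize = const_mult_left gen_poly_const gen_poly_const_left mult.assoc

lemma sum_unit_vec:
  shows "t \<in> {1..N} \<Longrightarrow> (\<Sum>i\<in>{1..(N::nat)}. unit_vec (Z i) (f i) (Z t)) = f t"
    and "t \<in> {1..N} \<Longrightarrow> (\<Sum>i\<in>{1..(N::nat)}. unit_vec (Zs i) (f i) (Zs t)) = f t"
    and "unit_vec (Z i) p (Zs t) = 0" and "unit_vec (Zs i) p (Z t) = 0"
  by (auto simp: unit_vec_def)

section \<open>Coordinates of the products of Omega_+ and Omega_- with generators\<close>

context quantum_sphere
begin

lemma omega_plus_simps [simp]: "omega_plus (Z i) = 0" "omega_plus (Zs i) = z i"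
  by (simp_all add: omega_plus_def)

lemma omega_minus_simps [simp]: "omega_minus (Z i) = const (wt i) * zs i" "omega_minus (Zs i) = 0"
  by (simp_all add: omega_minus_def wt_def)

lemma sum_omega_plus: "(\<Sum>g\<in>gens N. omega_plus g * f g) = (\<Sum>i\<in>{1..N}. z i * f (Zs i))"
  by (simp add: sum_gens)

lemma sum_omega_minus: "(\<Sum>g\<in>gens N. omega_minus g * f g) = (\<Sum>i\<in>{1..N}. const (wt i) * (zs i * f (Z i)))"
  by (simp add: sum_gens mult.assoc)

text \<open>The sum over the first index contracts the quadratic terms by \<open>sum_zzs\<close>,
  while the delta terms select the index l. For Omega_- the contraction is \<open>sum_zsz\<close>,
  with the constant q^(-2).\<close>

lemma omega_plus_om_coeff:
  assumes "l \<in> {1..N}"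
  shows "(\<Sum>g\<in>gens N. omega_plus g * om_coeff x1 x2 x3 x4 y3 y4 g (Z l)) \<approx> const (x4 + y4) * z l"
    and "(\<Sum>g\<in>gens N. omega_plus g * om_coeff x1 x2 x3 x4 y3 y4 g (Zs l)) \<approx> const x2 * zs l"
proof -
  have "(\<Sum>g\<in>gens N. omega_plus g * om_coeff x1 x2 x3 x4 y3 y4 g (Z l)) =
      const x4 * ((\<Sum>i\<in>{1..N}. z i * zs i) * z l) + (\<Sum>i\<in>{1..N}. if i = l then const y4 * z i else 0)"
    unfolding sum_omega_plus om_coeff.simps sum_distrib_left sum_distrib_right sum.distrib[symmetric]
    by (intro sum.cong refl) (simp add: distrib_left const_normalize)
  also have "\<dots> \<approx> const x4 * (1 * z l) + const y4 * z l"
    using assms by (intro eqI_add eqI_const eqI_mult_right sum_zzs) auto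
  also have "\<dots> = const (x4 + y4) * z l"
    by (simp add: const_add distrib_right)
  finally show "(\<Sum>g\<in>gens N. omega_plus g * om_coeff x1 x2 x3 x4 y3 y4 g (Z l)) \<approx> const (x4 + y4) * z l" .
  have "(\<Sum>g\<in>gens N. omega_plus g * om_coeff x1 x2 x3 x4 y3 y4 g (Zs l)) =
      const x2 * ((\<Sum>i\<in>{1..N}. z i * zs i) * zs l)"
    unfolding sum_omega_plus om_coeff.simps sum_distrib_left sum_distrib_right
    by (intro sum.cong refl) (simp add: const_normalize)
  also have "\<dots> \<approx> const x2 * (1 * zs l)"
    using assms by (intro eqI_const eqI_mult_right sum_zzs) auto
  finally show "(\<Sum>g\<in>gens N. omega_plus g * om_coeff x1 x2 x3 x4 y3 y4 g (Zs l)) \<approx> const x2 * zs l"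
    by simp
qed

lemma omega_minus_om_coeff:
  assumes "l \<in> {1..N}"
  shows "(\<Sum>g\<in>gens N. omega_minus g * om_coeff x1 x2 x3 x4 y3 y4 g (Z l)) \<approx> const (x1 / q^2) * z l"
    and "(\<Sum>g\<in>gens N. omega_minus g * om_coeff x1 x2 x3 x4 y3 y4 g (Zs l)) \<approx> const (x3 / q^2 + y3) * zs l"
proof -
  have "(\<Sum>g\<in>gens N. omega_minus g * om_coeff x1 x2 x3 x4 y3 y4 g (Z l)) =
      const x1 * ((\<Sum>i\<in>{1..N}. const (wt i) * (zs i * z i)) * z l)"
    unfolding sum_omega_minus om_coeff.simps sum_distrib_left sum_distrib_right
    by (intro sum.cong refl) (simp add: const_normalize mult.commute)
  also have "\<dots> \<approx> const x1 * (const (1 / q^2) * z l)"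
    using assms by (intro eqI_const eqI_mult_right sum_zsz) auto
  also have "\<dots> = const (x1 / q^2) * z l"
    by (simp add: const_mult_left)
  finally show "(\<Sum>g\<in>gens N. omega_minus g * om_coeff x1 x2 x3 x4 y3 y4 g (Z l)) \<approx> const (x1 / q^2) * z l" .
  \<comment> \<open>The factor q^(2k) of the delta term cancels the weight with which Omega_-
    contains dz_k.\<close>
  have w: "complex_of_real (wt l) * (y3 * complex_of_real q ^ (l * 2)) = y3"
    using arg_cong[OF wt_cancel[of l], of complex_of_real] by (simp add: mult.commute)
  have "(\<Sum>g\<in>gens N. omega_minus g * om_coeff x1 x2 x3 x4 y3 y4 g (Zs l)) =
      const x3 * ((\<Sum>i\<in>{1..N}. const (wt i) * (zs i * z i)) * zs l) + (\<Sum>i\<in>{1..N}. if i = l then const y3 * zs i else 0)"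
    unfolding sum_omega_minus om_coeff.simps sum_distrib_left sum_distrib_right sum.distrib[symmetric]
    by (intro sum.cong refl) (auto simp add: distrib_left const_normalize mult.commute w)
  also have "\<dots> \<approx> const x3 * (const (1 / q^2) * zs l) + const y3 * zs l"
    using assms by (intro eqI_add eqI_const eqI_mult_right sum_zsz) auto
  also have "\<dots> = const (x3 / q^2 + y3) * zs l"
    by (simp add: const_add distrib_right const_mult_left)
  finally show "(\<Sum>g\<in>gens N. omega_minus g * om_coeff x1 x2 x3 x4 y3 y4 g (Zs l)) \<approx> const (x3 / q^2 + y3) * zs l" .
qed

text \<open>The coordinates at \<open>Zs t\<close> come from the matrix term alone and are
  contracted by \<open>Racute_sum\<close>. Those at \<open>Z t\<close> come from the b term alone,
  where the factor in front of dz_l sums to a constant. The three lemmas after it follow the same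
  scheme; in the next two, both terms meet in the same coordinates.\<close>

lemma omega_plus_rmat_Z:
  assumes l: "l \<in> {1..N}" and g': "g' \<in> gens N"
  shows "(\<Sum>g\<in>gens N. omega_plus g * rmat K g (Z l) g') \<approx>
    const (q * a\<^sub>4 K) * z l * omega_plus g' + unit_vec (Z l) (const (b\<^sub>4 K)) g'"
proof (cases g')
  case [simp]: (Zs t)
  then have t: "t \<in> {1..N}"
    using g' by simp
  have "(\<Sum>g\<in>gens N. omega_plus g * rmat K g (Z l) g') =
      const (a\<^sub>4 K) * (\<Sum>i\<in>{1..N}. \<Sum>s\<in>{1..N}. const (Racute q s t i l) * (z i * z s))"
    unfolding sum_omega_plus rmat.simps Zs sum_unit_vec(2)[OF t] sum_unit_vec(3) sum_distrib_left add_0_right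
    by (intro sum.cong refl) (simp add: const_normalize)
  also have "\<dots> \<approx> const (a\<^sub>4 K) * (const q * (z l * z t))"
    by (intro eqI_const Racute_sum t l)
  finally show ?thesis
    by (simp add: sum_unit_vec const_normalize mult.commute)
next
  case [simp]: (Z t)
  have "(\<Sum>g\<in>gens N. omega_plus g * rmat K g (Z l) g') =
      (if t = l then const (b\<^sub>4 K) * (\<Sum>i\<in>{1..N}. z i * zs i) else 0)"
    unfolding sum_omega_plus rmat.simps Z sum_unit_vec(4)
    by (auto simp: unit_vec_def sum_distrib_left const_normalize)
  also have "\<dots> \<approx> (if t = l then const (b\<^sub>4 K) * 1 else 0)"
    using eqI_const[OF sum_zzs, of "b\<^sub>4 K"] by auto
  finally show ?thesis
    by (cases "t = l") (simp_all add: unit_vec_def)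
qed

lemma omega_plus_rmat_Zs:
  assumes l: "l \<in> {1..N}" and g': "g' \<in> gens N"
  shows "(\<Sum>g\<in>gens N. omega_plus g * rmat K g (Zs l) g') \<approx>
    const (q * a\<^sub>2 K) * zs l * omega_plus g' + unit_vec (Zs l) (const (b\<^sub>2 K)) g'"
proof (cases g')
  case [simp]: (Zs t)
  then have t: "t \<in> {1..N}"
    using g' by simp
  have "(\<Sum>g\<in>gens N. omega_plus g * rmat K g (Zs l) g') =
      const (a\<^sub>2 K) * (\<Sum>i\<in>{1..N}. \<Sum>s\<in>{1..N}. const (Rcheck q s t i l) * (z i * zs s)) +
      (if t = l then const (b\<^sub>2 K) * (\<Sum>i\<in>{1..N}. z i * zs i) else 0)"
    unfolding sum_omega_plus rmat.simps Zs sum_unit_vec(2)[OF t] sum_distrib_left distrib_left sum.distrib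
    by (auto simp: unit_vec_def const_normalize)
  also have "\<dots> \<approx> const (a\<^sub>2 K) * (const q * (zs l * z t)) + (if t = l then const (b\<^sub>2 K) * 1 else 0)"
    using eqI_const[OF sum_zzs, of "b\<^sub>2 K"] by (intro eqI_add eqI_const Rcheck_sum t l) auto
  finally show ?thesis
    by (cases "t = l") (simp_all add: unit_vec_def const_normalize mult.commute)
next
  case [simp]: (Z t)
  show ?thesis
    unfolding sum_omega_plus rmat.simps Z by (simp add: sum_unit_vec)
qed

lemma omega_minus_rmat_Z:
  assumes l: "l \<in> {1..N}" and g': "g' \<in> gens N"
  shows "(\<Sum>g\<in>gens N. omega_minus g * rmat K g (Z l) g') \<approx>
    const (a\<^sub>1 K / q) * z l * omega_minus g' + unit_vec (Z l) (const (b\<^sub>1 K / q^2)) g'"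
proof (cases g')
  case [simp]: (Z t)
  then have t: "t \<in> {1..N}"
    using g' by simp
  have "(\<Sum>g\<in>gens N. omega_minus g * rmat K g (Z l) g') =
      const (a\<^sub>1 K) * (\<Sum>i\<in>{1..N}. \<Sum>s\<in>{1..N}. const (Rhat_inv q s t i l) * (const (wt i) * (zs i * z s))) +
      (if t = l then const (b\<^sub>1 K) * (\<Sum>i\<in>{1..N}. const (wt i) * (zs i * z i)) else 0)"
    unfolding sum_omega_minus rmat.simps Z sum_unit_vec(1)[OF t] sum_distrib_left distrib_left sum.distrib
    by (auto simp: unit_vec_def const_normalize ac_simps)
  also have "\<dots> \<approx> const (a\<^sub>1 K) * (const (1 / q) * (const (wt t) * (z l * zs t))) +
      (if t = l then const (b\<^sub>1 K) * const (1 / q^2) else 0)"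
    using eqI_const[OF sum_zsz, of "b\<^sub>1 K"] by (intro eqI_add eqI_const Rhat_inv_sum t l) auto
  finally show ?thesis
    by (cases "t = l") (simp_all add: unit_vec_def const_normalize flip: const_mult)
next
  case [simp]: (Zs t)
  show ?thesis
    unfolding sum_omega_minus rmat.simps Zs by (simp add: sum_unit_vec)
qed

lemma omega_minus_rmat_Zs:
  assumes l: "l \<in> {1..N}" and g': "g' \<in> gens N"
  shows "(\<Sum>g\<in>gens N. omega_minus g * rmat K g (Zs l) g') \<approx>
    const (a\<^sub>3 K / q) * zs l * omega_minus g' + unit_vec (Zs l) (const (b\<^sub>3 K / q^2)) g'"
proof (cases g')
  case [simp]: (Z t)
  then have t: "t \<in> {1..N}"
    using g' by simp
  have "(\<Sum>g\<in>gens N. omega_minus g * rmat K g (Zs l) g') =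
      const (a\<^sub>3 K) * (\<Sum>i\<in>{1..N}. \<Sum>s\<in>{1..N}. const (Rgrave_inv q s t i l) * (const (wt i) * (zs i * zs s)))"
    unfolding sum_omega_minus rmat.simps Z sum_unit_vec(1)[OF t] sum_unit_vec(4) sum_distrib_left add_0_right
    by (intro sum.cong refl) (simp add: const_normalize ac_simps)
  also have "\<dots> \<approx> const (a\<^sub>3 K) * (const (1 / q) * (const (wt t) * (zs l * zs t)))"
    by (intro eqI_const Rgrave_inv_sum t l)
  finally show ?thesis
    by (simp add: sum_unit_vec const_normalize flip: const_mult)
next
  case [simp]: (Zs t)
  have "(\<Sum>g\<in>gens N. omega_minus g * rmat K g (Zs l) g') =
      (if t = l then const (b\<^sub>3 K) * (\<Sum>i\<in>{1..N}. const (wt i) * (zs i * z i)) else 0)"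
    unfolding sum_omega_minus rmat.simps Zs sum_unit_vec(3)
    by (auto simp: unit_vec_def sum_distrib_left const_normalize ac_simps)
  also have "\<dots> \<approx> (if t = l then const (b\<^sub>3 K) * const (1 / q^2) else 0)"
    using eqI_const[OF sum_zsz, of "b\<^sub>3 K"] by auto
  finally show ?thesis
    by (cases "t = l") (simp_all add: unit_vec_def flip: const_mult)
qed

lemma sum_rho_two:
  "(\<Sum>g\<in>gens N. w g * rho_two K g h g') =
    (\<Sum>g\<in>gens N. w g * rmat K g h g') + (\<Sum>g\<in>gens N. w g * c_coeff K g h) * omega_plus g' +
    (\<Sum>g\<in>gens N. w g * e_coeff K g h) * omega_minus g'"
  by (simp add: rho_two_def distrib_left sum.distrib sum_distrib_right mult.assoc)

text \<open>The left submodule generated by \<open>u \<Omega>\<^sub>+ + v \<Omega>\<^sub>-\<close> is stable under right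
  multiplication by \<open>z\<^sub>l\<close>, respectively \<open>z\<^sub>l\<^sup>*\<close>.\<close>

definition stable_Z :: "two_coeffs \<Rightarrow> complex \<Rightarrow> complex \<Rightarrow> complex \<Rightarrow> bool" where
  "stable_Z K u v m \<longleftrightarrow>
     u * (q * a\<^sub>4 K + c\<^sub>4 K + d\<^sub>4 K) + v * (c\<^sub>1 K / q^2) = m * u \<and>
     u * (e\<^sub>4 K + f\<^sub>4 K) + v * (a\<^sub>1 K / q + e\<^sub>1 K / q^2) = m * v \<and>
     u * b\<^sub>4 K + v * (b\<^sub>1 K / q^2) = 0"

definition stable_Zs :: "two_coeffs \<Rightarrow> complex \<Rightarrow> complex \<Rightarrow> complex \<Rightarrow> bool" where
  "stable_Zs K u v m \<longleftrightarrow>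
     u * (q * a\<^sub>2 K + c\<^sub>2 K) + v * (c\<^sub>3 K / q^2 + d\<^sub>3 K) = m * u \<and>
     u * e\<^sub>2 K + v * (a\<^sub>3 K / q + e\<^sub>3 K / q^2 + f\<^sub>3 K) = m * v \<and>
     u * b\<^sub>2 K + v * (b\<^sub>3 K / q^2) = 0"

text \<open>The hypotheses compare the coefficients of x Omega_+, of x Omega_- and of dh in
  turn.\<close>

lemma combine_omega:
  assumes "u * p1 + v * p2 = m * u" "u * n1 + v * n2 = m * v" "u * r1 + v * r2 = 0"
  shows "const u * (const p1 * x * omega_plus g' + const n1 * x * omega_minus g' + unit_vec h (const r1) g') +
    const v * (const p2 * x * omega_plus g' + const n2 * x * omega_minus g' + unit_vec h (const r2) g') =
    const m * x * omega u v g'"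
proof -
  have "const u * (const p1 * x * omega_plus g' + const n1 * x * omega_minus g' + unit_vec h (const r1) g') +
    const v * (const p2 * x * omega_plus g' + const n2 * x * omega_minus g' + unit_vec h (const r2) g') =
    const (u * p1 + v * p2) * (x * omega_plus g') + const (u * n1 + v * n2) * (x * omega_minus g') +
    unit_vec h (const (u * r1 + v * r2)) g'"
    by (simp add: const_add const_mult distrib_left distrib_right mult.assoc unit_vec_def)
  also have "\<dots> = const (m * u) * (x * omega_plus g') + const (m * v) * (x * omega_minus g')"
    unfolding assms by (simp add: unit_vec_def)
  also have "\<dots> = const m * (const u * (x * omega_plus g') + const v * (x * omega_minus g'))"
    by (simp add: const_mult distrib_left mult.assoc)
  also have "\<dots> = const m * (x * omega u v g')"
    unfolding omega_def distrib_left const_left_commute[of x] ..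
  finally show ?thesis
    by (simp add: mult.assoc)
qed

lemma sum_omega:
  "(\<Sum>g\<in>gens N. omega u v g * f g) =
    const u * (\<Sum>g\<in>gens N. omega_plus g * f g) + const v * (\<Sum>g\<in>gens N. omega_minus g * f g)"
  by (simp add: omega_def distrib_right sum.distrib sum_distrib_left mult.assoc)

text \<open>Matrix part and Omega coefficients together express Omega_+ z_l and Omega_- z_l through
  z_l Omega_+, z_l Omega_- and dz_l; \<open>stable_Z\<close> then says that (u, v) is an eigenvector
  with eigenvalue m and that the dz_l part cancels.\<close>

lemma omega_stable_Z:
  assumes K: "stable_Z K u v m" and l: "l \<in> {1..N}" and g': "g' \<in> gens N"
  shows "(\<Sum>g\<in>gens N. omega u v g * rho_two K g (Z l) g') \<approx> const m * z l * omega u v g'"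
proof -
  have FC: "omega_plus g' \<in> FC N" "omega_minus g' \<in> FC N"
    using g' by auto
  have "(\<Sum>g\<in>gens N. omega_plus g * rho_two K g (Z l) g') \<approx>
      (const (q * a\<^sub>4 K) * z l * omega_plus g' + unit_vec (Z l) (const (b\<^sub>4 K)) g') +
      const (c\<^sub>4 K + d\<^sub>4 K) * z l * omega_plus g' + const (e\<^sub>4 K + f\<^sub>4 K) * z l * omega_minus g'"
    unfolding sum_rho_two c_coeff_def e_coeff_def
    by (intro eqI_add eqI_mult_right omega_plus_om_coeff omega_plus_rmat_Z l g' FC)
  also have "\<dots> = const (q * a\<^sub>4 K + c\<^sub>4 K + d\<^sub>4 K) * z l * omega_plus g' +
      const (e\<^sub>4 K + f\<^sub>4 K) * z l * omega_minus g' + unit_vec (Z l) (const (b\<^sub>4 K)) g'"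
    by (simp add: const_add distrib_right)
  finally have P: "(\<Sum>g\<in>gens N. omega_plus g * rho_two K g (Z l) g') \<approx> \<dots>" .
  have "(\<Sum>g\<in>gens N. omega_minus g * rho_two K g (Z l) g') \<approx>
      (const (a\<^sub>1 K / q) * z l * omega_minus g' + unit_vec (Z l) (const (b\<^sub>1 K / q^2)) g') +
      const (c\<^sub>1 K / q^2) * z l * omega_plus g' + const (e\<^sub>1 K / q^2) * z l * omega_minus g'"
    unfolding sum_rho_two c_coeff_def e_coeff_def
    by (intro eqI_add eqI_mult_right omega_minus_om_coeff omega_minus_rmat_Z l g' FC)
  also have "\<dots> = const (c\<^sub>1 K / q^2) * z l * omega_plus g' +
      const (a\<^sub>1 K / q + e\<^sub>1 K / q^2) * z l * omega_minus g' + unit_vec (Z l) (const (b\<^sub>1 K / q^2)) g'"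
    by (simp add: const_add distrib_right)
  finally have M: "(\<Sum>g\<in>gens N. omega_minus g * rho_two K g (Z l) g') \<approx> \<dots>" .
  have "(\<Sum>g\<in>gens N. omega u v g * rho_two K g (Z l) g') \<approx>
      const u * (const (q * a\<^sub>4 K + c\<^sub>4 K + d\<^sub>4 K) * z l * omega_plus g' +
        const (e\<^sub>4 K + f\<^sub>4 K) * z l * omega_minus g' + unit_vec (Z l) (const (b\<^sub>4 K)) g') +
      const v * (const (c\<^sub>1 K / q^2) * z l * omega_plus g' +
        const (a\<^sub>1 K / q + e\<^sub>1 K / q^2) * z l * omega_minus g' + unit_vec (Z l) (const (b\<^sub>1 K / q^2)) g')"
    unfolding sum_omega by (intro eqI_add[OF eqI_const[OF P] eqI_const[OF M]])
  also have "\<dots> = const m * z l * omega u v g'"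
    using K unfolding stable_Z_def by (intro combine_omega) auto
  finally show ?thesis .
qed

lemma omega_stable_Zs:
  assumes K: "stable_Zs K u v m" and l: "l \<in> {1..N}" and g': "g' \<in> gens N"
  shows "(\<Sum>g\<in>gens N. omega u v g * rho_two K g (Zs l) g') \<approx> const m * zs l * omega u v g'"
proof -
  have FC: "omega_plus g' \<in> FC N" "omega_minus g' \<in> FC N"
    using g' by auto
  have "(\<Sum>g\<in>gens N. omega_plus g * rho_two K g (Zs l) g') \<approx>
      (const (q * a\<^sub>2 K) * zs l * omega_plus g' + unit_vec (Zs l) (const (b\<^sub>2 K)) g') +
      const (c\<^sub>2 K) * zs l * omega_plus g' + const (e\<^sub>2 K) * zs l * omega_minus g'"
    unfolding sum_rho_two c_coeff_def e_coeff_def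
    by (intro eqI_add eqI_mult_right omega_plus_om_coeff omega_plus_rmat_Zs l g' FC)
  also have "\<dots> = const (q * a\<^sub>2 K + c\<^sub>2 K) * zs l * omega_plus g' +
      const (e\<^sub>2 K) * zs l * omega_minus g' + unit_vec (Zs l) (const (b\<^sub>2 K)) g'"
    by (simp add: const_add distrib_right)
  finally have P: "(\<Sum>g\<in>gens N. omega_plus g * rho_two K g (Zs l) g') \<approx> \<dots>" .
  have "(\<Sum>g\<in>gens N. omega_minus g * rho_two K g (Zs l) g') \<approx>
      (const (a\<^sub>3 K / q) * zs l * omega_minus g' + unit_vec (Zs l) (const (b\<^sub>3 K / q^2)) g') +
      const (c\<^sub>3 K / q^2 + d\<^sub>3 K) * zs l * omega_plus g' + const (e\<^sub>3 K / q^2 + f\<^sub>3 K) * zs l * omega_minus g'"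
    unfolding sum_rho_two c_coeff_def e_coeff_def
    by (intro eqI_add eqI_mult_right omega_minus_om_coeff omega_minus_rmat_Zs l g' FC)
  also have "\<dots> = const (c\<^sub>3 K / q^2 + d\<^sub>3 K) * zs l * omega_plus g' +
      const (a\<^sub>3 K / q + e\<^sub>3 K / q^2 + f\<^sub>3 K) * zs l * omega_minus g' + unit_vec (Zs l) (const (b\<^sub>3 K / q^2)) g'"
    by (simp add: const_add distrib_right)
  finally have M: "(\<Sum>g\<in>gens N. omega_minus g * rho_two K g (Zs l) g') \<approx> \<dots>" .
  have "(\<Sum>g\<in>gens N. omega u v g * rho_two K g (Zs l) g') \<approx>
      const u * (const (q * a\<^sub>2 K + c\<^sub>2 K) * zs l * omega_plus g' +
        const (e\<^sub>2 K) * zs l * omega_minus g' + unit_vec (Zs l) (const (b\<^sub>2 K)) g') +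
      const v * (const (c\<^sub>3 K / q^2 + d\<^sub>3 K) * zs l * omega_plus g' +
        const (a\<^sub>3 K / q + e\<^sub>3 K / q^2 + f\<^sub>3 K) * zs l * omega_minus g' + unit_vec (Zs l) (const (b\<^sub>3 K / q^2)) g')"
    unfolding sum_omega by (intro eqI_add[OF eqI_const[OF P] eqI_const[OF M]])
  also have "\<dots> = const m * zs l * omega u v g'"
    using K unfolding stable_Zs_def by (intro combine_omega) auto
  finally show ?thesis .
qed

end

section \<open>Quotients of calculi\<close>

text \<open>Closure under scaling is assumed since the locale of calculi says nothing about it, and
  the scalar axioms of the quotient evaluate the action of c 1 on cosets.\<close>

locale calculus_quotient = first_order_calculus +
  fixes S
  assumes sub_bimodule: "sub_bimodule A M S"
    and cscale_closed: "x \<in> carrier A \<Longrightarrow> cscale A c x \<in> carrier A"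
begin

abbreviation "Q \<equiv> quotient_calculus M S"
abbreviation proj where "proj m \<equiv> S +>\<^bsub>M\<^esub> m"

sublocale Sub: abelian_subgroup S M
  using sub_bimodule M.abelian_group_axioms unfolding sub_bimodule_def by (intro abelian_subgroupI3) auto

lemma S_lmult: "x \<in> carrier A \<Longrightarrow> s \<in> S \<Longrightarrow> x \<odot>\<^bsub>M\<^esub> s \<in> S"
  and S_rmult: "x \<in> carrier A \<Longrightarrow> s \<in> S \<Longrightarrow> rsmult M s x \<in> S"
  using sub_bimodule by (auto simp: sub_bimodule_def)

lemma mem_proj: "n \<in> proj m \<longleftrightarrow> (\<exists>s\<in>S. n = s \<oplus>\<^bsub>M\<^esub> m)"
  by (auto simp: a_r_coset_def')

lemma proj_absorb:
  assumes "s \<in> S" "m \<in> carrier M"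
  shows "proj (s \<oplus>\<^bsub>M\<^esub> m) = proj m"
proof -
  have "s \<oplus>\<^bsub>M\<^esub> m \<in> proj m"
    using assms mem_proj by blast
  then show ?thesis
    using Sub.a_repr_independence'[of "s \<oplus>\<^bsub>M\<^esub> m" m] assms by simp
qed

lemma proj_eq_S_iff:
  assumes "m \<in> carrier M"
  shows "proj m = S \<longleftrightarrow> m \<in> S"
proof
  assume "proj m = S"
  then show "m \<in> S"
    using Sub.a_rcos_self[OF assms] by simp
next
  assume "m \<in> S"
  then show "proj m = S"
    by (rule Sub.a_rcos_const)
qed

lemma quotient_carrier: "carrier Q = proj ` carrier M"
  by (auto simp: quotient_calculus_def A_RCOSETS_def')

lemma quotient_zero: "\<zero>\<^bsub>Q\<^esub> = S"
  by (simp add: quotient_calculus_def)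

lemma quotient_add:
  "m \<in> carrier M \<Longrightarrow> n \<in> carrier M \<Longrightarrow> proj m \<oplus>\<^bsub>Q\<^esub> proj n = proj (m \<oplus>\<^bsub>M\<^esub> n)"
  using Sub.a_rcos_sum by (simp add: quotient_calculus_def)

text \<open>Well-definedness of the two actions, which \<open>quotient_calculus\<close> defines as
  unions over all representatives of a coset.\<close>

lemma proj_UN:
  assumes m: "m \<in> carrier M"
    and f: "\<And>s. s \<in> S \<Longrightarrow> f (s \<oplus>\<^bsub>M\<^esub> m) = f s \<oplus>\<^bsub>M\<^esub> f m" "\<And>s. s \<in> S \<Longrightarrow> f s \<in> S" "f m \<in> carrier M"
  shows "(\<Union>n\<in>proj m. proj (f n)) = proj (f m)"
proof -
  have "proj (f n) = proj (f m)" if n: "n \<in> proj m" for n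
  proof -
    obtain s where "s \<in> S" "n = s \<oplus>\<^bsub>M\<^esub> m"
      using n mem_proj by blast
    then show ?thesis
      using f by (simp add: proj_absorb)
  qed
  moreover have "m \<in> proj m"
    by (rule Sub.a_rcos_self[OF m])
  ultimately show ?thesis
    by (metis (no_types, lifting) SUP_eq_const empty_iff)
qed

lemma quotient_lmult:
  "x \<in> carrier A \<Longrightarrow> m \<in> carrier M \<Longrightarrow> x \<odot>\<^bsub>Q\<^esub> proj m = proj (x \<odot>\<^bsub>M\<^esub> m)"
  unfolding quotient_calculus_def
  by (simp add: proj_UN[where f = "\<lambda>m. x \<odot>\<^bsub>M\<^esub> m"] lmult_add_right S_lmult lmult_closed)

lemma quotient_rmult:
  "x \<in> carrier A \<Longrightarrow> m \<in> carrier M \<Longrightarrow> rsmult Q (proj m) x = proj (rsmult M m x)"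
  unfolding quotient_calculus_def
  by (simp add: proj_UN[where f = "\<lambda>m. rsmult M m x"] rmult_add_left S_rmult rmult_closed)

lemma quotient_diff: "diff Q x = proj (diff M x)"
  by (simp add: quotient_calculus_def)

lemma abelian_group_quotient: "abelian_group Q"
proof (rule abelian_groupI)
  have z: "\<zero>\<^bsub>Q\<^esub> = proj \<zero>\<^bsub>M\<^esub>"
    using proj_eq_S_iff[of "\<zero>\<^bsub>M\<^esub>"] additive_subgroup.zero_closed[OF Sub.is_additive_subgroup]
    by (simp add: quotient_zero)
  show "\<zero>\<^bsub>Q\<^esub> \<in> carrier Q"
    by (simp add: z quotient_carrier)
  fix k assume "k \<in> carrier Q"
  then obtain m where m: "m \<in> carrier M" "k = proj m"
    by (auto simp: quotient_carrier)
  then show "\<zero>\<^bsub>Q\<^esub> \<oplus>\<^bsub>Q\<^esub> k = k"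
    by (simp add: z quotient_add)
  have "proj (\<ominus>\<^bsub>M\<^esub> m) \<oplus>\<^bsub>Q\<^esub> k = \<zero>\<^bsub>Q\<^esub>"
    using m by (simp add: z quotient_add M.l_neg)
  then show "\<exists>k'\<in>carrier Q. k' \<oplus>\<^bsub>Q\<^esub> k = \<zero>\<^bsub>Q\<^esub>"
    using m by (auto simp: quotient_carrier)
qed (auto simp: quotient_carrier quotient_add M.a_ac)

lemma quotient_finsum:
  assumes "f \<in> J \<rightarrow> carrier M"
  shows "(\<Oplus>\<^bsub>Q\<^esub>i\<in>J. proj (f i)) = proj (\<Oplus>\<^bsub>M\<^esub>i\<in>J. f i)"
proof -
  interpret Qg: abelian_group Q
    by (rule abelian_group_quotient)
  have z: "\<zero>\<^bsub>Q\<^esub> = proj \<zero>\<^bsub>M\<^esub>"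
    using proj_eq_S_iff[of "\<zero>\<^bsub>M\<^esub>"] additive_subgroup.zero_closed[OF Sub.is_additive_subgroup]
    by (simp add: quotient_zero)
  have p: "proj m \<in> carrier Q" if "m \<in> carrier M" for m
    using that by (simp add: quotient_carrier)
  show ?thesis
    using assms
  proof (induction J rule: infinite_finite_induct)
    case (insert i J)
    then have "f i \<in> carrier M" "f \<in> J \<rightarrow> carrier M"
      by auto
    with insert show ?case
      by (subst Qg.finsum_insert) (auto simp: p quotient_add Pi_def)
  qed (auto simp: z)
qed

lemma first_order_calculus_quotient: "first_order_calculus A Q"
proof -
  interpret Qg: abelian_group Q
    by (rule abelian_group_quotient)
  have span: "\<exists>(n::nat) x y. (\<forall>k<n. x k \<in> carrier A \<and> y k \<in> carrier A) \<and>
        k = (\<Oplus>\<^bsub>Q\<^esub>k\<in>{..<n}. x k \<odot>\<^bsub>Q\<^esub> diff Q (y k))" if k: "k \<in> carrier Q" for k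
  proof -
    obtain m where m: "m \<in> carrier M" "k = proj m"
      using k by (auto simp: quotient_carrier)
    obtain n :: nat and x y where xy: "\<forall>k<n. x k \<in> carrier A \<and> y k \<in> carrier A"
      "m = (\<Oplus>\<^bsub>M\<^esub>k\<in>{..<n}. x k \<odot>\<^bsub>M\<^esub> diff M (y k))"
      using diff_span[OF m(1)] by blast
    have "k = (\<Oplus>\<^bsub>Q\<^esub>k\<in>{..<n}. proj (x k \<odot>\<^bsub>M\<^esub> diff M (y k)))"
      unfolding m xy(2) using xy(1) by (intro quotient_finsum[symmetric]) (auto simp: lmult_closed diff_closed)
    also have "\<dots> = (\<Oplus>\<^bsub>Q\<^esub>k\<in>{..<n}. x k \<odot>\<^bsub>Q\<^esub> diff Q (y k))"
      using xy(1)
      by (intro Qg.finsum_cong')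
        (auto simp: quotient_diff quotient_lmult diff_closed lmult_closed quotient_carrier)
    finally show ?thesis
      using xy(1) by blast
  qed
  show ?thesis
    using span
    by unfold_locales
      (auto simp: quotient_carrier quotient_lmult quotient_rmult quotient_add quotient_diff
        lmult_closed rmult_closed lmult_add_left lmult_add_right lmult_assoc lmult_one
        rmult_add_left rmult_add_right rmult_assoc rmult_one lmult_rmult scalar_central
        diff_closed diff_add diff_cscale diff_mult cscale_closed)
qed

end

section \<open>Principal sub-bimodules and the star property of their quotients\<close>

context sphere_calculus
begin

lemma act_minus: "p \<in> FC N \<Longrightarrow> m \<in> carrier C \<Longrightarrow> act (- p) m = \<ominus>\<^bsub>C\<^esub> act p m"
  using act_add[of "- p" p m] by (intro M.minus_equality[symmetric]) auto

lemma ract_add: "p \<in> FC N \<Longrightarrow> r \<in> FC N \<Longrightarrow> m \<in> carrier C \<Longrightarrow> ract m (p + r) = ract m p \<oplus>\<^bsub>C\<^esub> ract m r"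
  using rmult_add_right[of "cls p" "cls r" m] by simp

lemma ract_ract: "p \<in> FC N \<Longrightarrow> r \<in> FC N \<Longrightarrow> m \<in> carrier C \<Longrightarrow> ract (ract m p) r = ract m (p * r)"
  using rmult_assoc[of "cls p" "cls r" m] by simp

lemma ract_act: "p \<in> FC N \<Longrightarrow> r \<in> FC N \<Longrightarrow> m \<in> carrier C \<Longrightarrow> ract (act p m) r = act p (ract m r)"
  using lmult_rmult[of "cls p" "cls r" m] by simp

definition principal :: "'m \<Rightarrow> 'm set" where
  "principal m = (\<lambda>p. act p m) ` FC N"

text \<open>If m p = p' m and m r = r' m, then m (p r) = p' (m r) = p' r' m. Hence checking
  generators suffices.\<close>

lemma principal_ract:
  assumes m: "m \<in> carrier C"
    and gens: "\<And>h. h \<in> gens N \<Longrightarrow> ract m (gen_poly h) \<in> principal m"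
    and "r \<in> FC N"
  shows "ract m r \<in> principal m"
  using \<open>r \<in> FC N\<close>
proof (induction r rule: FC_induct)
  case (const c)
  show ?case
    using m by (auto simp: principal_def ract_const)
next
  case (gen g)
  then show ?case by (rule gens)
next
  case (add p r)
  then obtain p' r' where "p' \<in> FC N" "r' \<in> FC N" "ract m p = act p' m" "ract m r = act r' m"
    by (auto simp: principal_def)
  then show ?case
    using add m unfolding principal_def
    by (intro image_eqI[of _ _ "p' + r'"]) (auto simp: ract_add act_add)
next
  case (mult p r)
  then obtain p' r' where "p' \<in> FC N" "r' \<in> FC N" "ract m p = act p' m" "ract m r = act r' m"
    by (auto simp: principal_def)
  then show ?case
    using mult m unfolding principal_def
    by (intro image_eqI[of _ _ "p' * r'"]) (auto simp: ract_ract[symmetric] ract_act act_act)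
qed

text \<open>The left multiples are closed on the right because (p m) r = p (m r) with m r again a
  left multiple of m; conversely, any sub-bimodule containing m contains them.\<close>

lemma sub_bimodule_principal:
  assumes m: "m \<in> carrier C"
    and gens: "\<And>h. h \<in> gens N \<Longrightarrow> ract m (gen_poly h) \<in> principal m"
  shows "sub_bimodule A C (principal m)"
    and "sub_bimodule_generated A C {m} = principal m"
proof -
  have sub: "additive_subgroup (principal m) C"
  proof (rule additive_subgroup.intro, rule M.add.subgroupI)
    show "principal m \<subseteq> carrier C"
      using m by (auto simp: principal_def)
    show "principal m \<noteq> {}"
      by (auto simp: principal_def)
    fix s t assume "s \<in> principal m" "t \<in> principal m"
    then obtain p r where pr: "p \<in> FC N" "r \<in> FC N" "s = act p m" "t = act r m"
      by (auto simp: principal_def)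
    show "s \<oplus>\<^bsub>C\<^esub> t \<in> principal m"
      unfolding principal_def using pr m by (intro image_eqI[of _ _ "p + r"]) (auto simp: act_add)
  next
    fix s assume "s \<in> principal m"
    then obtain p where pr: "p \<in> FC N" "s = act p m"
      by (auto simp: principal_def)
    show "\<ominus>\<^bsub>C\<^esub> s \<in> principal m"
      unfolding principal_def using pr m by (intro image_eqI[of _ _ "- p"]) (auto simp: act_minus)
  qed
  show S: "sub_bimodule A C (principal m)"
    unfolding sub_bimodule_def
  proof (intro conjI ballI sub)
    fix x s assume "x \<in> carrier A" "s \<in> principal m"
    then obtain r p where r: "r \<in> FC N" "x = cls r" and p: "p \<in> FC N" "s = act p m"
      by (auto simp: sphere_carrier principal_def)
    show "x \<odot>\<^bsub>C\<^esub> s \<in> principal m"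
      using r p m by (auto simp: principal_def act_act)
    obtain r' where "r' \<in> FC N" "ract m r = act r' m"
      using principal_ract[OF m gens r(1)] by (auto simp: principal_def)
    then show "rsmult C s x \<in> principal m"
      using r p m by (auto simp: principal_def act_act ract_act)
  qed
  have "m \<in> principal m"
    unfolding principal_def using m by (intro image_eqI[of _ _ 1]) auto
  with S have "sub_bimodule_generated A C {m} \<subseteq> principal m"
    unfolding sub_bimodule_generated_def by blast
  moreover have "principal m \<subseteq> sub_bimodule_generated A C {m}"
    unfolding sub_bimodule_generated_def sub_bimodule_def principal_def by auto
  ultimately show "sub_bimodule_generated A C {m} = principal m"
    by blast
qed

lemma diff_cls_sum:
  "(\<And>i. i \<in> J \<Longrightarrow> f i \<in> FC N) \<Longrightarrow> diff C (cls (\<Sum>i\<in>J. f i)) = (\<Oplus>\<^bsub>C\<^esub>i\<in>J. diff C (cls (f i)))"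
proof (induction J rule: infinite_finite_induct)
  case (insert i J)
  then show ?case
    using diff_add[of "cls (f i)" "cls (sum f J)"] by (auto simp: Pi_def diff_closed)
qed (use diff_const[of 0] in auto)

lemma diff_cls_const_mult:
  "p \<in> FC N \<Longrightarrow> diff C (cls (const c * p)) = act (const c) (diff C (cls p))"
  using diff_cscale[of "cls p" c] by (simp add: cls_one)

lemma diff_cls_mult:
  "p \<in> FC N \<Longrightarrow> r \<in> FC N \<Longrightarrow> diff C (cls (p * r)) = ract (diff C (cls p)) r \<oplus>\<^bsub>C\<^esub> act p (diff C (cls r))"
  using diff_mult[of "cls p" "cls r"] by simp

lemma diff_cls_cong: "p \<approx> r \<Longrightarrow> p \<in> FC N \<Longrightarrow> r \<in> FC N \<Longrightarrow> diff C (cls p) = diff C (cls r)"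
  using cls_eq_iff[of p r] by (simp add: eqI_def)

text \<open>The left hand side without \<open>\<Omega>\<close> is \<open>\<Omega>\<^sup>*\<close>; it equals \<open>- \<Omega>\<close> since
  \<open>\<Sum>\<^sub>i z\<^sub>i z\<^sub>i\<^sup>*\<close> and \<open>\<Sum>\<^sub>i q\<^bsup>-2i\<^esup> z\<^sub>i\<^sup>* z\<^sub>i\<close> are constant.\<close>

lemma omega_star:
  assumes "u \<in> \<real>" "v \<in> \<real>"
  shows "(\<Oplus>\<^bsub>C\<^esub>g\<in>gens N. ract (dg (gen_star g)) (free_star (omega u v g))) \<oplus>\<^bsub>C\<^esub> Lc (omega u v) = \<zero>\<^bsub>C\<^esub>"
proof -
  let ?p = "\<lambda>g. gen_poly (gen_star g) * free_star (omega u v g)"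
  have cu: "cnj u = u" "cnj v = v"
    using assms by (auto simp: Reals_cnj_iff)
  have "(\<Sum>g\<in>gens N. ?p g) = const u * (\<Sum>i\<in>{1..N}. z i * zs i) + const v * (\<Sum>i\<in>{1..N}. const (wt i) * (zs i * z i))"
    by (simp add: sum_gens omega_def free_star_mult cu const_normalize sum_distrib_left mult.commute add.commute)
  also have "\<dots> \<approx> const u * 1 + const v * const (1 / q^2)"
    by (intro eqI_add eqI_const sum_zzs sum_zsz)
  also have "\<dots> = const (u + v * of_real (1 / q^2))"
    by (simp add: const_add flip: const_mult)
  finally have c: "(\<Sum>g\<in>gens N. ?p g) \<approx> const (u + v * of_real (1 / q^2))" .
  have FC: "free_star (omega u v g) \<in> FC N" "omega u v g \<in> FC N" if "g \<in> gens N" for g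
    using that by auto
  have "(\<Oplus>\<^bsub>C\<^esub>g\<in>gens N. ract (dg (gen_star g)) (free_star (omega u v g))) \<oplus>\<^bsub>C\<^esub> Lc (omega u v) =
      (\<Oplus>\<^bsub>C\<^esub>g\<in>gens N. ract (dg (gen_star g)) (free_star (omega u v g)) \<oplus>\<^bsub>C\<^esub> act (omega u v g) (dg g))"
    unfolding Lc_def by (rule M.finsum_addf[symmetric]) (auto simp: FC)
  also have "\<dots> = (\<Oplus>\<^bsub>C\<^esub>g\<in>gens N. diff C (cls (?p g)))"
  proof (intro M.finsum_cong')
    fix g assume g: "g \<in> gens N"
    \<comment> \<open>Second Leibniz term: because u, v and the weights are real, it is the g-th
      summand of Omega.\<close>
    have "act (gen_poly (gen_star g)) (diff C (cls (free_star (omega u v g)))) = act (omega u v g) (dg g)"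
      using g by (cases g)
        (simp_all add: omega_def cu free_star_mult diff_cls_const_mult act_act const_normalize mult.commute
          flip: const_mult)
    then show "ract (dg (gen_star g)) (free_star (omega u v g)) \<oplus>\<^bsub>C\<^esub> act (omega u v g) (dg g) =
        diff C (cls (?p g))"
      using g by (simp add: diff_cls_mult FC)
  qed (auto simp: diff_closed FC)
  also have "\<dots> = diff C (cls (\<Sum>g\<in>gens N. ?p g))"
    by (rule diff_cls_sum[symmetric]) (auto simp: FC)
  also have "\<dots> = \<zero>\<^bsub>C\<^esub>"
    using diff_cls_cong[OF c] by (auto simp: diff_const FC)
  finally show ?thesis .
qed

text \<open>The star axiom only admits sums over an initial segment of the naturals, so a sum over
  generators has to be enumerated by e and glued on.\<close>

lemma finsum_append:
  fixes n m :: nat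
  assumes f: "f \<in> {..<n} \<rightarrow> carrier C" and G: "G \<in> J \<rightarrow> carrier C" and e: "bij_betw e {..<m} J"
  shows "(\<Oplus>\<^bsub>C\<^esub>k\<in>{..<n + m}. if k < n then f k else G (e (k - n))) =
    (\<Oplus>\<^bsub>C\<^esub>k\<in>{..<n}. f k) \<oplus>\<^bsub>C\<^esub> (\<Oplus>\<^bsub>C\<^esub>g\<in>J. G g)"
proof -
  let ?F = "\<lambda>k. if k < n then f k else G (e (k - n))"
  have eJ: "e j \<in> J" if "j < m" for j
    using e that by (auto simp: bij_betw_def)
  have un: "{..<n + m} = {..<n} \<union> (\<lambda>j. n + j) ` {..<m}"
  proof (intro equalityI subsetI)
    fix k assume "k \<in> {..<n + m}"
    then show "k \<in> {..<n} \<union> (\<lambda>j. n + j) ` {..<m}"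
      by (cases "k < n") (auto intro!: image_eqI[of k _ "k - n"])
  qed auto
  have "finsum C ?F {..<n + m} = finsum C ?F {..<n} \<oplus>\<^bsub>C\<^esub> finsum C ?F ((\<lambda>j. n + j) ` {..<m})"
    unfolding un using f G eJ by (intro M.finsum_Un_disjoint) auto
  also have "finsum C ?F {..<n} = finsum C f {..<n}"
    using f by (intro M.finsum_cong') auto
  also have "finsum C ?F ((\<lambda>j. n + j) ` {..<m}) = (\<Oplus>\<^bsub>C\<^esub>j\<in>{..<m}. ?F (n + j))"
    using G eJ by (intro M.finsum_reindex) (auto simp: inj_on_def)
  also have "\<dots> = (\<Oplus>\<^bsub>C\<^esub>j\<in>{..<m}. G (e j))"
    using G eJ by (intro M.finsum_cong') auto
  also have "\<dots> = finsum C G (e ` {..<m})"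
    using G e by (intro M.finsum_reindex[symmetric]) (auto simp: bij_betw_def)
  also have "e ` {..<m} = J"
    using e by (simp add: bij_betw_def)
  finally show ?thesis .
qed

text \<open>Reduces equality to the kernel of \<open>Lc\<close>, the only information by which two
  calculi are compared later.\<close>

lemma Lc_eq_iff:
  assumes "v \<in> vecs N" "w \<in> vecs N"
  shows "Lc v = Lc w \<longleftrightarrow> Lc (\<lambda>g. v g + const (- 1) * w g) = \<zero>\<^bsub>C\<^esub>"
proof -
  have n: "(\<lambda>g. const (- 1) * w g) \<in> vecs N"
    using assms by auto
  have "Lc w \<oplus>\<^bsub>C\<^esub> Lc (\<lambda>g. const (- 1) * w g) = \<zero>\<^bsub>C\<^esub>"
    using assms by (subst Lc_add[OF assms(2) n]) (simp add: const_minus)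
  then have "Lc (\<lambda>g. const (- 1) * w g) = \<ominus>\<^bsub>C\<^esub> Lc w"
    using assms n by (metis Lc_closed M.minus_equality M.minus_minus)
  then have "Lc (\<lambda>g. v g + const (- 1) * w g) = Lc v \<ominus>\<^bsub>C\<^esub> Lc w"
    by (simp only: Lc_add[OF assms(1) n, symmetric] a_minus_def)
  moreover have "Lc v \<ominus>\<^bsub>C\<^esub> Lc w = \<zero>\<^bsub>C\<^esub> \<longleftrightarrow> Lc v = Lc w"
    using M.minus_equality[of "Lc v" "\<ominus>\<^bsub>C\<^esub> Lc w"] assms
    by (auto simp: a_minus_def M.r_neg)
  ultimately show ?thesis
    by simp
qed

lemma cscale_sphere_closed: "x \<in> carrier A \<Longrightarrow> cscale A c x \<in> carrier A"
  and cstar_sphere_closed: "x \<in> carrier A \<Longrightarrow> cstar A x \<in> carrier A"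
  by (auto simp: sphere_carrier)

lemma calculus_quotient_principal:
  assumes "m \<in> carrier C" "\<And>h. h \<in> gens N \<Longrightarrow> ract m (gen_poly h) \<in> principal m"
  shows "calculus_quotient A C (principal m)"
  by (intro calculus_quotient.intro calculus_quotient_axioms.intro sub_bimodule_principal(1) assms
      cscale_sphere_closed first_order_calculus_axioms)

text \<open>A sum that vanishes in the quotient equals p Omega in C. Subtracting the summands of p
  Omega gives a sum that vanishes in C, to which the star axiom of C applies. The adjoint of the
  subtracted part is a right multiple of Omega, since Omega is mapped to -Omega, and so it lies in
  the sub-bimodule.\<close>

lemma star_calculus_quotient:
  assumes star: "star_calculus A C" and uv: "u \<in> \<real>" "v \<in> \<real>"
    and gens: "\<And>h. h \<in> gens N \<Longrightarrow> ract (Lc (omega u v)) (gen_poly h) \<in> principal (Lc (omega u v))"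
  shows "star_calculus A (quotient_calculus C (principal (Lc (omega u v))))"
proof -
  interpret St: star_calculus A C
    by (rule star)
  let ?O = "Lc (omega u v)"
  have O: "?O \<in> carrier C"
    by auto
  interpret R: calculus_quotient A C "principal ?O"
    by (rule calculus_quotient_principal[OF O gens])
  interpret Q: first_order_calculus A R.Q
    by (rule R.first_order_calculus_quotient)
  show ?thesis
  proof (intro star_calculus.intro star_calculus_axioms.intro Q.first_order_calculus_axioms)
    fix n :: nat and x y
    assume xy: "\<forall>k<n. x k \<in> carrier A \<and> y k \<in> carrier A"
      and zero: "(\<Oplus>\<^bsub>R.Q\<^esub>k\<in>{..<n}. x k \<odot>\<^bsub>R.Q\<^esub> diff R.Q (y k)) = \<zero>\<^bsub>R.Q\<^esub>"
    let ?s = "\<Oplus>\<^bsub>C\<^esub>k\<in>{..<n}. x k \<odot>\<^bsub>C\<^esub> diff C (y k)"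
    have s: "?s \<in> carrier C"
      using xy by (intro M.finsum_closed) (auto simp: lmult_closed diff_closed)
    have "(\<Oplus>\<^bsub>R.Q\<^esub>k\<in>{..<n}. x k \<odot>\<^bsub>R.Q\<^esub> diff R.Q (y k)) = (\<Oplus>\<^bsub>R.Q\<^esub>k\<in>{..<n}. R.proj (x k \<odot>\<^bsub>C\<^esub> diff C (y k)))"
      using xy by (intro Q.M.finsum_cong')
        (auto simp: R.quotient_diff R.quotient_lmult R.quotient_carrier lmult_closed diff_closed)
    also have "\<dots> = R.proj ?s"
      using xy by (intro R.quotient_finsum) (auto simp: lmult_closed diff_closed)
    finally have "R.proj ?s = principal ?O"
      using zero by (simp add: R.quotient_zero)
    then have "?s \<in> principal ?O"
      using R.proj_eq_S_iff[OF s] by simp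
    then obtain p where p: "p \<in> FC N" "?s = act p ?O"
      by (auto simp: principal_def)
    obtain e where e: "bij_betw e {..<card (gens N)} (gens N)"
      using ex_bij_betw_nat_finite[OF finite_gens, of N] by (auto simp: atLeast0LessThan)
    let ?m = "card (gens N)" and ?r = "- free_star p"
      and ?t = "\<Oplus>\<^bsub>C\<^esub>k\<in>{..<n}. rsmult C (diff C (cstar A (y k))) (cstar A (x k))"
      and ?w = "\<Oplus>\<^bsub>C\<^esub>g\<in>gens N. ract (dg (gen_star g)) (free_star (omega u v g))"
    have eJ: "e j \<in> gens N" if "j < ?m" for j
      using e that by (auto simp: bij_betw_def)
    \<comment> \<open>The given summands are followed by those of -p Omega, one for each
      generator.\<close>
    define X where "X = (\<lambda>k. if k < n then x k else cls (- (p * omega u v (e (k - n)))))"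
    define Y where "Y = (\<lambda>k. if k < n then y k else cls (gen_poly (e (k - n))))"
    have XY: "\<forall>k<n + ?m. X k \<in> carrier A \<and> Y k \<in> carrier A"
      using xy eJ p(1) by (auto simp: X_def Y_def)
    have "(\<Oplus>\<^bsub>C\<^esub>k\<in>{..<n + ?m}. X k \<odot>\<^bsub>C\<^esub> diff C (Y k)) =
        (\<Oplus>\<^bsub>C\<^esub>k\<in>{..<n + ?m}. if k < n then x k \<odot>\<^bsub>C\<^esub> diff C (y k)
          else (\<lambda>g. act (- (p * omega u v g)) (dg g)) (e (k - n)))"
      using xy eJ p by (intro M.finsum_cong') (auto simp: X_def Y_def lmult_closed diff_closed)
    also have "\<dots> = ?s \<oplus>\<^bsub>C\<^esub> (\<Oplus>\<^bsub>C\<^esub>g\<in>gens N. act (- (p * omega u v g)) (dg g))"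
      using xy p by (intro finsum_append e) (auto simp: lmult_closed diff_closed)
    also have "\<dots> = Lc (\<lambda>g. p * omega u v g) \<oplus>\<^bsub>C\<^esub> Lc (\<lambda>g. - p * omega u v g)"
      unfolding p(2) using p(1) by (simp add: act_Lc) (simp add: Lc_def)
    also have "\<dots> = \<zero>\<^bsub>C\<^esub>"
      using p(1) by (simp add: Lc_add vecs_mult[of "- p"] del: minus_mult_minus mult_minus_left)
        (simp flip: distrib_right)
    finally have "(\<Oplus>\<^bsub>C\<^esub>k\<in>{..<n + ?m}. rsmult C (diff C (cstar A (Y k))) (cstar A (X k))) = \<zero>\<^bsub>C\<^esub>"
      by (rule St.star_compatible[OF XY])
    also have "(\<Oplus>\<^bsub>C\<^esub>k\<in>{..<n + ?m}. rsmult C (diff C (cstar A (Y k))) (cstar A (X k))) =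
        (\<Oplus>\<^bsub>C\<^esub>k\<in>{..<n + ?m}. if k < n then rsmult C (diff C (cstar A (y k))) (cstar A (x k))
          else (\<lambda>g. ract (ract (dg (gen_star g)) (free_star (omega u v g))) (- free_star p)) (e (k - n)))"
      using xy eJ p
      by (intro M.finsum_cong')
        (auto simp: X_def Y_def rmult_closed diff_closed cstar_sphere_closed free_star_minus free_star_mult ract_ract)
    also have "\<dots> = (\<Oplus>\<^bsub>C\<^esub>k\<in>{..<n}. rsmult C (diff C (cstar A (y k))) (cstar A (x k))) \<oplus>\<^bsub>C\<^esub>
        (\<Oplus>\<^bsub>C\<^esub>g\<in>gens N. ract (ract (dg (gen_star g)) (free_star (omega u v g))) (- free_star p))"
      using xy p by (intro finsum_append e) (auto simp: rmult_closed diff_closed cstar_sphere_closed)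
    also have "(\<Oplus>\<^bsub>C\<^esub>g\<in>gens N. ract (ract (dg (gen_star g)) (free_star (omega u v g))) (- free_star p)) =
        ract (\<Oplus>\<^bsub>C\<^esub>g\<in>gens N. ract (dg (gen_star g)) (free_star (omega u v g))) (- free_star p)"
      using p by (intro ract_finsum[symmetric]) auto
    finally have "?t \<oplus>\<^bsub>C\<^esub> ract ?w ?r = \<zero>\<^bsub>C\<^esub>" .
    have t: "?t \<in> carrier C"
      using xy by (intro M.finsum_closed) (auto simp: rmult_closed diff_closed cstar_sphere_closed)
    show "(\<Oplus>\<^bsub>R.Q\<^esub>k\<in>{..<n}. rsmult R.Q (diff R.Q (cstar A (y k))) (cstar A (x k))) = \<zero>\<^bsub>R.Q\<^esub>"
    proof -
      have w: "?w \<in> carrier C"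
        by (rule M.finsum_closed) auto
      \<comment> \<open>The sum \<open>?w\<close> is the adjoint of Omega, so
        \<open>omega_star\<close> makes it cancel against Omega.\<close>
      have "ract ?w ?r \<oplus>\<^bsub>C\<^esub> ract ?O ?r = ract (?w \<oplus>\<^bsub>C\<^esub> ?O) ?r"
        using w O p(1) by (intro rmult_add_left[symmetric]) auto
      also have "\<dots> = \<zero>\<^bsub>C\<^esub>"
        using p(1) by (simp add: omega_star[OF uv])
      finally have "ract ?O ?r \<oplus>\<^bsub>C\<^esub> ract ?w ?r = \<zero>\<^bsub>C\<^esub>"
        using w O p(1) by (simp add: M.a_comm)
      with \<open>?t \<oplus>\<^bsub>C\<^esub> ract ?w ?r = \<zero>\<^bsub>C\<^esub>\<close> have "?t = ract ?O ?r"
        using t w O p(1) M.add.right_cancel[of "ract ?w ?r" ?t "ract ?O ?r"] by simp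
      then have "?t \<in> principal ?O"
        using principal_ract[OF O gens, of ?r] p(1) by simp
      have "(\<Oplus>\<^bsub>R.Q\<^esub>k\<in>{..<n}. rsmult R.Q (diff R.Q (cstar A (y k))) (cstar A (x k))) =
          (\<Oplus>\<^bsub>R.Q\<^esub>k\<in>{..<n}. R.proj (rsmult C (diff C (cstar A (y k))) (cstar A (x k))))"
        using xy by (intro Q.M.finsum_cong')
          (auto simp: R.quotient_diff R.quotient_rmult R.quotient_carrier rmult_closed diff_closed
            cstar_sphere_closed)
      also have "\<dots> = R.proj ?t"
        using xy by (intro R.quotient_finsum) (auto simp: rmult_closed diff_closed cstar_sphere_closed)
      also have "\<dots> = \<zero>\<^bsub>R.Q\<^esub>"
        using \<open>?t \<in> principal ?O\<close> R.proj_eq_S_iff[OF t] by (simp add: R.quotient_zero)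
      finally show ?thesis .
    qed
  qed
qed

end

text \<open>Equality of the kernels makes the map from \<open>B.Lc v\<close> to
  \<open>D.Lc v\<close> well defined and injective; the common rules r make it compatible with right
  multiplication.\<close>

locale calculus_pair =
  quantum_sphere N q + B: sphere_calculus N q B + D: sphere_calculus N q D
  for N q and B :: "(free_alg set, 'm) calculus" and D :: "(free_alg set, 'n) calculus" +
  fixes r :: "gen \<Rightarrow> gen \<Rightarrow> gen \<Rightarrow> free_alg"
  assumes B_onto: "carrier B = B.Lc ` vecs N"
    and D_onto: "carrier D = D.Lc ` vecs N"
    and kernels: "v \<in> vecs N \<Longrightarrow> B.Lc v = \<zero>\<^bsub>B\<^esub> \<longleftrightarrow> D.Lc v = \<zero>\<^bsub>D\<^esub>"
    and r_vecs: "h \<in> gens N \<Longrightarrow> h' \<in> gens N \<Longrightarrow> r h h' \<in> vecs N"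
    and B_rel: "h \<in> gens N \<Longrightarrow> h' \<in> gens N \<Longrightarrow> B.ract (B.dg h) (gen_poly h') = B.Lc (r h h')"
    and D_rel: "h \<in> gens N \<Longrightarrow> h' \<in> gens N \<Longrightarrow> D.ract (D.dg h) (gen_poly h') = D.Lc (r h h')"
begin

text \<open>Coordinates of m are picked by choice; \<open>phi_Lc\<close> shows that the result does
  not depend on them.\<close>

definition phi :: "'m \<Rightarrow> 'n" where
  "phi m = D.Lc (SOME v. v \<in> vecs N \<and> B.Lc v = m)"

lemma Lc_eq_iff: "v \<in> vecs N \<Longrightarrow> w \<in> vecs N \<Longrightarrow> B.Lc v = B.Lc w \<longleftrightarrow> D.Lc v = D.Lc w"
  by (simp add: B.Lc_eq_iff D.Lc_eq_iff kernels)

lemma phi_Lc: "v \<in> vecs N \<Longrightarrow> phi (B.Lc v) = D.Lc v"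
proof -
  assume v: "v \<in> vecs N"
  then have "(SOME w. w \<in> vecs N \<and> B.Lc w = B.Lc v) \<in> vecs N \<and> B.Lc (SOME w. w \<in> vecs N \<and> B.Lc w = B.Lc v) = B.Lc v"
    by (intro someI[of "\<lambda>w. w \<in> vecs N \<and> B.Lc w = B.Lc v"]) simp
  then show ?thesis
    unfolding phi_def using Lc_eq_iff[OF _ v] by blast
qed

lemma phi_closed: "m \<in> carrier B \<Longrightarrow> phi m \<in> carrier D"
  by (auto simp: B_onto phi_Lc)

lemma phi_add: "m \<in> carrier B \<Longrightarrow> n \<in> carrier B \<Longrightarrow> phi (m \<oplus>\<^bsub>B\<^esub> n) = phi m \<oplus>\<^bsub>D\<^esub> phi n"
  by (auto simp: B_onto phi_Lc B.Lc_add D.Lc_add)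

lemma phi_act: "m \<in> carrier B \<Longrightarrow> p \<in> FC N \<Longrightarrow> phi (B.act p m) = D.act p (phi m)"
  by (auto simp: B_onto phi_Lc B.act_Lc D.act_Lc)

lemma phi_dg: "h \<in> gens N \<Longrightarrow> phi (B.dg h) = D.dg h"
  by (simp add: B.dg_Lc D.dg_Lc phi_Lc)

lemma phi_ract:
  assumes "p \<in> FC N" "m \<in> carrier B"
  shows "phi (B.ract m p) = D.ract (phi m) p"
  using assms
\<comment> \<open>The element m must vary, because the product case applies the second hypothesis to
  m times the first factor.\<close>
proof (induction p arbitrary: m rule: FC_induct)
  case (const c)
  then show ?case
    by (simp add: B.ract_const D.ract_const phi_act phi_closed)
next
  case (gen h)
  then obtain v where v: "v \<in> vecs N" "m = B.Lc v"
    by (auto simp: B_onto)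
  have "B.ract m (gen_poly h) = B.Lc (\<lambda>g'. \<Sum>g\<in>gens N. v g * r g h g')"
    unfolding v using gen v by (intro B.ract_Lc) (auto simp: r_vecs B_rel)
  moreover have "D.ract (phi m) (gen_poly h) = D.Lc (\<lambda>g'. \<Sum>g\<in>gens N. v g * r g h g')"
    unfolding v phi_Lc[OF v(1)] using gen v by (intro D.ract_Lc) (auto simp: r_vecs D_rel)
  ultimately show ?case
    using v gen by (simp add: phi_Lc r_vecs vecs_sum vecs_mult)
next
  case (add p p')
  then show ?case
    by (simp add: B.ract_add D.ract_add phi_add phi_closed)
next
  case (mult p p')
  then show ?case
    by (simp add: B.ract_ract[symmetric] D.ract_ract[symmetric] phi_closed)
qed

lemma phi_diff:
  assumes "p \<in> FC N"
  shows "phi (diff B (cls p)) = diff D (cls p)"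
  using assms
proof (induction p rule: FC_induct)
  case (const c)
  have "phi \<zero>\<^bsub>B\<^esub> = \<zero>\<^bsub>D\<^esub>"
    using phi_Lc[of "\<lambda>g. 0"] by simp
  then show ?case
    by (simp add: B.diff_const D.diff_const)
next
  case (gen g)
  then show ?case by (rule phi_dg)
next
  case (add p p')
  then show ?case
    using B.diff_add[of "cls p" "cls p'"] D.diff_add[of "cls p" "cls p'"]
    by (simp add: phi_add B.diff_closed)
next
  case (mult p p')
  then show ?case
    by (simp add: B.diff_cls_mult D.diff_cls_mult phi_add phi_act phi_ract B.diff_closed)
qed

lemma calculus_iso: "calculus_iso A B D"
  unfolding calculus_iso_def
proof (intro exI[of _ phi] conjI ballI)
  show "bij_betw phi (carrier B) (carrier D)"
    unfolding bij_betw_def inj_on_def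
    by (auto simp: B_onto D_onto phi_Lc Lc_eq_iff image_iff)
qed (auto simp: phi_add phi_act phi_ract phi_diff sphere_carrier)

end

section \<open>Factorisation by one relation\<close>

text \<open>The relation is \<open>u \<Omega>\<^sub>+ + v \<Omega>\<^sub>- = 0\<close> with \<open>(u, v) = (1, \<lambda>)\<close>, or \<open>(0, 1)\<close> for \<open>\<lambda> = \<infinity>\<close>.\<close>

fun lam_u :: "ext_complex \<Rightarrow> complex" where
  "lam_u (Fin l) = 1"
| "lam_u Infty = 0"

fun lam_v :: "ext_complex \<Rightarrow> complex" where
  "lam_v (Fin l) = l"
| "lam_v Infty = 1"

fun lam_real :: "ext_complex \<Rightarrow> bool" where
  "lam_real (Fin l) \<longleftrightarrow> l \<in> \<real>"
| "lam_real Infty \<longleftrightarrow> True"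

text \<open>Says that c Omega_+ + e Omega_- is a scalar multiple of the relation. The existential is
  resolved so that the coefficient checks become plain equations.\<close>

fun proportional :: "ext_complex \<Rightarrow> complex \<Rightarrow> complex \<Rightarrow> bool" where
  "proportional (Fin l) c e \<longleftrightarrow> e = c * l"
| "proportional Infty c e \<longleftrightarrow> c = 0"

lemma proportionalE:
  assumes "proportional lam c e"
  obtains k where "c = k * lam_u lam" "e = k * lam_v lam"
  using assms by (cases lam) auto

context quantum_sphere
begin

abbreviation "omega_lam lam \<equiv> omega (lam_u lam) (lam_v lam)"

lemma relation_vector_eq: "relation_vector N q lam = (\<lambda>g\<in>gens N. cls (omega_lam lam g))"
  unfolding relation_vector_def
proof (rule restrict_ext)
  fix g assume g: "g \<in> gens N"
  show "(case lam of
     Fin l \<Rightarrow> (case g of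
         Z i \<Rightarrow> cscale (sphere N q) (l * q powi (- 2 * int i)) (sphere_gen N q (Zs i))
       | Zs i \<Rightarrow> sphere_gen N q (Z i))
   | Infty \<Rightarrow> (case g of
         Z i \<Rightarrow> cscale (sphere N q) (q powi (- 2 * int i)) (sphere_gen N q (Zs i))
       | Zs i \<Rightarrow> \<zero>\<^bsub>sphere N q\<^esub>)) = cls (omega_lam lam g)"
    using g by (cases lam; cases g)
      (simp_all add: omega_def sphere_gen_cls cls_zero wt_def const_mult_left)
qed

text \<open>A flag names the remaining form uniformly in calculi with different carriers.\<close>

definition Om :: "bool \<Rightarrow> (free_alg set, 'm) calculus \<Rightarrow> 'm" where
  "Om pl C = (if pl then Omega_plus N q C else Omega_minus N q C)"

text \<open>The flag \<open>pl\<close> tells whether \<open>\<Omega>\<^sub>+\<close> or \<open>\<Omega>\<^sub>-\<close> is the form that remains in the relations of the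
  quotient. The first four conditions make the relation generate a sub-bimodule of rank one, the
  others express that \<open>K\<close> becomes \<open>K'\<close> modulo the relation.\<close>

definition compatible :: "ext_complex \<Rightarrow> two_coeffs \<Rightarrow> one_coeffs \<Rightarrow> bool \<Rightarrow> bool" where
  "compatible lam K K' pl \<longleftrightarrow> (let u = lam_u lam; v = lam_v lam; x = of_bool pl; y = of_bool (\<not> pl) in
     proportional lam (u * (q * a\<^sub>4 K + c\<^sub>4 K + d\<^sub>4 K) + v * (c\<^sub>1 K / q^2))
       (u * (e\<^sub>4 K + f\<^sub>4 K) + v * (a\<^sub>1 K / q + e\<^sub>1 K / q^2)) \<and>
     u * b\<^sub>4 K + v * (b\<^sub>1 K / q^2) = 0 \<and>
     proportional lam (u * (q * a\<^sub>2 K + c\<^sub>2 K) + v * (c\<^sub>3 K / q^2 + d\<^sub>3 K))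
       (u * e\<^sub>2 K + v * (a\<^sub>3 K / q + e\<^sub>3 K / q^2 + f\<^sub>3 K)) \<and>
     u * b\<^sub>2 K + v * (b\<^sub>3 K / q^2) = 0 \<and>
     a\<^sub>1 K = a\<^sub>1 K' \<and> a\<^sub>2 K = a\<^sub>2 K' \<and> a\<^sub>3 K = a\<^sub>3 K' \<and> a\<^sub>4 K = a\<^sub>4 K' \<and>
     b\<^sub>1 K = b\<^sub>1 K' \<and> b\<^sub>2 K = b\<^sub>2 K' \<and> b\<^sub>3 K = b\<^sub>3 K' \<and> b\<^sub>4 K = b\<^sub>4 K' \<and>
     proportional lam (c\<^sub>1 K - x * c\<^sub>1 K') (e\<^sub>1 K - y * c\<^sub>1 K') \<and>
     proportional lam (c\<^sub>2 K - x * c\<^sub>2 K') (e\<^sub>2 K - y * c\<^sub>2 K') \<and>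
     proportional lam (c\<^sub>3 K - x * c\<^sub>3 K') (e\<^sub>3 K - y * c\<^sub>3 K') \<and>
     proportional lam (c\<^sub>4 K - x * c\<^sub>4 K') (e\<^sub>4 K - y * c\<^sub>4 K') \<and>
     proportional lam (d\<^sub>3 K - x * d\<^sub>3 K') (f\<^sub>3 K - y * d\<^sub>3 K') \<and>
     proportional lam (d\<^sub>4 K - x * d\<^sub>4 K') (f\<^sub>4 K - y * d\<^sub>4 K'))"

lemma om_coeff_linear:
  "om_coeff (x * c1 + u * k1) (x * c2 + u * k2) (x * c3 + u * k3) (x * c4 + u * k4)
     (x * d3 + u * l3) (x * d4 + u * l4) h h' =
   const x * om_coeff c1 c2 c3 c4 d3 d4 h h' + const u * om_coeff k1 k2 k3 k4 l3 l4 h h'"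
  by (cases h; cases h')
    (auto simp: const_add const_mult distrib_left distrib_right mult.assoc)

lemma rmat_cong:
  assumes "a\<^sub>1 K = a\<^sub>1 K'" "a\<^sub>2 K = a\<^sub>2 K'" "a\<^sub>3 K = a\<^sub>3 K'" "a\<^sub>4 K = a\<^sub>4 K'"
    "b\<^sub>1 K = b\<^sub>1 K'" "b\<^sub>2 K = b\<^sub>2 K'" "b\<^sub>3 K = b\<^sub>3 K'" "b\<^sub>4 K = b\<^sub>4 K'"
  shows "rmat K h h' = rmat K' h h'"
  using assms by (cases h; cases h') simp_all

text \<open>In each coefficient, K and K' differ by a multiple of (u, v). These multiples are
  themselves the parameters of an \<open>om_coeff\<close>, which is the p in front of the
  relation.\<close>

lemma rho_two_reduce:
  assumes K: "compatible lam K K' pl" and h: "h \<in> gens N" "h' \<in> gens N"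
  obtains p where "p \<in> FC N"
    "\<And>g. rho_two K h h' g = rho_one K' (omega (of_bool pl) (of_bool (\<not> pl))) h h' g + p * omega_lam lam g"
proof -
  let ?x = "of_bool pl :: complex" and ?y = "of_bool (\<not> pl) :: complex"
  note K' = K[unfolded compatible_def Let_def]
  obtain k1 where k1: "c\<^sub>1 K - ?x * c\<^sub>1 K' = k1 * lam_u lam" "e\<^sub>1 K - ?y * c\<^sub>1 K' = k1 * lam_v lam"
    using K' by (blast elim: proportionalE)
  obtain k2 where k2: "c\<^sub>2 K - ?x * c\<^sub>2 K' = k2 * lam_u lam" "e\<^sub>2 K - ?y * c\<^sub>2 K' = k2 * lam_v lam"
    using K' by (blast elim: proportionalE)
  obtain k3 where k3: "c\<^sub>3 K - ?x * c\<^sub>3 K' = k3 * lam_u lam" "e\<^sub>3 K - ?y * c\<^sub>3 K' = k3 * lam_v lam"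
    using K' by (blast elim: proportionalE)
  obtain k4 where k4: "c\<^sub>4 K - ?x * c\<^sub>4 K' = k4 * lam_u lam" "e\<^sub>4 K - ?y * c\<^sub>4 K' = k4 * lam_v lam"
    using K' by (blast elim: proportionalE)
  obtain l3 where l3: "d\<^sub>3 K - ?x * d\<^sub>3 K' = l3 * lam_u lam" "f\<^sub>3 K - ?y * d\<^sub>3 K' = l3 * lam_v lam"
    using K' by (blast elim: proportionalE)
  obtain l4 where l4: "d\<^sub>4 K - ?x * d\<^sub>4 K' = l4 * lam_u lam" "f\<^sub>4 K - ?y * d\<^sub>4 K' = l4 * lam_v lam"
    using K' by (blast elim: proportionalE)
  let ?p = "om_coeff k1 k2 k3 k4 l3 l4 h h'" and ?c = "c_coeff K' h h'"
  have *: "c = x * c' + u * k" if "c - x * c' = k * u" for c x c' k u :: complex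
    using that by (simp add: algebra_simps)
  have "c_coeff K h h' = const ?x * ?c + const (lam_u lam) * ?p"
    unfolding c_coeff_def om_coeff_linear[symmetric] k1(1)[THEN *] k2(1)[THEN *] k3(1)[THEN *]
      k4(1)[THEN *] l3(1)[THEN *] l4(1)[THEN *] ..
  moreover have "e_coeff K h h' = const ?y * ?c + const (lam_v lam) * ?p"
    unfolding e_coeff_def c_coeff_def om_coeff_linear[symmetric] k1(2)[THEN *] k2(2)[THEN *]
      k3(2)[THEN *] k4(2)[THEN *] l3(2)[THEN *] l4(2)[THEN *] ..
  moreover have "rmat K h h' = rmat K' h h'"
    using K' by (intro rmat_cong) auto
  ultimately have "rho_two K h h' g = rho_one K' (omega ?x ?y) h h' g + ?p * omega_lam lam g" for g
    by (simp add: rho_two_def rho_one_def omega_def distrib_left distrib_right mult.assoc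
        const_left_commute[of ?p] const_left_commute[of ?c])
  then show thesis
    using h by (intro that[of ?p]) auto
qed

end

context sphere_calculus
begin

lemma relation_form_Lc: "relation_form N q lam C = Lc (omega_lam lam)"
  by (cases lam)
    (simp_all add: relation_form_def Omega_plus_Lc Omega_minus_Lc cls_one act_Lc Lc_add omega_def)

lemma Om_Lc: "Om pl C = Lc (omega (of_bool pl) (of_bool (\<not> pl)))"
  by (simp add: Om_def Omega_plus_Lc Omega_minus_Lc omega_def)

lemma ball_free_vectors:
  "(\<forall>u\<in>free_vectors N q. P u) \<longleftrightarrow> (\<forall>v\<in>vecs N. P (\<lambda>g\<in>gens N. cls (v g)))"
proof (intro iffI ballI)
  fix u assume P: "\<forall>v\<in>vecs N. P (\<lambda>g\<in>gens N. cls (v g))" and "u \<in> free_vectors N q"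
  from this(2) obtain v where "v \<in> vecs N" "u = (\<lambda>g\<in>gens N. cls (v g))"
    by (rule free_vectors_vecs)
  with P show "P u"
    by simp
qed (simp add: vecs_free_vectors)

text \<open>Replaces functions into cosets by congruences between representatives; the multiplier
  from the sphere becomes a polynomial p.\<close>

lemma left_one_relation_iff:
  "left_one_relation N q lam C \<longleftrightarrow> carrier C = Lc ` vecs N \<and>
    (\<forall>v\<in>vecs N. Lc v = \<zero>\<^bsub>C\<^esub> \<longleftrightarrow> (\<exists>p\<in>FC N. \<forall>g\<in>gens N. v g \<approx> p * omega_lam lam g))"
proof -
  let ?W = "\<lambda>p. \<lambda>g\<in>gens N. cls (p * omega_lam lam g)"
  let ?K = "{v \<in> free_vectors N q. left_comb N q C v = \<zero>\<^bsub>C\<^esub>}"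
  have res: "(\<lambda>g\<in>gens N. cls (v g)) = (\<lambda>g\<in>gens N. cls (w g)) \<longleftrightarrow> (\<forall>g\<in>gens N. v g \<approx> w g)"
    if "v \<in> vecs N" "w \<in> vecs N" for v w
  proof -
    have "(\<lambda>g\<in>gens N. cls (v g)) = (\<lambda>g\<in>gens N. cls (w g)) \<longleftrightarrow> (\<forall>g\<in>gens N. cls (v g) = cls (w g))"
      by (auto simp: restrict_def fun_eq_iff)
    then show ?thesis
      using that by (simp add: cls_eq_iff eqI_def)
  qed
  have "{\<lambda>g\<in>gens N. w \<otimes>\<^bsub>A\<^esub> relation_vector N q lam g | w. w \<in> carrier A} = ?W ` FC N"
  proof -
    have "(\<lambda>g\<in>gens N. cls p \<otimes>\<^bsub>A\<^esub> relation_vector N q lam g) = ?W p" if "p \<in> FC N" for p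
      using that by (intro restrict_ext) (simp add: relation_vector_eq)
    then show ?thesis
      by (auto simp: sphere_carrier image_iff Bex_def) metis
  qed
  moreover have "?K = ?W ` FC N \<longleftrightarrow>
      (\<forall>v\<in>vecs N. Lc v = \<zero>\<^bsub>C\<^esub> \<longleftrightarrow> (\<exists>p\<in>FC N. \<forall>g\<in>gens N. v g \<approx> p * omega_lam lam g))"
  proof -
    have "?K = ?W ` FC N \<longleftrightarrow> (\<forall>u\<in>free_vectors N q. u \<in> ?K \<longleftrightarrow> u \<in> ?W ` FC N)"
      using vecs_free_vectors[OF vecs_mult[OF _ omega_vecs]] by blast
    also have "\<dots> \<longleftrightarrow> (\<forall>v\<in>vecs N. (\<lambda>g\<in>gens N. cls (v g)) \<in> ?K \<longleftrightarrow> (\<lambda>g\<in>gens N. cls (v g)) \<in> ?W ` FC N)"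
      by (rule ball_free_vectors)
    also have "\<dots> \<longleftrightarrow> (\<forall>v\<in>vecs N. Lc v = \<zero>\<^bsub>C\<^esub> \<longleftrightarrow> (\<exists>p\<in>FC N. \<forall>g\<in>gens N. v g \<approx> p * omega_lam lam g))"
      by (simp add: left_comb_eq_zero_iff image_iff res vecs_mult del: mem_Collect_eq)
    finally show ?thesis .
  qed
  ultimately show ?thesis
    unfolding left_one_relation_def left_comb_image by auto
qed

lemma left_free_imp:
  assumes "left_free N q C"
  shows "carrier C = Lc ` vecs N"
    and "v \<in> vecs N \<Longrightarrow> w \<in> vecs N \<Longrightarrow> Lc v = Lc w \<Longrightarrow> g \<in> gens N \<Longrightarrow> v g \<approx> w g"
proof -
  show "carrier C = Lc ` vecs N"
    unfolding left_comb_image[symmetric]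
  proof (intro equalityI subsetI)
    fix m assume "m \<in> carrier C"
    then show "m \<in> left_comb N q C ` free_vectors N q"
      using assms unfolding left_free_def by blast
  next
    fix m assume "m \<in> left_comb N q C ` free_vectors N q"
    then show "m \<in> carrier C"
      unfolding left_comb_image by auto
  qed
  assume v: "v \<in> vecs N" "w \<in> vecs N" "Lc v = Lc w" and g: "g \<in> gens N"
  have "\<exists>!u. u \<in> free_vectors N q \<and> left_comb N q C u = Lc v"
    using assms v unfolding left_free_def by blast
  moreover have "(\<lambda>g\<in>gens N. cls (v g)) \<in> free_vectors N q \<and> left_comb N q C (\<lambda>g\<in>gens N. cls (v g)) = Lc v"
    using v by (simp add: vecs_free_vectors left_comb_Lc)
  moreover have "(\<lambda>g\<in>gens N. cls (w g)) \<in> free_vectors N q \<and> left_comb N q C (\<lambda>g\<in>gens N. cls (w g)) = Lc v"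
    using v by (simp add: vecs_free_vectors left_comb_Lc)
  ultimately have "(\<lambda>g\<in>gens N. cls (v g)) = (\<lambda>g\<in>gens N. cls (w g))"
    by blast
  from fun_cong[OF this, of g] have "cls (v g) = cls (w g)"
    using g by simp
  then show "v g \<approx> w g"
    using v g by (simp add: cls_eq_iff eqI_def)
qed

end

section \<open>Uniqueness of the quotient and the factorisation theorem\<close>

context quantum_sphere
begin

lemma sphere_calculusI: "first_order_calculus A C \<Longrightarrow> sphere_calculus N q C"
  by (intro sphere_calculus.intro quantum_sphere_axioms)

lemma one_relation_calculus_unique:
  assumes B: "one_relation_calculus N q lam K B (Om pl B)"
    and D: "one_relation_calculus N q lam K D (Om pl D)"
  shows "calculus_iso A B D"
proof -
  interpret B: sphere_calculus N q B
    using B by (intro sphere_calculusI) (simp add: one_relation_calculus_def)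
  interpret D: sphere_calculus N q D
    using D by (intro sphere_calculusI) (simp add: one_relation_calculus_def)
  let ?w = "omega (of_bool pl) (of_bool (\<not> pl))"
  have "calculus_pair N q B D (rho_one K ?w)"
    using B D unfolding one_relation_calculus_def
    by unfold_locales
      (simp_all add: B.Om_Lc D.Om_Lc B.one_form_relations_iff D.one_form_relations_iff
        B.left_one_relation_iff D.left_one_relation_iff)
  then show ?thesis
    by (rule calculus_pair.calculus_iso)
qed

theorem factorisation:
  fixes C :: "(free_alg set, 'm) calculus"
  assumes C: "free_calculus N q K C" and K: "compatible lam K K' pl"
  shows "one_relation_calculus N q lam K' (factor_calculus N q C lam) (Om pl (factor_calculus N q C lam))"
    and "lam_real lam \<Longrightarrow> star_calculus A (factor_calculus N q C lam)"
proof -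
  have star: "star_calculus A C" and free: "left_free N q C" and form: "two_form_relations N q K C"
    using C by (auto simp: free_calculus_def)
  interpret star_calculus A C
    by (rule star)
  interpret C: sphere_calculus N q C
    by (intro sphere_calculusI first_order_calculus_axioms)
  let ?w = "omega_lam lam"
  let ?O = "C.Lc ?w"
  have O: "?O \<in> carrier C"
    by auto
  have rel: "C.ract (C.dg h) (gen_poly h') = C.Lc (rho_two K h h')" if "h \<in> gens N" "h' \<in> gens N" for h h'
    using form that by (simp add: C.two_form_relations_iff)
  have gens: "C.ract ?O (gen_poly h) \<in> C.principal ?O" if h: "h \<in> gens N" for h
  proof -
    have "\<exists>m. \<forall>g'\<in>gens N. (\<Sum>g\<in>gens N. ?w g * rho_two K g h g') \<approx> const m * gen_poly h * ?w g'"
    proof (cases h)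
      case (Z l)
      \<comment> \<open>The eigenvalue m is the proportionality factor supplied by the first
        condition of \<open>compatible\<close>.\<close>
      have "\<exists>m. stable_Z K (lam_u lam) (lam_v lam) m"
        using K unfolding compatible_def Let_def stable_Z_def by (blast elim: proportionalE)
      then show ?thesis
        using omega_stable_Z h unfolding Z by fastforce
    next
      case (Zs l)
      have "\<exists>m. stable_Zs K (lam_u lam) (lam_v lam) m"
        using K unfolding compatible_def Let_def stable_Zs_def by (blast elim: proportionalE)
      then show ?thesis
        using omega_stable_Zs h unfolding Zs by fastforce
    qed
    then obtain m where m: "\<And>g'. g' \<in> gens N \<Longrightarrow>
        (\<Sum>g\<in>gens N. ?w g * rho_two K g h g') \<approx> const m * gen_poly h * ?w g'"
      by blast
    have "C.ract ?O (gen_poly h) = C.Lc (\<lambda>g'. \<Sum>g\<in>gens N. ?w g * rho_two K g h g')"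
      using h by (intro C.ract_Lc) (auto simp: rel)
    also have "\<dots> = C.Lc (\<lambda>g'. const m * gen_poly h * ?w g')"
      using h m by (intro C.Lc_congI vecs_sum vecs_mult) (auto simp: eqI_def)
    also have "\<dots> = C.act (const m * gen_poly h) ?O"
      using h by (simp add: C.act_Lc)
    finally show ?thesis
      using h unfolding C.principal_def by auto
  qed
  let ?B = "quotient_calculus C (C.principal ?O)"
  have B: "factor_calculus N q C lam = ?B"
    using C.sub_bimodule_principal(2)[OF O gens] by (simp add: factor_calculus_def C.relation_form_Lc)
  interpret R: calculus_quotient A C "C.principal ?O"
    by (rule C.calculus_quotient_principal[OF O gens])
  interpret B: sphere_calculus N q ?B
    by (intro sphere_calculusI R.first_order_calculus_quotient)
  have B_Lc: "B.Lc v = R.proj (C.Lc v)" if v: "v \<in> vecs N" for v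
  proof -
    have "B.Lc v = (\<Oplus>\<^bsub>?B\<^esub>g\<in>gens N. R.proj (C.act (v g) (C.dg g)))"
      unfolding B.Lc_def using v
      by (intro B.M.finsum_cong') (auto simp: R.quotient_lmult R.quotient_diff R.quotient_carrier)
    also have "\<dots> = R.proj (\<Oplus>\<^bsub>C\<^esub>g\<in>gens N. C.act (v g) (C.dg g))"
      using v by (intro R.quotient_finsum) auto
    finally show ?thesis
      by (simp only: C.Lc_def[of v])
  qed
  have B_zero: "B.Lc v = \<zero>\<^bsub>?B\<^esub> \<longleftrightarrow> (\<exists>p\<in>FC N. \<forall>g\<in>gens N. v g \<approx> p * ?w g)" if v: "v \<in> vecs N" for v
  proof -
    have "B.Lc v = \<zero>\<^bsub>?B\<^esub> \<longleftrightarrow> C.Lc v \<in> C.principal ?O"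
      using v by (simp add: B_Lc R.quotient_zero R.proj_eq_S_iff)
    also have "\<dots> \<longleftrightarrow> (\<exists>p\<in>FC N. C.Lc v = C.Lc (\<lambda>g. p * ?w g))"
      by (auto simp: C.principal_def C.act_Lc)
    \<comment> \<open>Freeness of the left module enters here: equal elements of C have congruent
      coordinates.\<close>
    also have "\<dots> \<longleftrightarrow> (\<exists>p\<in>FC N. \<forall>g\<in>gens N. v g \<approx> p * ?w g)"
    proof (intro bex_cong refl)
      fix p assume "p \<in> FC N"
      then have w: "(\<lambda>g. p * ?w g) \<in> vecs N"
        by (intro vecs_mult) auto
      show "C.Lc v = C.Lc (\<lambda>g. p * ?w g) \<longleftrightarrow> (\<forall>g\<in>gens N. v g \<approx> p * ?w g)"
      proof
        assume "C.Lc v = C.Lc (\<lambda>g. p * ?w g)"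
        then show "\<forall>g\<in>gens N. v g \<approx> p * ?w g"
          using C.left_free_imp(2)[OF free v w] by blast
      next
        assume "\<forall>g\<in>gens N. v g \<approx> p * ?w g"
        then show "C.Lc v = C.Lc (\<lambda>g. p * ?w g)"
          using v w by (intro C.Lc_congI) (auto simp: eqI_def)
      qed
    qed
    finally show ?thesis .
  qed
  have "carrier ?B = B.Lc ` vecs N"
    by (auto simp: R.quotient_carrier C.left_free_imp(1)[OF free] B_Lc image_iff)
  then have one: "left_one_relation N q lam ?B"
    by (simp add: B.left_one_relation_iff B_zero)
  have "B.ract (B.dg h) (gen_poly h') = B.Lc (rho_one K' (omega (of_bool pl) (of_bool (\<not> pl))) h h')"
    if h: "h \<in> gens N" "h' \<in> gens N" for h h'
  proof -
    let ?r = "rho_one K' (omega (of_bool pl) (of_bool (\<not> pl))) h h'"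
    obtain p where p: "p \<in> FC N" "\<And>g. rho_two K h h' g = ?r g + p * ?w g"
      using rho_two_reduce[OF K h] by blast
    have "B.ract (B.dg h) (gen_poly h') = B.Lc (rho_two K h h')"
      using h by (simp add: R.quotient_diff R.quotient_rmult rel B_Lc)
    also have "rho_two K h h' = (\<lambda>g. ?r g + p * ?w g)"
      using p(2) by blast
    also have "B.Lc \<dots> = B.Lc ?r \<oplus>\<^bsub>?B\<^esub> B.Lc (\<lambda>g. p * ?w g)"
      using p(1) h by (intro B.Lc_add[symmetric]) auto
    \<comment> \<open>Left multiples of the relation vanish, so the two-form rule becomes the
      one-form rule.\<close>
    also have "B.Lc (\<lambda>g. p * ?w g) = \<zero>\<^bsub>?B\<^esub>"
      using p(1) by (subst B_zero) auto
    finally show ?thesis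
      using h by simp
  qed
  then have "one_form_relations N q K' ?B (Om pl ?B)"
    by (simp add: B.Om_Lc B.one_form_relations_iff)
  with one show "one_relation_calculus N q lam K' (factor_calculus N q C lam) (Om pl (factor_calculus N q C lam))"
    unfolding B one_relation_calculus_def by (simp add: R.first_order_calculus_quotient)
  assume "lam_real lam"
  then have "lam_u lam \<in> \<real>" "lam_v lam \<in> \<real>"
    by (cases lam; simp)+
  then show "star_calculus A (factor_calculus N q C lam)"
    unfolding B using gens by (intro C.star_calculus_quotient star)
qed

section \<open>Verification of the coefficients for the four families\<close>

lemma s_plus_eq: "s_plus N q = s_plus' N q + 1"
  by (simp add: s_plus'_def)

text \<open>The geometric sum gives q^(2N) - 1 = (q^2 - 1) s_+. Eliminating q^(2N) this way turns
  all coefficient checks into rational identities in q, s'_+ and the parameters.\<close>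

lemma q_power_eq: "q ^ (2 * N) = q\<^sup>2 * (s_plus' N q + 1) - s_plus' N q"
proof -
  have "q\<^sup>2 * (\<Sum>i<n. q ^ (2 * i)) - (\<Sum>i<n. q ^ (2 * i)) = q ^ (2 * n) - 1" for n
    by (induction n) (simp_all add: algebra_simps power2_eq_square)
  from this[of N] show ?thesis
    by (simp add: s_plus'_def s_plus_def algebra_simps)
qed

lemma factor_plus:
  assumes "free_calculus N q K C" "compatible lam K K' True"
  shows "one_relation_calculus N q lam K' (factor_calculus N q C lam) (Omega_plus N q (factor_calculus N q C lam)) \<and>
    (lam_real lam \<longrightarrow> star_calculus A (factor_calculus N q C lam))"
  using factorisation[OF assms] by (simp add: Om_def)

lemma factor_minus:
  assumes "free_calculus N q K C" "compatible lam K K' False"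
  shows "one_relation_calculus N q lam K' (factor_calculus N q C lam) (Omega_minus N q (factor_calculus N q C lam)) \<and>
    (lam_real lam \<longrightarrow> star_calculus A (factor_calculus N q C lam))"
  using factorisation[OF assms] by (simp add: Om_def)

lemma unique_plus:
  "one_relation_calculus N q lam K B (Omega_plus N q B) \<Longrightarrow> one_relation_calculus N q lam K D (Omega_plus N q D) \<Longrightarrow>
    calculus_iso A B D"
  using one_relation_calculus_unique[of lam K B True D] by (simp add: Om_def)

lemma unique_minus:
  "one_relation_calculus N q lam K B (Omega_minus N q B) \<Longrightarrow> one_relation_calculus N q lam K D (Omega_minus N q D) \<Longrightarrow>
    calculus_iso A B D"
  using one_relation_calculus_unique[of lam K B False D] by (simp add: Om_def)

lemma tilde_Gamma_unique:
  "is_tilde_Gamma N q l B \<Longrightarrow> is_tilde_Gamma N q l D \<Longrightarrow> calculus_iso A B D"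
  unfolding is_tilde_Gamma_def Let_def by (blast intro: unique_plus)

lemma tilde_Gamma'_unique:
  "is_tilde_Gamma' N q l B \<Longrightarrow> is_tilde_Gamma' N q l D \<Longrightarrow> calculus_iso A B D"
  unfolding is_tilde_Gamma'_def Let_def by (blast intro: unique_plus)

lemma tilde_Gamma''_unique:
  "is_tilde_Gamma'' N q lam B \<Longrightarrow> is_tilde_Gamma'' N q lam D \<Longrightarrow> calculus_iso A B D"
  unfolding is_tilde_Gamma''_def Let_def
  by (auto split: ext_complex.splits if_splits intro: unique_plus unique_minus)


text \<open>Removing the summand 1 leaves a nonempty sum of positive even powers, so divisions by
  s'_+ are legitimate.\<close>

lemma s_plus'_pos: "N \<ge> 2 \<Longrightarrow> s_plus' N q > 0"
proof -
  assume "N \<ge> 2"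
  then have "s_plus' N q = (\<Sum>i\<in>{1..<N}. q ^ (2 * i))"
    by (simp add: s_plus'_def s_plus_def lessThan_atLeast0 sum.atLeast_Suc_lessThan)
  also have "\<dots> > 0"
    using \<open>N \<ge> 2\<close> by (intro sum_pos) (auto simp: zero_less_power_eq)
  finally show ?thesis .
qed

lemma q_power_eq': "N \<ge> 2 \<Longrightarrow> q ^ (2 * N - 2) = s_plus' N q + 1 - s_plus' N q / q^2"
proof -
  assume "N \<ge> 2"
  then have "q ^ (2 * N - 2) * q ^ 2 = q ^ (2 * N)"
    by (metis diff_add le_trans mult_2 nat_le_iff_add numeral_Bit0 one_add_one power_add trans_le_add1)
  then show ?thesis
    using q_power_eq by (simp add: field_simps)
qed

text \<open>As \<alpha> \<noteq> q^(-2), the dh part b_4 + lambda b_1/q^2 vanishes only for lambda =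
  1/alpha. Modulo this relation tau drops out: what it adds to the Omega terms is a multiple of the
  relation.\<close>

lemma Gamma_factor:
  assumes "\<alpha> \<notin> {0, 1 / q^2}" "is_Gamma N q \<alpha> \<tau> C"
  defines "l \<equiv> complex_of_real (1 / \<alpha>)"
  shows "is_tilde_Gamma N q l (factor_calculus N q C (Fin l)) \<and> (l \<in> \<real> \<longrightarrow> star_calculus A (factor_calculus N q C (Fin l)))"
proof -
  have l: "l \<notin> {0, of_real q ^ 2}"
    using assms(1) by (auto simp: l_def field_simps simp flip: of_real_power of_real_mult)
  have [simp]: "\<alpha> \<noteq> 0"
    using assms(1) by auto
  show ?thesis
    unfolding is_tilde_Gamma_def Let_def conj_assoc lam_real.simps(1)[symmetric]
    by (intro conjI[OF l] factor_plus[OF assms(2)[unfolded is_Gamma_def Let_def]])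
      (simp add: compatible_def l_def,
        simp add: s_plus_eq q_power_eq flip: of_real_power,
        simp add: field_simps power2_eq_square power4_eq_xxxx)
qed

text \<open>The b coefficients, and hence lambda, are those of \<open>is_Gamma\<close>. The
  difference of the first rules is the factor w - q^2 alpha (alpha - 1) times (1, 1/alpha), so w
  drops out of them as well.\<close>

lemma Gamma'_factor:
  assumes "\<alpha> \<notin> {0, 1 / q^2}" "w \<noteq> 0" "is_Gamma' N q \<alpha> w C"
  defines "l \<equiv> complex_of_real (1 / \<alpha>)"
  shows "is_tilde_Gamma N q l (factor_calculus N q C (Fin l)) \<and> (l \<in> \<real> \<longrightarrow> star_calculus A (factor_calculus N q C (Fin l)))"
proof -
  have l: "l \<notin> {0, of_real q ^ 2}"
    using assms(1) by (auto simp: l_def field_simps simp flip: of_real_power of_real_mult)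
  have [simp]: "\<alpha> \<noteq> 0" "w \<noteq> 0"
    using assms(1,2) by auto
  show ?thesis
    unfolding is_tilde_Gamma_def Let_def conj_assoc lam_real.simps(1)[symmetric]
    by (intro conjI[OF l] factor_plus[OF assms(3)[unfolded is_Gamma'_def Let_def]])
      (simp add: compatible_def l_def,
        simp add: field_simps power2_eq_square power4_eq_xxxx)
qed

text \<open>All b vanish, and stability under \<open>z l\<close>, with eigenvalue w lambda/q^2, is
  exactly the quadratic equation. Its constant term 1 excludes lambda = 0.\<close>

lemma Gamma''_factor:
  assumes "w \<noteq> 0" "is_Gamma'' N q w \<psi> C"
    and "of_real (w / q^4) * l^2 - of_real (w * \<psi> / q^2) * l + 1 = 0"
  shows "is_tilde_Gamma' N q l (factor_calculus N q C (Fin l)) \<and> (l \<in> \<real> \<longrightarrow> star_calculus A (factor_calculus N q C (Fin l)))"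
proof -
  have l: "l \<noteq> 0"
    using assms(3) by auto
  have [simp]: "w \<noteq> 0"
    using assms(1) by auto
  \<comment> \<open>The quadratic equation with denominators cleared and products nested to match
    the normal form of the goals, for use as a rewrite rule.\<close>
  have E: "l * (of_real \<psi> * (of_real q * (of_real q * of_real w))) =
      l * (l * of_real w) + of_real q * (of_real q * (of_real q * of_real q))"
    using assms(3) by (simp add: field_simps power2_eq_square power4_eq_xxxx)
  show ?thesis
    unfolding is_tilde_Gamma'_def Let_def conj_assoc lam_real.simps(1)[symmetric]
    by (intro conjI[OF l] factor_plus[OF assms(2)[unfolded is_Gamma''_def Let_def]])
      (simp add: compatible_def l,
        simp add: field_simps power2_eq_square power4_eq_xxxx l E)
qed

text \<open>The delta terms d Omega_+ + f Omega_- are multiples of the relation precisely for this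
  lambda, so they disappear from the rules.\<close>

lemma Gamma'''_factor1:
  assumes "N \<ge> 2" "\<rho> \<noteq> 0" "\<tau> \<noteq> 0" "is_Gamma''' N q \<rho> \<tau> C"
  defines "l \<equiv> complex_of_real (q^2 * \<tau> / \<rho>)"
  shows "is_tilde_Gamma' N q l (factor_calculus N q C (Fin l)) \<and> (l \<in> \<real> \<longrightarrow> star_calculus A (factor_calculus N q C (Fin l)))"
proof -
  have l: "l \<noteq> 0"
    using assms by (auto simp: l_def)
  have [simp]: "\<rho> \<noteq> 0" "\<tau> \<noteq> 0"
    using assms by auto
  show ?thesis
    unfolding is_tilde_Gamma'_def Let_def conj_assoc lam_real.simps(1)[symmetric]
    by (intro conjI[OF l] factor_plus[OF assms(4)[unfolded is_Gamma'''_def Let_def]])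
      (simp add: compatible_def l_def,
        simp add: s_plus_eq q_power_eq q_power_eq'[OF assms(1)] flip: of_real_power,
        simp add: field_simps power2_eq_square power4_eq_xxxx)
qed

text \<open>This lambda makes c_1 Omega_+ + e_1 Omega_- and c_2 Omega_+ + e_2 Omega_- multiples of
  the relation, so these terms disappear. For lambda = 0 the relation is Omega_+ = 0 and the rules
  retain Omega_-.\<close>

lemma Gamma'''_factor2:
  assumes "N \<ge> 2" "\<rho> \<notin> {0, 1 / s_plus' N q}" "\<tau> \<noteq> 0" "is_Gamma''' N q \<rho> \<tau> C"
  defines "l \<equiv> complex_of_real (q^2 * (s_plus' N q * \<tau> - q^2) / (s_plus' N q * \<rho> - 1))"
  shows "is_tilde_Gamma'' N q (Fin l) (factor_calculus N q C (Fin l)) \<and> (l \<in> \<real> \<longrightarrow> star_calculus A (factor_calculus N q C (Fin l)))"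
proof -
  have [simp]: "\<rho> \<noteq> 0" "\<tau> \<noteq> 0" "s_plus' N q \<noteq> 0"
    using assms s_plus'_pos by auto
  define S where "S = complex_of_real (s_plus' N q)"
  have S: "S \<noteq> 0"
    by (simp add: S_def)
  have d: "S * of_real \<rho> - 1 \<noteq> 0"
    using assms(2) by (auto simp: S_def field_simps simp flip: of_real_mult)
  have L: "l * (S * of_real \<rho> - 1) = of_real q ^ 2 * (S * of_real \<tau> - of_real q ^ 2)"
    using d by (simp add: l_def S_def)
  show ?thesis
  proof (cases "l = 0")
    case True
    then have "S * of_real \<tau> = of_real q ^ 2"
      using L by simp
    then have t: "of_real \<tau> = of_real q ^ 2 / S"
      using S by (simp add: field_simps)
    show ?thesis
      unfolding is_tilde_Gamma''_def Let_def True ext_complex.case if_P[OF refl] lam_real.simps(1)[symmetric]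
      by (intro factor_minus[OF assms(4)[unfolded is_Gamma'''_def Let_def]])
        (simp add: compatible_def,
          simp add: s_plus_eq q_power_eq q_power_eq'[OF assms(1)] t S flip: of_real_power S_def,
          simp add: field_simps power2_eq_square power4_eq_xxxx S)
  next
    case False
    \<comment> \<open>The common value of (S rho - 1)/q^2 and (S tau - q^2)/l. Writing rho and tau
      through k builds the equation for l into the parametrisation.\<close>
    define k where "k = (S * of_real \<rho> - 1) / of_real q ^ 2"
    have R: "of_real \<rho> = (1 + of_real q ^ 2 * k) / S"
      using S by (simp add: k_def)
    have T: "of_real \<tau> = (of_real q ^ 2 + l * k) / S"
      using S L by (simp add: k_def field_simps)
    have n: "1 + of_real q ^ 2 * k \<noteq> 0" "of_real q ^ 2 + l * k \<noteq> 0"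
      using R T by auto
    show ?thesis
      unfolding is_tilde_Gamma''_def Let_def ext_complex.case if_not_P[OF False] lam_real.simps(1)[symmetric]
      by (intro factor_plus[OF assms(4)[unfolded is_Gamma'''_def Let_def]])
        (simp add: compatible_def False,
          simp add: s_plus_eq q_power_eq q_power_eq'[OF assms(1)] S False flip: of_real_power S_def,
          simp add: R T S False n,
          simp add: field_simps power2_eq_square power4_eq_xxxx S False n)
  qed
qed

text \<open>At this value of rho the coefficients c_1 and c_2 vanish, so only Omega_- is left in the
  first two rules and the relation removes it.\<close>

lemma Gamma'''_factor_Infty:
  assumes "N \<ge> 2" "\<rho> = 1 / s_plus' N q" "\<tau> \<noteq> 0" "is_Gamma''' N q \<rho> \<tau> C"
  shows "is_tilde_Gamma'' N q Infty (factor_calculus N q C Infty) \<and> star_calculus A (factor_calculus N q C Infty)"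
proof -
  have [simp]: "\<tau> \<noteq> 0" "s_plus' N q \<noteq> 0"
    using assms s_plus'_pos by auto
  have "is_tilde_Gamma'' N q Infty (factor_calculus N q C Infty) \<and> (lam_real Infty \<longrightarrow> star_calculus A (factor_calculus N q C Infty))"
    unfolding is_tilde_Gamma''_def Let_def ext_complex.case
    by (intro factor_plus[OF assms(4)[unfolded is_Gamma'''_def Let_def]])
      (simp add: compatible_def,
        simp add: assms(2) s_plus_eq q_power_eq q_power_eq'[OF assms(1)] flip: of_real_power,
        simp add: field_simps power2_eq_square power4_eq_xxxx)
  then show ?thesis by simp
qed

text \<open>Here c_1, c_2, e_1 and e_2 all vanish, so the first two rules contain no Omega term and
  put no condition on lambda.\<close>

lemma Gamma'''_factor_all:
  assumes "N \<ge> 2" "\<rho> = 1 / s_plus' N q" "\<tau> / q^2 = 1 / s_plus' N q" "is_Gamma''' N q \<rho> \<tau> C"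
  shows "is_tilde_Gamma'' N q (Fin l) (factor_calculus N q C (Fin l)) \<and> (l \<in> \<real> \<longrightarrow> star_calculus A (factor_calculus N q C (Fin l)))"
proof -
  have [simp]: "s_plus' N q \<noteq> 0"
    using assms s_plus'_pos by auto
  have t: "\<tau> = q^2 / s_plus' N q"
    using assms(3) by (simp add: field_simps)
  show ?thesis
  proof (cases "l = 0")
    case True
    show ?thesis
      unfolding is_tilde_Gamma''_def Let_def True ext_complex.case if_P[OF refl] lam_real.simps(1)[symmetric]
      by (intro factor_minus[OF assms(4)[unfolded is_Gamma'''_def Let_def]])
        (simp add: compatible_def,
          simp add: assms(2) s_plus_eq q_power_eq q_power_eq'[OF assms(1)] t flip: of_real_power,
          simp add: field_simps power2_eq_square power4_eq_xxxx)
  next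
    case False
    show ?thesis
      unfolding is_tilde_Gamma''_def Let_def ext_complex.case if_not_P[OF False] lam_real.simps(1)[symmetric]
      by (intro factor_plus[OF assms(4)[unfolded is_Gamma'''_def Let_def]])
        (simp add: compatible_def False,
          simp add: assms(2) s_plus_eq q_power_eq q_power_eq'[OF assms(1)] t False flip: of_real_power,
          simp add: field_simps power2_eq_square power4_eq_xxxx False)
  qed
qed

end

text \<open>Families being given up to isomorphism, an equality of calculi is expressed by the
  quotient meeting the specification and by its isomorphism to any D that meets it. The roots for
  \<open>is_Gamma''\<close> may be non-real, and the star property rests on reality of
  lambda.\<close>

theorem corollary5:
  fixes N :: nat and q :: real
    and C :: "(free_alg set, 'm) calculus"
    and C' :: "(free_alg set, 'n) calculus"
    and D :: "(free_alg set, 'k) calculus"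
  assumes "N \<ge> 2" and "q \<notin> {- 1, 0, 1}"
  shows
    "(\<forall>\<alpha> \<tau>. \<alpha> \<notin> {0, 1 / q^2} \<longrightarrow> is_Gamma N q \<alpha> \<tau> C \<longrightarrow>
        (let l = complex_of_real (1 / \<alpha>); B = factor_calculus N q C (Fin l) in
         star_calculus (sphere N q) B \<and> is_tilde_Gamma N q l B \<and>
         (is_tilde_Gamma N q l D \<longrightarrow> calculus_iso (sphere N q) B D))) \<and>
     (\<forall>\<alpha> \<omega>. \<alpha> \<notin> {0, 1 / q^2} \<longrightarrow> \<omega> \<noteq> 0 \<longrightarrow> is_Gamma' N q \<alpha> \<omega> C' \<longrightarrow>
        (let l = complex_of_real (1 / \<alpha>); B = factor_calculus N q C' (Fin l) in
         star_calculus (sphere N q) B \<and> is_tilde_Gamma N q l B \<and>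
         (is_tilde_Gamma N q l D \<longrightarrow> calculus_iso (sphere N q) B D))) \<and>
     (\<forall>\<alpha> \<tau> \<omega>. \<alpha> \<notin> {0, 1 / q^2} \<longrightarrow> \<omega> \<noteq> 0 \<longrightarrow>
        is_Gamma N q \<alpha> \<tau> C \<longrightarrow> is_Gamma' N q \<alpha> \<omega> C' \<longrightarrow>
        (let l = complex_of_real (1 / \<alpha>) in
         calculus_iso (sphere N q) (factor_calculus N q C (Fin l)) (factor_calculus N q C' (Fin l)))) \<and>
     (\<forall>\<omega> \<psi> (l::complex). \<omega> \<noteq> 0 \<longrightarrow> is_Gamma'' N q \<omega> \<psi> C \<longrightarrow>
        of_real (\<omega> / q^4) * l^2 - of_real (\<omega> * \<psi> / q^2) * l + 1 = 0 \<longrightarrow>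
        (let B = factor_calculus N q C (Fin l) in
         (l \<in> \<real> \<longrightarrow> star_calculus (sphere N q) B) \<and> is_tilde_Gamma' N q l B \<and>
         (is_tilde_Gamma' N q l D \<longrightarrow> calculus_iso (sphere N q) B D))) \<and>
     (\<forall>\<rho> \<tau>. \<rho> \<notin> {0, 1 / s_plus' N q} \<longrightarrow> \<tau> \<noteq> 0 \<longrightarrow> is_Gamma''' N q \<rho> \<tau> C \<longrightarrow>
        (let r1 = q^2 * \<tau> / \<rho>;
             r2 = q^2 * (s_plus' N q * \<tau> - q^2) / (s_plus' N q * \<rho> - 1);
             l1 = complex_of_real r1; l2 = complex_of_real r2;
             B1 = factor_calculus N q C (Fin l1); B2 = factor_calculus N q C (Fin l2) in
         (\<tau> = q^2 * \<rho> \<longrightarrow> r1 = q^4 \<and> r2 = q^4) \<and>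
         star_calculus (sphere N q) B1 \<and> is_tilde_Gamma' N q l1 B1 \<and>
         (is_tilde_Gamma' N q l1 D \<longrightarrow> calculus_iso (sphere N q) B1 D) \<and>
         star_calculus (sphere N q) B2 \<and> is_tilde_Gamma'' N q (Fin l2) B2 \<and>
         (is_tilde_Gamma'' N q (Fin l2) D \<longrightarrow> calculus_iso (sphere N q) B2 D))) \<and>
     (\<forall>\<rho> \<tau>. \<rho> = 1 / s_plus' N q \<longrightarrow> \<tau> \<notin> {0, q^2 / s_plus' N q} \<longrightarrow> is_Gamma''' N q \<rho> \<tau> C \<longrightarrow>
        (let l1 = complex_of_real (q^2 * \<tau> / \<rho>);
             B1 = factor_calculus N q C (Fin l1); B2 = factor_calculus N q C Infty in
         star_calculus (sphere N q) B1 \<and> is_tilde_Gamma' N q l1 B1 \<and>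
         (is_tilde_Gamma' N q l1 D \<longrightarrow> calculus_iso (sphere N q) B1 D) \<and>
         star_calculus (sphere N q) B2 \<and> is_tilde_Gamma'' N q Infty B2 \<and>
         (is_tilde_Gamma'' N q Infty D \<longrightarrow> calculus_iso (sphere N q) B2 D))) \<and>
     (\<forall>\<rho> \<tau>. \<rho> = 1 / s_plus' N q \<longrightarrow> \<tau> / q^2 = 1 / s_plus' N q \<longrightarrow> is_Gamma''' N q \<rho> \<tau> C \<longrightarrow>
        (\<forall>r. let l = complex_of_real r; B = factor_calculus N q C (Fin l) in
           star_calculus (sphere N q) B \<and> is_tilde_Gamma'' N q (Fin l) B \<and>
           (is_tilde_Gamma'' N q (Fin l) D \<longrightarrow> calculus_iso (sphere N q) B D)) \<and>
        (let B = factor_calculus N q C Infty in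
           star_calculus (sphere N q) B \<and> is_tilde_Gamma'' N q Infty B \<and>
           (is_tilde_Gamma'' N q Infty D \<longrightarrow> calculus_iso (sphere N q) B D)))"
proof -
  interpret quantum_sphere N q
    using assms(2) by unfold_locales auto
  note N = \<open>N \<ge> 2\<close>
  have s: "s_plus' N q \<noteq> 0"
    using s_plus'_pos[OF N] by simp
  show ?thesis
  proof (intro conjI allI impI, goal_cases)
    case (1 \<alpha> \<tau>)
    then show ?case
      using Gamma_factor[OF 1] unfolding Let_def by (blast intro: tilde_Gamma_unique Reals_of_real)
  next
    case (2 \<alpha> \<omega>)
    then show ?case
      using Gamma'_factor[OF 2] unfolding Let_def by (blast intro: tilde_Gamma_unique Reals_of_real)
  next
    case (3 \<alpha> \<tau> \<omega>)
    then show ?case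
      \<comment> \<open>Both quotients meet the same specification, which determines a calculus up
        to isomorphism.\<close>
      using Gamma_factor[OF 3(1,3)] Gamma'_factor[OF 3(1,2,4)] unfolding Let_def
      by (blast intro: tilde_Gamma_unique)
  next
    case (4 \<omega> \<psi> l)
    then show ?case
      using Gamma''_factor[OF 4] unfolding Let_def by (blast intro: tilde_Gamma'_unique)
  next
    case (5 \<rho> \<tau>)
    then have "\<rho> \<noteq> 0" "s_plus' N q * \<rho> - 1 \<noteq> 0"
      using s by (auto simp: field_simps)
    then have "q^2 * \<tau> / \<rho> = q^4 \<and> q^2 * (s_plus' N q * \<tau> - q^2) / (s_plus' N q * \<rho> - 1) = q^4"
      if "\<tau> = q^2 * \<rho>"
      unfolding that by (simp add: divide_eq_eq) (simp add: algebra_simps power2_eq_square power4_eq_xxxx)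
    then show ?case
      using Gamma'''_factor1[OF N \<open>\<rho> \<noteq> 0\<close> 5(2,3)] Gamma'''_factor2[OF N 5] unfolding Let_def
      by (blast intro: tilde_Gamma'_unique tilde_Gamma''_unique Reals_of_real)
  next
    case (6 \<rho> \<tau>)
    then have "\<rho> \<noteq> 0" "\<tau> \<noteq> 0"
      using s by auto
    then show ?case
      using Gamma'''_factor1[OF N _ _ 6(3)] Gamma'''_factor_Infty[OF N 6(1) _ 6(3)] unfolding Let_def
      by (blast intro: tilde_Gamma'_unique tilde_Gamma''_unique Reals_of_real)
  next
    case (7 \<rho> \<tau> r)
    then show ?case
      using Gamma'''_factor_all[OF N 7] unfolding Let_def
      by (blast intro: tilde_Gamma''_unique Reals_of_real)
  next
    case (8 \<rho> \<tau>)
    then have "\<tau> \<noteq> 0"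
      using s by auto
    then show ?case
      using Gamma'''_factor_Infty[OF N 8(1) _ 8(3)] unfolding Let_def
      by (blast intro: tilde_Gamma''_unique)
  qed
qed

end
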